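(* Let $(M,\overline g,\circ,e,\mathcal E)$ be a Frobenius manifold. Let $N$ be a hypersurface of $M$ (a submanifold of codimension one) such that the restricted metric $g:=\overline g|_{TN}$ is non-degenerate and flat. (a) If $e$ is not tangent to $N$, then the following are equivalent: (1) $N$ is a natural Frobenius submanifold of $M$; (2) $TN\circ TN\subseteq TN$ and $\overline\nabla=\nabla$. (b) If $e$ is tangent to $N$, then the following are equivalent: (1) $N$ is a natural Frobenius submanifold of $M$; (2) $TN\circ TN\subseteq TN$ and either $\overline\nabla=\nabla$ or $\mathcal E$ is tangent to $N$.
   Context: A Frobenius manifold $(M,\overline g,\circ,e,\mathcal E)$ consists of a manifold $M$ (in one of the standard categories: $C^\infty$, analytic, ...), a metric $\overline g=\langle\,,\rangle$ on $M$ (a symmetric, non-degenerate bilinear form on $TM$), a commutative and associative product $\circ$ on $TM$ depending smoothly on the point, with unit vector field $e$, and a vector field $\mathcal E$ (the Euler field) such that, with $\overline\nabla$ the Levi-Civita connection of $\overline g$: (a) $\overline\nabla$ is flat; (b) $\overline g(X\circ Y,Z)=\overline g(X,Y\circ Z)$ for all $X,Y,Z\in TM$; (c) $\overline\nabla e=0$; (d) with $c(X,Y,Z):=\overline g(X\circ Y,Z)$, the 4-tensor $(\overline\nabla_Z c)(U,V,W)$ is symmetric in $U,V,W,Z$; (e) $\overline\nabla(\overline\nabla\mathcal E)=0$, $\mathcal L_{\mathcal E}(\circ)=\circ$, and there is a constant $D\in\mathbb C$ with $\mathcal L_{\mathcal E}(\overline g)=D\cdot\overline g$. Let $N\subseteq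 M$ be a submanifold such that $g:=\overline g|_{TN}$ is non-degenerate, and let $\nabla$ be the Levi-Civita connection of $g$. Along $N$, let $TN^\bot$ be the $\overline g$-orthogonal complement of $TN$ in $TM|_N$ and $\mathrm{pr}:TM|_N\to TN$ the orthogonal projection. For $X,Y\in TN$ put $X*Y:=\mathrm{pr}(X\circ Y)$; put $e_N:=\mathrm{pr}(e|_N)$ and $\mathcal E_N:=\mathrm{pr}(\mathcal E|_N)$. $N$ is a Frobenius submanifold of $M$ if $(N,g,*,e_N,\mathcal E_N)$ is a Frobenius manifold (with its own constant, not assumed equal to $D$). A Frobenius submanifold $N$ is natural if $TN$ is left invariant by the product $\circ$, i.e. $TN\circ TN\subseteq TN$. The notation $\overline\nabla=\nabla$ means that $\overline\nabla_XY=\nabla_XY$ for all vector fields $X,Y$ tangent to $N$, i.e. the second fundamental form $h(X,Y)=\overline\nabla_XY-\nabla_XY$ vanishes ($N$ is totally geodesic). A vector field $V$ on $M$ is tangent to $N$ if $V|_N\in TN$.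
   Formalization: The hypersurface N is assumed connected; for disconnected N part (b) fails, since N can be a union of a totally geodesic piece to which the Euler field is not tangent and a non-totally-geodesic piece to which it is tangent. *)

theory Defs
  imports "HOL-Analysis.Analysis" "HOL-Library.Function_Algebras"
begin

text \<open>
  The ground field is a type of sort \<open>{real_normed_field, euclidean_space}\<close>, that is, the real or
  the complex numbers; the same definitions thus describe real $C^\infty$ manifolds and complex
  (holomorphic) manifolds.  The model space of dimension \<open>card I\<close> is the coordinate subspace of
  \<open>'k ^ 'n\<close> belonging to a set \<open>I\<close> of indices, so that a manifold and its submanifolds (possibly of
  dimension 0) are modelled inside one type.  Points carry the Hausdorff topology of their type,
  and subsets the subspace topology.
\<close>

type_synonym ('m, 'k, 'n) chart = "'m set \<times> ('m \<Rightarrow> 'k ^ 'n)"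

record ('m, 'k, 'n) manifold =
  pts :: "'m set"
  idx :: "'n set"
  atlas :: "('m, 'k, 'n) chart set"

definition coord_space :: "'n::finite set \<Rightarrow> ('k::zero ^ 'n) set" where
  "coord_space I = {x. \<forall>i. i \<notin> I \<longrightarrow> x $ i = 0}"

text \<open>
  The derivative is required to be linear over \<open>'k\<close>.  The set \<open>A\<close> is always a relatively open
  subset of \<open>coord_space I\<close>, so the functions \<open>f' i\<close> with \<open>i \<in> I\<close> are uniquely determined on \<open>A\<close>:
  they are the partial derivatives.
\<close>

primrec Ck_on :: "nat \<Rightarrow> 'n::finite set \<Rightarrow>
    ('k::{real_normed_field, euclidean_space} ^ 'n) set \<Rightarrow> ('k ^ 'n \<Rightarrow> 'k) \<Rightarrow> bool" where
  "Ck_on 0 I A f \<longleftrightarrow> continuous_on A f"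
| "Ck_on (Suc r) I A f \<longleftrightarrow>
     (\<exists>f'. (\<forall>x\<in>A. (f has_derivative (\<lambda>h. \<Sum>i\<in>I. h $ i * f' i x)) (at x within A)) \<and>
           (\<forall>i\<in>I. Ck_on r I A (f' i)))"

definition Cinf_on :: "'n::finite set \<Rightarrow>
    ('k::{real_normed_field, euclidean_space} ^ 'n) set \<Rightarrow> ('k ^ 'n \<Rightarrow> 'k) \<Rightarrow> bool" where
  "Cinf_on I A f \<longleftrightarrow> (\<forall>r. Ck_on r I A f)"

definition partial_deriv :: "'n::finite \<Rightarrow>
    ('k::{real_normed_field, euclidean_space} ^ 'n \<Rightarrow> 'k) \<Rightarrow> 'k ^ 'n \<Rightarrow> 'k" where
  "partial_deriv i f x = deriv (\<lambda>t. f (x + axis i t)) 0"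


section \<open>Manifolds and smooth functions\<close>

definition is_chart :: "'m::t2_space set \<Rightarrow> 'n::finite set \<Rightarrow>
    ('m, 'k::{real_normed_field, euclidean_space}, 'n) chart \<Rightarrow> bool" where
  "is_chart S I c \<longleftrightarrow> (case c of (U, \<kappa>) \<Rightarrow>
     openin (top_of_set S) U \<and>
     inj_on \<kappa> U \<and>
     openin (top_of_set (coord_space I)) (\<kappa> ` U) \<and>
     homeomorphism U (\<kappa> ` U) \<kappa> (inv_into U \<kappa>))"

definition smooth_transition :: "'n::finite set \<Rightarrow>
    ('m, 'k::{real_normed_field, euclidean_space}, 'n) chart \<Rightarrow> ('m, 'k, 'n) chart \<Rightarrow> bool" where
  "smooth_transition I c d \<longleftrightarrow> (case c of (U, \<kappa>) \<Rightarrow> case d of (V, \<mu>) \<Rightarrow>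
     \<forall>i\<in>I. Cinf_on I (\<kappa> ` (U \<inter> V)) (\<lambda>x. \<mu> (inv_into U \<kappa> x) $ i))"

definition is_manifold ::
    "('m::t2_space, 'k::{real_normed_field, euclidean_space}, 'n::finite) manifold \<Rightarrow> bool" where
  "is_manifold X \<longleftrightarrow>
     (\<forall>c\<in>atlas X. is_chart (pts X) (idx X) c) \<and>
     (\<Union>c\<in>atlas X. fst c) = pts X \<and>
     (\<forall>c\<in>atlas X. \<forall>d\<in>atlas X. smooth_transition (idx X) c d)"

definition max_atlas ::
    "('m::t2_space, 'k::{real_normed_field, euclidean_space}, 'n::finite) manifold \<Rightarrow>
     ('m, 'k, 'n) chart set" where
  "max_atlas X = {c. is_chart (pts X) (idx X) c \<and>
     (\<forall>d\<in>atlas X. smooth_transition (idx X) c d \<and> smooth_transition (idx X) d c)}"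

definition open_in ::
    "('m::t2_space, 'k::{real_normed_field, euclidean_space}, 'n::finite) manifold \<Rightarrow>
     'm set \<Rightarrow> bool" where
  "open_in X W \<longleftrightarrow> openin (top_of_set (pts X)) W"

definition smooth_fun ::
    "('m::t2_space, 'k::{real_normed_field, euclidean_space}, 'n::finite) manifold \<Rightarrow>
     'm set \<Rightarrow> ('m \<Rightarrow> 'k) \<Rightarrow> bool" where
  "smooth_fun X W f \<longleftrightarrow>
     (\<forall>(U, \<kappa>)\<in>atlas X. Cinf_on (idx X) (\<kappa> ` (U \<inter> W)) (\<lambda>x. f (inv_into U \<kappa> x)))"

definition smooth_near ::
    "('m::t2_space, 'k::{real_normed_field, euclidean_space}, 'n::finite) manifold \<Rightarrow>
     'm \<Rightarrow> ('m \<Rightarrow> 'k) \<Rightarrow> bool" where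
  "smooth_near X p f \<longleftrightarrow> (\<exists>W. open_in X W \<and> p \<in> W \<and> smooth_fun X W f)"


section \<open>Tangent vectors and vector fields\<close>

text \<open>
  A tangent vector at \<open>p\<close> is the operator of directional derivative on functions that are smooth
  near \<open>p\<close>, extended by 0 to all other functions; addition and zero of tangent vectors are the
  pointwise ones.  A vector field is a total function of which only the values on a given open
  set matter.
\<close>

type_synonym ('m, 'k) tvec = "('m \<Rightarrow> 'k) \<Rightarrow> 'k"
type_synonym ('m, 'k) vfield = "'m \<Rightarrow> ('m, 'k) tvec"

definition smul :: "'k::times \<Rightarrow> ('m, 'k) tvec \<Rightarrow> ('m, 'k) tvec" (infixr "\<bullet>\<^sub>v" 75) where
  "a \<bullet>\<^sub>v v = (\<lambda>f. a * v f)"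

definition tangent_vector ::
    "('m::t2_space, 'k::{real_normed_field, euclidean_space}, 'n::finite) manifold \<Rightarrow>
     ('m, 'k, 'n) chart \<Rightarrow> 'm \<Rightarrow> 'k ^ 'n \<Rightarrow> ('m, 'k) tvec" where
  "tangent_vector X c p a = (case c of (U, \<kappa>) \<Rightarrow>
     (\<lambda>f. if smooth_near X p f
          then \<Sum>i\<in>idx X. a $ i * partial_deriv i (\<lambda>x. f (inv_into U \<kappa> x)) (\<kappa> p) else 0))"

definition tangent_space ::
    "('m::t2_space, 'k::{real_normed_field, euclidean_space}, 'n::finite) manifold \<Rightarrow>
     'm \<Rightarrow> ('m, 'k) tvec set" where
  "tangent_space X p = {tangent_vector X c p a | c a. c \<in> atlas X \<and> p \<in> fst c}"

definition vector_field ::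
    "('m::t2_space, 'k::{real_normed_field, euclidean_space}, 'n::finite) manifold \<Rightarrow>
     'm set \<Rightarrow> ('m, 'k) vfield \<Rightarrow> bool" where
  "vector_field X W V \<longleftrightarrow> open_in X W \<and>
     (\<forall>p\<in>W. V p \<in> tangent_space X p) \<and>
     (\<forall>W' f. open_in X W' \<and> W' \<subseteq> W \<and> smooth_fun X W' f \<longrightarrow> smooth_fun X W' (\<lambda>p. V p f))"

definition lie_bracket ::
    "('m::t2_space, 'k::{real_normed_field, euclidean_space}, 'n::finite) manifold \<Rightarrow>
     ('m, 'k) vfield \<Rightarrow> ('m, 'k) vfield \<Rightarrow> ('m, 'k) vfield" where
  "lie_bracket X V W p =
     (\<lambda>f. if smooth_near X p f then V p (\<lambda>q. W q f) - W p (\<lambda>q. V q f) else 0)"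


section \<open>Metrics, Levi-Civita connections, multiplications\<close>

type_synonym ('m, 'k) metric_field = "'m \<Rightarrow> ('m, 'k) tvec \<Rightarrow> ('m, 'k) tvec \<Rightarrow> 'k"
type_synonym ('m, 'k) product_field = "'m \<Rightarrow> ('m, 'k) tvec \<Rightarrow> ('m, 'k) tvec \<Rightarrow> ('m, 'k) tvec"
type_synonym ('m, 'k) covd = "('m, 'k) vfield \<Rightarrow> ('m, 'k) vfield \<Rightarrow> ('m, 'k) vfield"

text \<open>Linearity in the second argument follows from symmetry, here and for multiplications.\<close>

definition is_metric ::
    "('m::t2_space, 'k::{real_normed_field, euclidean_space}, 'n::finite) manifold \<Rightarrow>
     ('m, 'k) metric_field \<Rightarrow> bool" where
  "is_metric X g \<longleftrightarrow>
     (\<forall>p\<in>pts X. \<forall>u\<in>tangent_space X p. \<forall>v\<in>tangent_space X p. g p u v = g p v u) \<and>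
     (\<forall>p\<in>pts X. \<forall>u\<in>tangent_space X p. \<forall>u'\<in>tangent_space X p. \<forall>v\<in>tangent_space X p.
        g p (u + u') v = g p u v + g p u' v) \<and>
     (\<forall>p\<in>pts X. \<forall>u\<in>tangent_space X p. \<forall>v\<in>tangent_space X p. \<forall>a.
        g p (a \<bullet>\<^sub>v u) v = a * g p u v) \<and>
     (\<forall>p\<in>pts X. \<forall>u\<in>tangent_space X p. (\<forall>v\<in>tangent_space X p. g p u v = 0) \<longrightarrow> u = 0) \<and>
     (\<forall>W Y Z. vector_field X W Y \<and> vector_field X W Z \<longrightarrow>
        smooth_fun X W (\<lambda>p. g p (Y p) (Z p)))"

definition is_multiplication ::
    "('m::t2_space, 'k::{real_normed_field, euclidean_space}, 'n::finite) manifold \<Rightarrow>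
     ('m, 'k) product_field \<Rightarrow> bool" where
  "is_multiplication X m \<longleftrightarrow>
     (\<forall>p\<in>pts X. \<forall>u\<in>tangent_space X p. \<forall>v\<in>tangent_space X p. m p u v \<in> tangent_space X p) \<and>
     (\<forall>p\<in>pts X. \<forall>u\<in>tangent_space X p. \<forall>v\<in>tangent_space X p. m p u v = m p v u) \<and>
     (\<forall>p\<in>pts X. \<forall>u\<in>tangent_space X p. \<forall>u'\<in>tangent_space X p. \<forall>v\<in>tangent_space X p.
        m p (u + u') v = m p u v + m p u' v) \<and>
     (\<forall>p\<in>pts X. \<forall>u\<in>tangent_space X p. \<forall>v\<in>tangent_space X p. \<forall>a.
        m p (a \<bullet>\<^sub>v u) v = a \<bullet>\<^sub>v m p u v) \<and>
     (\<forall>p\<in>pts X. \<forall>u\<in>tangent_space X p. \<forall>v\<in>tangent_space X p. \<forall>w\<in>tangent_space X p.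
        m p (m p u v) w = m p u (m p v w)) \<and>
     (\<forall>W Y Z. vector_field X W Y \<and> vector_field X W Z \<longrightarrow>
        vector_field X W (\<lambda>p. m p (Y p) (Z p)))"

text \<open>
  A connection acts on vector fields over arbitrary open sets, compatibly with restriction
  (first two conditions); in the holomorphic category global vector fields would not suffice.
\<close>

definition is_connection ::
    "('m::t2_space, 'k::{real_normed_field, euclidean_space}, 'n::finite) manifold \<Rightarrow>
     ('m, 'k) covd \<Rightarrow> bool" where
  "is_connection X D \<longleftrightarrow>
     (\<forall>W Y Z. vector_field X W Y \<and> vector_field X W Z \<longrightarrow> vector_field X W (D Y Z)) \<and>
     (\<forall>W Y Y' Z Z'. vector_field X W Y \<and> vector_field X W Z \<and>
        (\<forall>p\<in>W. Y' p = Y p \<and> Z' p = Z p) \<longrightarrow> (\<forall>p\<in>W. D Y' Z' p = D Y Z p)) \<and>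
     (\<forall>W Y Y' Z. vector_field X W Y \<and> vector_field X W Y' \<and> vector_field X W Z \<longrightarrow>
        (\<forall>p\<in>W. D (\<lambda>q. Y q + Y' q) Z p = D Y Z p + D Y' Z p)) \<and>
     (\<forall>W f Y Z. smooth_fun X W f \<and> vector_field X W Y \<and> vector_field X W Z \<longrightarrow>
        (\<forall>p\<in>W. D (\<lambda>q. f q \<bullet>\<^sub>v Y q) Z p = f p \<bullet>\<^sub>v D Y Z p)) \<and>
     (\<forall>W Y Z Z'. vector_field X W Y \<and> vector_field X W Z \<and> vector_field X W Z' \<longrightarrow>
        (\<forall>p\<in>W. D Y (\<lambda>q. Z q + Z' q) p = D Y Z p + D Y Z' p)) \<and>
     (\<forall>W f Y Z. smooth_fun X W f \<and> vector_field X W Y \<and> vector_field X W Z \<longrightarrow>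
        (\<forall>p\<in>W. D Y (\<lambda>q. f q \<bullet>\<^sub>v Z q) p = f p \<bullet>\<^sub>v D Y Z p + Y p f \<bullet>\<^sub>v Z p))"

definition is_levi_civita ::
    "('m::t2_space, 'k::{real_normed_field, euclidean_space}, 'n::finite) manifold \<Rightarrow>
     ('m, 'k) metric_field \<Rightarrow> ('m, 'k) covd \<Rightarrow> bool" where
  "is_levi_civita X g D \<longleftrightarrow> is_connection X D \<and>
     (\<forall>W Y Z. vector_field X W Y \<and> vector_field X W Z \<longrightarrow>
        (\<forall>p\<in>W. D Y Z p - D Z Y p = lie_bracket X Y Z p)) \<and>
     (\<forall>W Y Z Z'. vector_field X W Y \<and> vector_field X W Z \<and> vector_field X W Z' \<longrightarrow>
        (\<forall>p\<in>W. Y p (\<lambda>q. g q (Z q) (Z' q)) = g p (D Y Z p) (Z' p) + g p (Z p) (D Y Z' p)))"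

definition is_flat ::
    "('m::t2_space, 'k::{real_normed_field, euclidean_space}, 'n::finite) manifold \<Rightarrow>
     ('m, 'k) covd \<Rightarrow> bool" where
  "is_flat X D \<longleftrightarrow>
     (\<forall>W U V Z. vector_field X W U \<and> vector_field X W V \<and> vector_field X W Z \<longrightarrow>
        (\<forall>p\<in>W. D U (D V Z) p - D V (D U Z) p - D (lie_bracket X U V) Z p = 0))"


section \<open>Frobenius manifolds\<close>

definition ctensor :: "('m, 'k) metric_field \<Rightarrow> ('m, 'k) product_field \<Rightarrow>
    'm \<Rightarrow> ('m, 'k) tvec \<Rightarrow> ('m, 'k) tvec \<Rightarrow> ('m, 'k) tvec \<Rightarrow> 'k" where
  "ctensor g m p u v w = g p (m p u v) w"

definition nabla_c :: "('m, 'k::ring) metric_field \<Rightarrow> ('m, 'k) product_field \<Rightarrow> ('m, 'k) covd \<Rightarrow>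
    ('m, 'k) vfield \<Rightarrow> ('m, 'k) vfield \<Rightarrow> ('m, 'k) vfield \<Rightarrow> ('m, 'k) vfield \<Rightarrow> 'm \<Rightarrow> 'k" where
  "nabla_c g m D Z U V W p =
     Z p (\<lambda>q. ctensor g m q (U q) (V q) (W q))
     - ctensor g m p (D Z U p) (V p) (W p)
     - ctensor g m p (U p) (D Z V p) (W p)
     - ctensor g m p (U p) (V p) (D Z W p)"

text \<open>
  Total symmetry in \<open>U, V, W, Z\<close> is expressed by the three adjacent transpositions, which
  generate the symmetric group.  Lie derivatives along \<open>E\<close> of the multiplication and of the metric
  are written out by the Leibniz rule.
\<close>

definition frobenius_manifold ::
    "('m::t2_space, 'k::{real_normed_field, euclidean_space}, 'n::finite) manifold \<Rightarrow>
     ('m, 'k) metric_field \<Rightarrow> ('m, 'k) product_field \<Rightarrow> ('m, 'k) vfield \<Rightarrow> ('m, 'k) vfield \<Rightarrow>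
     bool" where
  "frobenius_manifold X g m e E \<longleftrightarrow>
     is_manifold X \<and> is_metric X g \<and> is_multiplication X m \<and>
     vector_field X (pts X) e \<and> vector_field X (pts X) E \<and>
     (\<forall>p\<in>pts X. \<forall>u\<in>tangent_space X p. m p (e p) u = u) \<and>
     (\<exists>D. is_levi_civita X g D \<and>
        is_flat X D \<and>
        (\<forall>p\<in>pts X. \<forall>u\<in>tangent_space X p. \<forall>v\<in>tangent_space X p. \<forall>w\<in>tangent_space X p.
           g p (m p u v) w = g p u (m p v w)) \<and>
        (\<forall>A Y. vector_field X A Y \<longrightarrow> (\<forall>p\<in>A. D Y e p = 0)) \<and>
        (\<forall>A U V W Z. vector_field X A U \<and> vector_field X A V \<and>
             vector_field X A W \<and> vector_field X A Z \<longrightarrow>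
           (\<forall>p\<in>A. nabla_c g m D Z U V W p = nabla_c g m D U Z V W p \<and>
                  nabla_c g m D Z U V W p = nabla_c g m D Z V U W p \<and>
                  nabla_c g m D Z U V W p = nabla_c g m D Z U W V p)) \<and>
        (\<forall>A Y Z. vector_field X A Y \<and> vector_field X A Z \<longrightarrow>
           (\<forall>p\<in>A. D Y (D Z E) p - D (D Y Z) E p = 0)) \<and>
        (\<forall>A Y Z. vector_field X A Y \<and> vector_field X A Z \<longrightarrow>
           (\<forall>p\<in>A. lie_bracket X E (\<lambda>q. m q (Y q) (Z q)) p
                   - m p (lie_bracket X E Y p) (Z p) - m p (Y p) (lie_bracket X E Z p)
                 = m p (Y p) (Z p))) \<and>
        (\<exists>d. \<forall>A Y Z. vector_field X A Y \<and> vector_field X A Z \<longrightarrow>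
           (\<forall>p\<in>A. E p (\<lambda>q. g q (Y q) (Z q))
                   - g p (lie_bracket X E Y p) (Z p) - g p (Y p) (lie_bracket X E Z p)
                 = d * g p (Y p) (Z p))))"


section \<open>Submanifolds\<close>

text \<open>
  Embedded submanifolds, given by slice charts.  The chart of the submanifold induced by a slice
  chart \<open>(U, \<kappa>)\<close> is \<open>\<kappa>\<close> itself, on the smaller domain.
\<close>

definition slice_charts ::
    "('m::t2_space, 'k::{real_normed_field, euclidean_space}, 'n::finite) manifold \<Rightarrow>
     'm set \<Rightarrow> 'n set \<Rightarrow> ('m, 'k, 'n) chart set" where
  "slice_charts M S J =
     {(U, \<kappa>). (U, \<kappa>) \<in> max_atlas M \<and> \<kappa> ` (U \<inter> S) = \<kappa> ` U \<inter> coord_space J}"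

definition submanifold ::
    "('m::t2_space, 'k::{real_normed_field, euclidean_space}, 'n::finite) manifold \<Rightarrow>
     ('m, 'k, 'n) manifold \<Rightarrow> bool" where
  "submanifold M N \<longleftrightarrow> pts N \<subseteq> pts M \<and> idx N \<subseteq> idx M \<and>
     (\<forall>p\<in>pts N. \<exists>c\<in>slice_charts M (pts N) (idx N). p \<in> fst c) \<and>
     atlas N = {(U \<inter> pts N, \<kappa>) | U \<kappa>. (U, \<kappa>) \<in> slice_charts M (pts N) (idx N)}"

definition hypersurface ::
    "('m::t2_space, 'k::{real_normed_field, euclidean_space}, 'n::finite) manifold \<Rightarrow>
     ('m, 'k, 'n) manifold \<Rightarrow> bool" where
  "hypersurface M N \<longleftrightarrow> submanifold M N \<and> card (idx M) = card (idx N) + 1"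

text \<open>The differential of the inclusion, sending a derivation on \<open>N\<close> to its action on restrictions.\<close>

definition incl ::
    "('m::t2_space, 'k::{real_normed_field, euclidean_space}, 'n::finite) manifold \<Rightarrow>
     'm \<Rightarrow> ('m, 'k) tvec \<Rightarrow> ('m, 'k) tvec" where
  "incl M p v = (\<lambda>f. if smooth_near M p f then v f else 0)"

definition sub_tangent_space ::
    "('m::t2_space, 'k::{real_normed_field, euclidean_space}, 'n::finite) manifold \<Rightarrow>
     ('m, 'k, 'n) manifold \<Rightarrow> 'm \<Rightarrow> ('m, 'k) tvec set" where
  "sub_tangent_space M N p = incl M p ` tangent_space N p"

definition tangent_to ::
    "('m::t2_space, 'k::{real_normed_field, euclidean_space}, 'n::finite) manifold \<Rightarrow>
     ('m, 'k, 'n) manifold \<Rightarrow> ('m, 'k) vfield \<Rightarrow> bool" where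
  "tangent_to M N V \<longleftrightarrow> (\<forall>p\<in>pts N. V p \<in> sub_tangent_space M N p)"

definition restrict_metric ::
    "('m::t2_space, 'k::{real_normed_field, euclidean_space}, 'n::finite) manifold \<Rightarrow>
     ('m, 'k) metric_field \<Rightarrow> ('m, 'k) metric_field" where
  "restrict_metric M g p u v = g p (incl M p u) (incl M p v)"

definition nondegenerate ::
    "('m::t2_space, 'k::{real_normed_field, euclidean_space}, 'n::finite) manifold \<Rightarrow>
     ('m, 'k) metric_field \<Rightarrow> bool" where
  "nondegenerate X g \<longleftrightarrow>
     (\<forall>p\<in>pts X. \<forall>u\<in>tangent_space X p. (\<forall>v\<in>tangent_space X p. g p u v = 0) \<longrightarrow> u = 0)"

text \<open>
  Orthogonal projection, with values in the tangent space of \<open>N\<close> itself: \<open>w\<close> and the image of its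
  projection have the same products with all vectors tangent to \<open>N\<close>.
\<close>

definition pr ::
    "('m::t2_space, 'k::{real_normed_field, euclidean_space}, 'n::finite) manifold \<Rightarrow>
     ('m, 'k, 'n) manifold \<Rightarrow> ('m, 'k) metric_field \<Rightarrow> 'm \<Rightarrow> ('m, 'k) tvec \<Rightarrow> ('m, 'k) tvec" where
  "pr M N g p w = (THE u. u \<in> tangent_space N p \<and>
     (\<forall>v\<in>sub_tangent_space M N p. g p (w - incl M p u) v = 0))"

definition proj_product ::
    "('m::t2_space, 'k::{real_normed_field, euclidean_space}, 'n::finite) manifold \<Rightarrow>
     ('m, 'k, 'n) manifold \<Rightarrow> ('m, 'k) metric_field \<Rightarrow> ('m, 'k) product_field \<Rightarrow>
     ('m, 'k) product_field" where
  "proj_product M N g m p u v = pr M N g p (m p (incl M p u) (incl M p v))"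

definition proj_field ::
    "('m::t2_space, 'k::{real_normed_field, euclidean_space}, 'n::finite) manifold \<Rightarrow>
     ('m, 'k, 'n) manifold \<Rightarrow> ('m, 'k) metric_field \<Rightarrow> ('m, 'k) vfield \<Rightarrow> ('m, 'k) vfield" where
  "proj_field M N g V p = pr M N g p (V p)"

definition product_invariant ::
    "('m::t2_space, 'k::{real_normed_field, euclidean_space}, 'n::finite) manifold \<Rightarrow>
     ('m, 'k, 'n) manifold \<Rightarrow> ('m, 'k) product_field \<Rightarrow> bool" where
  "product_invariant M N m \<longleftrightarrow>
     (\<forall>p\<in>pts N. \<forall>u\<in>sub_tangent_space M N p. \<forall>v\<in>sub_tangent_space M N p.
        m p u v \<in> sub_tangent_space M N p)"

definition frobenius_submanifold ::
    "('m::t2_space, 'k::{real_normed_field, euclidean_space}, 'n::finite) manifold \<Rightarrow>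
     ('m, 'k, 'n) manifold \<Rightarrow>
     ('m, 'k) metric_field \<Rightarrow> ('m, 'k) product_field \<Rightarrow> ('m, 'k) vfield \<Rightarrow> ('m, 'k) vfield \<Rightarrow>
     bool" where
  "frobenius_submanifold M N g m e E \<longleftrightarrow>
     submanifold M N \<and> nondegenerate N (restrict_metric M g) \<and>
     frobenius_manifold N (restrict_metric M g) (proj_product M N g m)
       (proj_field M N g e) (proj_field M N g E)"

definition natural_frobenius_submanifold ::
    "('m::t2_space, 'k::{real_normed_field, euclidean_space}, 'n::finite) manifold \<Rightarrow>
     ('m, 'k, 'n) manifold \<Rightarrow>
     ('m, 'k) metric_field \<Rightarrow> ('m, 'k) product_field \<Rightarrow> ('m, 'k) vfield \<Rightarrow> ('m, 'k) vfield \<Rightarrow>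
     bool" where
  "natural_frobenius_submanifold M N g m e E \<longleftrightarrow>
     frobenius_submanifold M N g m e E \<and> product_invariant M N m"

text \<open>
  Equality of the two connections on vector fields tangent to \<open>N\<close>: the fields \<open>Y'\<close>, \<open>Z'\<close> on an open
  subset of \<open>M\<close> extend the fields \<open>Y\<close>, \<open>Z\<close> on \<open>N\<close>.
\<close>

definition connections_agree ::
    "('m::t2_space, 'k::{real_normed_field, euclidean_space}, 'n::finite) manifold \<Rightarrow>
     ('m, 'k, 'n) manifold \<Rightarrow> ('m, 'k) covd \<Rightarrow> ('m, 'k) covd \<Rightarrow> bool" where
  "connections_agree M N DM DN \<longleftrightarrow>
     (\<forall>W Y Z Y' Z'.
        vector_field M W Y' \<and> vector_field M W Z' \<and>
        vector_field N (W \<inter> pts N) Y \<and> vector_field N (W \<inter> pts N) Z \<and>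
        (\<forall>p\<in>W \<inter> pts N. Y' p = incl M p (Y p) \<and> Z' p = incl M p (Z p)) \<longrightarrow>
        (\<forall>p\<in>W \<inter> pts N. DM Y' Z' p = incl M p (DN Y Z p)))"

end

theory Submission
  imports Defs
begin

text \<open>
  Write \<open>h\<close> for the second fundamental form of the hypersurface \<open>N\<close> and assume \<open>TN \<circ> TN \<subseteq> TN\<close>.
  Everything turns on one question: is \<open>h\<close> orthogonal to the normal parts \<open>e - e\<^sub>N\<close> and \<open>\<E> - \<E>\<^sub>N\<close> of
  the two distinguished fields?  For a hypersurface, \<open>h\<close> is orthogonal to a normal vector \<open>\<nu>\<close> at a
  point iff \<open>\<nu> = 0\<close> or \<open>h = 0\<close> there.

  If \<open>h\<close> is orthogonal to both normal parts, then \<open>N\<close> is a Frobenius manifold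
  (\<open>frobenius_if_sff_orthogonal\<close>).  By Weingarten's equation the connections of \<open>M\<close> and \<open>N\<close> then give
  the same tangential derivatives of \<open>e\<close> and \<open>e\<^sub>N\<close>, and of \<open>\<E>\<close> and \<open>\<E>\<^sub>N\<close>, so that most axioms restrict
  to \<open>N\<close>.  Two of them need more.  \<open>\<nabla>(\<nabla>\<E>\<^sub>N) = 0\<close> follows on the flat manifold \<open>N\<close> from the homothety
  equation alone (\<open>homothetic_imp_affine\<close>).  The Lie derivative of the product along \<open>\<E>\<close> contains
  \<open>\<nabla>\<^sub>\<nu>c\<close> in the normal direction \<open>\<nu> = \<E> - \<E>\<^sub>N\<close>; the symmetry of \<open>\<nabla>c\<close> turns it into a derivative of \<open>c(\<nu>, \<cdot>, \<cdot>)\<close>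
  in a tangential direction, which vanishes (\<open>nabla_c_normal\<close>).

  Conversely, let \<open>N\<close> be a natural Frobenius submanifold.  Then \<open>\<nabla>e\<^sub>N = 0\<close> makes \<open>h\<close> orthogonal to
  \<open>e - e\<^sub>N\<close>.  Since \<open>TN\<close> is a subalgebra, the normal part of \<open>e\<close> annihilates \<open>TN\<close>, and tangency of \<open>e\<close>
  is an open and closed condition (\<open>e_tangent_dichotomy\<close>); so \<open>e\<close>, if not tangent to the connected
  manifold \<open>N\<close>, is tangent at no point, and \<open>h = 0\<close>.  If \<open>e\<close> is tangent, then the homothety equations
  of \<open>M\<close> and \<open>N\<close> show that \<open>g(h, \<E> - \<E>\<^sub>N)\<close> is a constant multiple of \<open>g\<close>; but \<open>h(e, \<cdot>) = 0\<close> since \<open>e\<close>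
  is parallel, so the constant is 0 (\<open>frobenius_imp_sff_orthogonal_E\<close>).

  What remains, if \<open>e\<close> is tangent, is to pass from the pointwise alternative \<open>\<E>\<^sub>p \<in> T\<^sub>pN\<close> or \<open>h\<^sub>p = 0\<close> to a
  global one; for smooth functions a vanishing product does not suffice.  Let \<open>a = g(\<E>, \<xi>)\<close> with \<open>\<xi>\<close> a
  normal field, so that \<open>a h = 0\<close>.  On the open set where the 1-jet of \<open>a\<close> does not vanish, \<open>h\<close> is 0 and
  \<open>\<nabla>(\<nabla>\<E>) = 0\<close> becomes a linear equation for the second derivatives of \<open>a\<close> in terms of its 1-jet.  By
  Gronwall's argument the 1-jet vanishes near each point identically or nowhere
  (\<open>jet_zero_dichotomy\<close>, \<open>E_local_dichotomy\<close>), and \<open>N\<close> is connected.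

  Fields of \<open>N\<close> and of \<open>M\<close> are compared through extensions: in a slice chart, functions and vector
  fields of \<open>N\<close> extend to \<open>M\<close>, and by Koszul's formula \<open>\<nabla>\<^sub>YZ\<close> is the tangential part of the derivative of
  the extensions (\<open>DM_tangential_part\<close>).
\<close>

section \<open>Smooth functions on open subsets of a coordinate space\<close>

lemma Ck_on_subset: "Ck_on r I A f \<Longrightarrow> B \<subseteq> A \<Longrightarrow> Ck_on r I B f"
proof (induction r arbitrary: f)
  case 0
  then show ?case by (auto intro: continuous_on_subset)
next
  case (Suc r)
  from Suc.prems(1) obtain f' where f':
      "\<forall>x\<in>A. (f has_derivative (\<lambda>h. \<Sum>i\<in>I. h $ i * f' i x)) (at x within A)"
      "\<forall>i\<in>I. Ck_on r I A (f' i)"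
    by auto
  have "\<forall>x\<in>B. (f has_derivative (\<lambda>h. \<Sum>i\<in>I. h $ i * f' i x)) (at x within B)"
    using f'(1) Suc.prems(2) by (meson has_derivative_subset subset_eq)
  then show ?case using Suc f' by auto
qed

lemma Ck_on_cong:
  assumes "Ck_on r I A f" and "\<And>x. x \<in> A \<Longrightarrow> g x = f x"
  shows "Ck_on r I A g"
proof (cases r)
  case 0
  then show ?thesis using assms by (simp cong: continuous_on_cong)
next
  case (Suc r')
  with assms(1) obtain f' where f':
      "\<forall>x\<in>A. (f has_derivative (\<lambda>h. \<Sum>i\<in>I. h $ i * f' i x)) (at x within A)"
      "\<forall>i\<in>I. Ck_on r' I A (f' i)"
    by auto
  have "\<forall>x\<in>A. (g has_derivative (\<lambda>h. \<Sum>i\<in>I. h $ i * f' i x)) (at x within A)"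
    using f'(1) assms(2) by (meson has_derivative_transform)
  with f'(2) Suc show ?thesis by auto
qed

lemma Ck_on_SucD: "Ck_on (Suc r) I A f \<Longrightarrow> Ck_on r I A f"
proof (induction r arbitrary: f)
  case 0
  then have "\<And>x. x \<in> A \<Longrightarrow> \<exists>D. (f has_derivative D) (at x within A)"
    unfolding Ck_on.simps by blast
  then have "continuous (at x within A) f" if "x \<in> A" for x
    using has_derivative_continuous that by blast
  then show ?case
    by (simp add: continuous_on_eq_continuous_within)
next
  case (Suc r)
  from Suc.prems obtain f' where
      "\<forall>x\<in>A. (f has_derivative (\<lambda>h. \<Sum>i\<in>I. h $ i * f' i x)) (at x within A)"
      "\<forall>i\<in>I. Ck_on (Suc r) I A (f' i)"
    unfolding Ck_on.simps(2)[of "Suc r"] by blast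
  then show ?case using Suc.IH unfolding Ck_on.simps(2)[of r] by blast
qed

lemma Ck_on_SucI:
  assumes "\<And>x. x \<in> A \<Longrightarrow> (f has_derivative D x) (at x within A)"
    and "\<And>x h. x \<in> A \<Longrightarrow> D x h = (\<Sum>i\<in>I. h $ i * f' i x)"
    and "\<And>i. i \<in> I \<Longrightarrow> Ck_on r I A (f' i)"
  shows "Ck_on (Suc r) I A f"
proof -
  have "\<forall>x\<in>A. (f has_derivative (\<lambda>h. \<Sum>i\<in>I. h $ i * f' i x)) (at x within A)"
    using assms(1,2) by (metis (no_types, lifting) ext)
  then show ?thesis using assms(3) by auto
qed

lemma Ck_on_const [simp]: "Ck_on r I A (\<lambda>x. c)"
proof (induction r arbitrary: c)
  case (Suc r)
  then show ?case
    by (intro Ck_on_SucI[where f' = "\<lambda>_ _. 0" and D = "\<lambda>_ _. 0"]) auto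
qed simp

lemma Ck_on_add:
  "Ck_on r I A f \<Longrightarrow> Ck_on r I A g \<Longrightarrow> Ck_on r I A (\<lambda>x. f x + g x)"
proof (induction r arbitrary: f g)
  case 0
  then show ?case by (auto intro: continuous_intros)
next
  case (Suc r)
  obtain f' g' where
      "\<forall>x\<in>A. (f has_derivative (\<lambda>h. \<Sum>i\<in>I. h $ i * f' i x)) (at x within A)"
      "\<forall>i\<in>I. Ck_on r I A (f' i)"
      "\<forall>x\<in>A. (g has_derivative (\<lambda>h. \<Sum>i\<in>I. h $ i * g' i x)) (at x within A)"
      "\<forall>i\<in>I. Ck_on r I A (g' i)"
    using Suc.prems by auto
  then show ?case
    by (intro Ck_on_SucI[where f' = "\<lambda>i x. f' i x + g' i x", OF has_derivative_add])
       (auto simp: algebra_simps sum.distrib intro: Suc.IH)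
qed

lemma Ck_on_mult:
  "Ck_on r I A f \<Longrightarrow> Ck_on r I A g \<Longrightarrow> Ck_on r I A (\<lambda>x. f x * g x)"
proof (induction r arbitrary: f g)
  case 0
  then show ?case by (auto intro: continuous_intros)
next
  case (Suc r)
  obtain f' g' where
      "\<forall>x\<in>A. (f has_derivative (\<lambda>h. \<Sum>i\<in>I. h $ i * f' i x)) (at x within A)"
      "\<forall>i\<in>I. Ck_on r I A (f' i)"
      "\<forall>x\<in>A. (g has_derivative (\<lambda>h. \<Sum>i\<in>I. h $ i * g' i x)) (at x within A)"
      "\<forall>i\<in>I. Ck_on r I A (g' i)"
    using Suc.prems by auto
  moreover have "Ck_on r I A f" "Ck_on r I A g"
    using Suc.prems Ck_on_SucD by blast+
  ultimately show ?case
    by (intro Ck_on_SucI[where D = "\<lambda>x h. f x * (\<Sum>i\<in>I. h $ i * g' i x) + (\<Sum>i\<in>I. h $ i * f' i x) * g x"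
          and f' = "\<lambda>i x. f x * g' i x + f' i x * g x"] has_derivative_mult Ck_on_add Suc.IH)
       (simp_all add: sum.distrib sum_distrib_left sum_distrib_right distrib_left mult_ac)
qed

lemma Ck_on_uminus: "Ck_on r I A f \<Longrightarrow> Ck_on r I A (\<lambda>x. - f x)"
  using Ck_on_mult[OF Ck_on_const[of r I A "-1"], of f] by simp

lemma Ck_on_sum:
  "(\<And>s. s \<in> S \<Longrightarrow> Ck_on r I A (f s)) \<Longrightarrow> Ck_on r I A (\<lambda>x. \<Sum>s\<in>S. f s x)"
  by (induction S rule: infinite_finite_induct) (auto intro: Ck_on_add)

lemma Ck_on_inverse:
  assumes "\<And>x. x \<in> A \<Longrightarrow> f x \<noteq> 0"
  shows "Ck_on r I A f \<Longrightarrow> Ck_on r I A (\<lambda>x. inverse (f x))"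
proof (induction r)
  case 0
  then show ?case using assms by (auto intro: continuous_intros)
next
  case (Suc r)
  obtain f' where f':
      "\<forall>x\<in>A. (f has_derivative (\<lambda>h. \<Sum>i\<in>I. h $ i * f' i x)) (at x within A)"
      "\<forall>i\<in>I. Ck_on r I A (f' i)"
    using Suc.prems by auto
  have "Ck_on r I A (\<lambda>x. inverse (f x))"
    using Suc.IH Suc.prems Ck_on_SucD by blast
  then have C: "Ck_on r I A (\<lambda>x. - (inverse (f x) * f' i x * inverse (f x)))" if "i \<in> I" for i
    using f'(2) that by (intro Ck_on_uminus Ck_on_mult) auto
  have "((\<lambda>x. inverse (f x)) has_derivative
      (\<lambda>h. - (inverse (f x) * (\<Sum>i\<in>I. h $ i * f' i x) * inverse (f x)))) (at x within A)" if "x \<in> A" for x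
    using Deriv.has_derivative_inverse[OF assms[OF that] bspec[OF f'(1) that]] .
  then show ?case
    by (rule Ck_on_SucI[OF _ _ C]) (simp_all add: sum_distrib_left sum_distrib_right sum_negf mult_ac)
qed

lemma has_derivative_nth [derivative_intros]:
  "((\<lambda>x. x $ j) has_derivative (\<lambda>h. h $ j)) F"
  by (rule bounded_linear_imp_has_derivative) (rule bounded_linear_vec_nth)

lemma Ck_on_coord:
  fixes A :: "('k::{real_normed_field, euclidean_space} ^ 'n::finite) set"
  assumes "A \<subseteq> coord_space I"
  shows "Ck_on r I A (\<lambda>x. x $ j)"
proof (cases "j \<in> I")
  case True
  show ?thesis
  proof (cases r)
    case 0
    then show ?thesis by (auto intro: continuous_intros)
  next
    case (Suc r')
    have "h $ j = (\<Sum>i\<in>I. h $ i * (if i = j then 1 else 0))" for h :: "'k ^ 'n"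
    proof -
      have "(\<Sum>i\<in>I. h $ i * (if i = j then 1 else 0)) = (\<Sum>i\<in>I. if i = j then h $ i else 0)"
        by (intro sum.cong) auto
      also have "\<dots> = h $ j" using True by simp
      finally show ?thesis by simp
    qed
    then show ?thesis unfolding Suc
      by (rule Ck_on_SucI[OF has_derivative_nth, where f' = "\<lambda>i _. if i = j then 1 else 0"]) auto
  qed
next
  case False
  then have "x $ j = 0" if "x \<in> A" for x
    using assms that by (auto simp: coord_space_def)
  then show ?thesis by (intro Ck_on_cong[OF Ck_on_const[of r I A 0]])
qed

lemma bounded_linear_axis: "bounded_linear (axis i :: 'a::euclidean_space \<Rightarrow> 'a ^ 'n::finite)"
proof -
  have "linear (axis i :: 'a \<Rightarrow> 'a ^ 'n)"
    by (rule linearI) (simp_all add: vec_eq_iff axis_def)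
  then show ?thesis by (simp add: linear_conv_bounded_linear)
qed

lemma vec_as_sum_axis: "(\<Sum>i\<in>UNIV. axis i (x $ i)) = (x :: 'a::comm_monoid_add ^ 'n::finite)"
  by (simp add: vec_eq_iff axis_def)

text \<open>
  The components of the inner map whose index lies outside the target coordinate space vanish, so
  that its remaining components control its derivative.
\<close>

lemma has_derivative_into_coord_space:
  fixes G :: "'a::real_normed_vector \<Rightarrow> 'k::{real_normed_field, euclidean_space} ^ 'n::finite"
  assumes "\<And>i. i \<in> I \<Longrightarrow> ((\<lambda>x. G x $ i) has_derivative D i) (at x within B)"
    and "G ` B \<subseteq> coord_space I" and "x \<in> B"
  shows "(G has_derivative (\<lambda>h. \<chi> i. if i \<in> I then D i h else 0)) (at x within B)"
proof -
  have *: "((\<lambda>x. G x $ i) has_derivative (\<lambda>h. if i \<in> I then D i h else 0)) (at x within B)" for i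
  proof (cases "i \<in> I")
    case False
    then have "G y $ i = 0" if "y \<in> B" for y
      using assms(2) that by (auto simp: coord_space_def)
    with False show ?thesis
      using has_derivative_transform[OF assms(3), of "\<lambda>x. G x $ i" "\<lambda>_. 0"] by auto
  qed (use assms(1) in auto)
  have "((\<lambda>x. \<Sum>i\<in>UNIV. axis i (G x $ i)) has_derivative
         (\<lambda>h. \<Sum>i\<in>UNIV. axis i (if i \<in> I then D i h else 0))) (at x within B)"
    by (intro has_derivative_sum bounded_linear.has_derivative[OF bounded_linear_axis] *)
  moreover have "(\<lambda>h. \<Sum>i\<in>UNIV. axis i (if i \<in> I then D i h else 0))
      = (\<lambda>h. \<chi> i. if i \<in> I then D i h else 0)"
    using vec_as_sum_axis[of "\<chi> i. if i \<in> I then D i h else 0" for h] by (auto cong: if_cong)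
  ultimately show ?thesis by (simp add: vec_as_sum_axis)
qed

text \<open>The chain rule; its inner factors \<open>\<partial>\<^sub>i f \<circ> G\<close> are handled by the induction on the order.\<close>

lemma Ck_on_compose:
  fixes G :: "'k::{real_normed_field, euclidean_space} ^ 'n::finite \<Rightarrow> 'k ^ 'n"
  assumes G: "\<And>i. i \<in> I \<Longrightarrow> Ck_on r J B (\<lambda>x. G x $ i)"
    and GB: "G ` B \<subseteq> A" and A: "A \<subseteq> coord_space I"
  shows "Ck_on r I A f \<Longrightarrow> Ck_on r J B (\<lambda>x. f (G x))"
  using G
proof (induction r arbitrary: f)
  case 0
  have "continuous_on B (\<lambda>x. G x $ i)" for i
  proof (cases "i \<in> I")
    case False
    then have "G y $ i = 0" if "y \<in> B" for y
      using A GB that by (force simp: coord_space_def)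
    then show ?thesis by (simp cong: continuous_on_cong)
  qed (use 0 in auto)
  then have "continuous_on B (\<lambda>x. \<chi> i. G x $ i)"
    by (rule continuous_on_vec_lambda)
  then show ?case using 0 GB by (auto intro: continuous_on_compose2)
next
  case (Suc r)
  obtain f' where f':
      "\<forall>x\<in>A. (f has_derivative (\<lambda>h. \<Sum>i\<in>I. h $ i * f' i x)) (at x within A)"
      "\<forall>i\<in>I. Ck_on r I A (f' i)"
    using Suc.prems by auto
  have "\<forall>i\<in>I. \<exists>g'. (\<forall>x\<in>B. ((\<lambda>x. G x $ i) has_derivative (\<lambda>h. \<Sum>j\<in>J. h $ j * g' j x)) (at x within B))
      \<and> (\<forall>j\<in>J. Ck_on r J B (g' j))"
    using Suc.prems by auto
  from bchoice[OF this] obtain g' where g':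
      "\<And>i x. i \<in> I \<Longrightarrow> x \<in> B \<Longrightarrow>
        ((\<lambda>x. G x $ i) has_derivative (\<lambda>h. \<Sum>j\<in>J. h $ j * g' i j x)) (at x within B)"
      "\<And>i j. i \<in> I \<Longrightarrow> j \<in> J \<Longrightarrow> Ck_on r J B (g' i j)"
    by blast
  have GC: "Ck_on r J B (\<lambda>x. G x $ i)" if "i \<in> I" for i
    using Suc.prems that Ck_on_SucD by blast
  have comp: "((\<lambda>x. f (G x)) has_derivative
        (\<lambda>h. \<Sum>i\<in>I. (\<Sum>j\<in>J. h $ j * g' i j x) * f' i (G x))) (at x within B)" if x: "x \<in> B" for x
  proof -
    have 1: "(G has_derivative (\<lambda>h. \<chi> i. if i \<in> I then (\<Sum>j\<in>J. h $ j * g' i j x) else 0)) (at x within B)"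
      using g'(1) x GB A by (intro has_derivative_into_coord_space) auto
    have "(f has_derivative (\<lambda>h. \<Sum>i\<in>I. h $ i * f' i (G x))) (at (G x) within A)"
      using f'(1) GB x by blast
    then have 2: "(f has_derivative (\<lambda>h. \<Sum>i\<in>I. h $ i * f' i (G x))) (at (G x) within G ` B)"
      using GB by (rule has_derivative_subset)
    show ?thesis
      using has_derivative_in_compose[OF 1 2] by (simp cong: sum.cong)
  qed
  have "(\<Sum>i\<in>I. (\<Sum>j\<in>J. h $ j * g' i j x) * f' i (G x))
      = (\<Sum>j\<in>J. h $ j * (\<Sum>i\<in>I. g' i j x * f' i (G x)))" for h x
    by (simp add: sum_distrib_left sum_distrib_right mult_ac sum.swap[of _ I J])
  moreover have "Ck_on r J B (\<lambda>x. \<Sum>i\<in>I. g' i j x * f' i (G x))" if "j \<in> J" for j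
    using that f'(2) g'(2) GC Suc.IH by (intro Ck_on_sum Ck_on_mult) auto
  ultimately show ?case
    by (intro Ck_on_SucI[OF comp, where f' = "\<lambda>j x. \<Sum>i\<in>I. g' i j x * f' i (G x)"]) auto
qed

subsection \<open>Partial derivatives\<close>

lemma coord_space_mono: "J \<subseteq> I \<Longrightarrow> coord_space J \<subseteq> coord_space I"
  by (auto simp: coord_space_def)

lemma axis_translate_in_coord_space:
  fixes x :: "'k::real_normed_field ^ 'n::finite"
  shows "x \<in> coord_space I \<Longrightarrow> i \<in> I \<Longrightarrow> x + axis i t \<in> coord_space I"
  by (auto simp: coord_space_def axis_def)

lemma eventually_axis_translate:
  fixes A :: "('k::{real_normed_field, euclidean_space} ^ 'n::finite) set"
  assumes A: "openin (top_of_set (coord_space I)) A" and x: "x \<in> A" and i: "i \<in> I"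
  shows "eventually (\<lambda>t. x + axis i t \<in> A) (nhds 0)"
proof -
  obtain T where T: "open T" "A = coord_space I \<inter> T" using A by (auto simp: openin_open)
  have "isCont (\<lambda>t. x + axis i t) 0"
    by (intro continuous_add continuous_const linear_continuous_at bounded_linear_axis)
  then have "((\<lambda>t. x + axis i t) \<longlongrightarrow> x + axis i 0) (nhds 0)"
    unfolding isCont_def using tendsto_at_iff_tendsto_nhds[of "\<lambda>t. x + axis i t" 0] by blast
  moreover have "axis i (0::'k) = (0 :: 'k ^ 'n)" by (simp add: vec_eq_iff axis_def)
  ultimately have "((\<lambda>t. x + axis i t) \<longlongrightarrow> x) (nhds 0)"
    by simp
  then have "eventually (\<lambda>t. x + axis i t \<in> T) (nhds 0)"
    using T x by (intro topological_tendstoD) auto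
  then show ?thesis
    by eventually_elim (use T x i axis_translate_in_coord_space in auto)
qed

text \<open>
  Short coordinate lines in the directions of \<open>I\<close> stay in a relatively open set, so restricting the
  derivative to such a line recovers the ordinary partial derivative.  This makes the choice of the
  coefficient functions in the definition of \<open>Ck_on\<close> harmless.
\<close>

lemma partial_deriv_eq:
  fixes f :: "'k::{real_normed_field, euclidean_space} ^ 'n::finite \<Rightarrow> 'k"
  assumes A: "openin (top_of_set (coord_space I)) A" and x: "x \<in> A" and i: "i \<in> I"
    and f: "(f has_derivative (\<lambda>h. \<Sum>i\<in>I. h $ i * c i)) (at x within A)"
  shows "partial_deriv i f x = c i"
proof -
  have ax0: "axis i (0::'k) = (0 :: 'k ^ 'n)" by (simp add: vec_eq_iff axis_def)
  let ?T = "{t. x + axis i t \<in> A}"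
  obtain V where V: "open V" "0 \<in> V" "\<forall>t\<in>V. x + axis i t \<in> A"
    using eventually_axis_translate[OF A x i] by (auto simp: eventually_nhds)
  have 1: "((\<lambda>t. x + axis i t) has_derivative (\<lambda>t. axis i t)) (at 0 within ?T)"
    by (auto intro!: derivative_eq_intros bounded_linear_imp_has_derivative bounded_linear_axis)
  have 2: "(f has_derivative (\<lambda>h. \<Sum>i\<in>I. h $ i * c i)) (at (x + axis i 0) within (\<lambda>t. x + axis i t) ` ?T)"
    using f by (auto simp: ax0 intro: has_derivative_subset)
  have "((\<lambda>t. f (x + axis i t)) has_derivative (\<lambda>t. \<Sum>l\<in>I. axis i t $ l * c l)) (at 0 within ?T)"
    using has_derivative_in_compose[OF 1 2] .
  moreover have "(\<Sum>l\<in>I. axis i t $ l * c l) = t * c i" for t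
  proof -
    have "(\<Sum>l\<in>I. axis i t $ l * c l) = (\<Sum>l\<in>I. if l = i then t * c i else 0)"
      by (intro sum.cong) (auto simp: axis_def)
    then show ?thesis using i by simp
  qed
  ultimately have "((\<lambda>t. f (x + axis i t)) has_field_derivative c i) (at 0 within ?T)"
    by (simp add: has_field_derivative_def mult_commute_abs)
  moreover have "at 0 within ?T = at 0"
    using V by (intro at_within_nhd[of 0 V]) auto
  ultimately show ?thesis
    unfolding partial_deriv_def by (simp add: DERIV_imp_deriv)
qed

lemma Ck_on_Suc_partial:
  assumes A: "openin (top_of_set (coord_space I)) A"
  shows "Ck_on (Suc r) I A f \<longleftrightarrow>
     (\<forall>x\<in>A. (f has_derivative (\<lambda>h. \<Sum>i\<in>I. h $ i * partial_deriv i f x)) (at x within A)) \<and>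
     (\<forall>i\<in>I. Ck_on r I A (partial_deriv i f))"
proof
  assume "Ck_on (Suc r) I A f"
  then obtain f' where f':
      "\<forall>x\<in>A. (f has_derivative (\<lambda>h. \<Sum>i\<in>I. h $ i * f' i x)) (at x within A)"
      "\<forall>i\<in>I. Ck_on r I A (f' i)"
    by auto
  have eq: "partial_deriv i f x = f' i x" if "x \<in> A" "i \<in> I" for x i
    using partial_deriv_eq[OF A that, of f "\<lambda>i. f' i x"] f'(1) that(1) by blast
  moreover have "Ck_on r I A (partial_deriv i f)" if "i \<in> I" for i
    using that f' eq Ck_on_cong[of r I A "f' i" "partial_deriv i f"] by auto
  ultimately show "(\<forall>x\<in>A. (f has_derivative (\<lambda>h. \<Sum>i\<in>I. h $ i * partial_deriv i f x)) (at x within A)) \<and>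
     (\<forall>i\<in>I. Ck_on r I A (partial_deriv i f))"
    using f'(1) by (auto cong: sum.cong)
qed auto

lemma at_within_openin:
  assumes "openin (top_of_set S) V" "x \<in> V" "V \<subseteq> A" "A \<subseteq> S"
  shows "at x within V = at x within A"
proof -
  obtain T where "open T" "V = S \<inter> T" using assms(1) by (auto simp: openin_open)
  then show ?thesis using assms by (intro at_within_nhd[of x T]) auto
qed

text \<open>
  Witnesses for the coefficients on the small sets need not fit together; the partial derivatives,
  being determined by the function, do.
\<close>

lemma Ck_on_local:
  assumes A: "openin (top_of_set (coord_space I)) A"
    and "\<And>x. x \<in> A \<Longrightarrow> \<exists>V. openin (top_of_set (coord_space I)) V \<and> x \<in> V \<and> V \<subseteq> A \<and> Ck_on r I V f"
  shows "Ck_on r I A f"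
  using assms(2)
proof (induction r arbitrary: f)
  case 0
  show ?case
    unfolding Ck_on.simps continuous_on_eq_continuous_within
  proof
    fix x assume "x \<in> A"
    then obtain V where V: "openin (top_of_set (coord_space I)) V" "x \<in> V" "V \<subseteq> A" "Ck_on 0 I V f"
      using 0 by blast
    then have "continuous (at x within V) f"
      by (simp add: continuous_on_eq_continuous_within)
    moreover have "at x within V = at x within A"
      using V A by (intro at_within_openin) (auto dest: openin_imp_subset)
    ultimately show "continuous (at x within A) f" by simp
  qed
next
  case (Suc r)
  have "(f has_derivative (\<lambda>h. \<Sum>i\<in>I. h $ i * partial_deriv i f x)) (at x within A)" if x: "x \<in> A" for x
  proof -
    obtain V where V: "openin (top_of_set (coord_space I)) V" "x \<in> V" "V \<subseteq> A" "Ck_on (Suc r) I V f"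
      using Suc.prems[OF x] by (elim exE conjE)
    then have "(f has_derivative (\<lambda>h. \<Sum>i\<in>I. h $ i * partial_deriv i f x)) (at x within V)"
      by (simp only: Ck_on_Suc_partial[OF V(1)])
    moreover have "at x within V = at x within A"
      using V A by (intro at_within_openin) (auto dest: openin_imp_subset)
    ultimately show ?thesis by simp
  qed
  moreover have "Ck_on r I A (partial_deriv i f)" if i: "i \<in> I" for i
  proof (rule Suc.IH)
    fix x assume x: "x \<in> A"
    obtain V where V: "openin (top_of_set (coord_space I)) V" "x \<in> V" "V \<subseteq> A" "Ck_on (Suc r) I V f"
      using Suc.prems[OF x] by (elim exE conjE)
    then have "Ck_on r I V (partial_deriv i f)"
      using i by (simp only: Ck_on_Suc_partial[OF V(1)])
    then show "\<exists>V. openin (top_of_set (coord_space I)) V \<and> x \<in> V \<and> V \<subseteq> A \<and> Ck_on r I V (partial_deriv i f)"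
      using V(1-3) by (intro exI[of _ V] conjI)
  qed
  ultimately show ?case using Ck_on_Suc_partial[OF A] by blast
qed

lemma partial_deriv_cong:
  fixes f g :: "'k::{real_normed_field, euclidean_space} ^ 'n::finite \<Rightarrow> 'k"
  assumes "openin (top_of_set (coord_space I)) A" "x \<in> A" "i \<in> I" "\<And>y. y \<in> A \<Longrightarrow> f y = g y"
  shows "partial_deriv i f x = partial_deriv i g x"
  unfolding partial_deriv_def
  by (rule deriv_cong_ev) (use eventually_axis_translate[OF assms(1-3)] assms(4) in \<open>auto elim: eventually_mono\<close>)

subsection \<open>Infinitely differentiable functions\<close>

lemma Cinf_on_subset: "Cinf_on I A f \<Longrightarrow> B \<subseteq> A \<Longrightarrow> Cinf_on I B f"
  by (auto simp: Cinf_on_def intro: Ck_on_subset)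

lemma Cinf_on_cong: "Cinf_on I A f \<Longrightarrow> (\<And>x. x \<in> A \<Longrightarrow> g x = f x) \<Longrightarrow> Cinf_on I A g"
  by (auto simp: Cinf_on_def intro: Ck_on_cong)

lemma Cinf_on_const [simp]: "Cinf_on I A (\<lambda>x. c)"
  by (simp add: Cinf_on_def)

lemma Cinf_on_add: "Cinf_on I A f \<Longrightarrow> Cinf_on I A g \<Longrightarrow> Cinf_on I A (\<lambda>x. f x + g x)"
  by (simp add: Cinf_on_def Ck_on_add)

lemma Cinf_on_mult: "Cinf_on I A f \<Longrightarrow> Cinf_on I A g \<Longrightarrow> Cinf_on I A (\<lambda>x. f x * g x)"
  by (simp add: Cinf_on_def Ck_on_mult)

lemma Cinf_on_inverse:
  "Cinf_on I A f \<Longrightarrow> (\<And>x. x \<in> A \<Longrightarrow> f x \<noteq> 0) \<Longrightarrow> Cinf_on I A (\<lambda>x. inverse (f x))"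
  by (simp add: Cinf_on_def Ck_on_inverse)

lemma Cinf_on_coord: "A \<subseteq> coord_space I \<Longrightarrow> Cinf_on I A (\<lambda>x. x $ j)"
  by (simp add: Cinf_on_def Ck_on_coord)

lemma Cinf_on_compose:
  fixes G :: "'k::{real_normed_field, euclidean_space} ^ 'n::finite \<Rightarrow> 'k ^ 'n"
  assumes "Cinf_on I A f" "\<And>i. i \<in> I \<Longrightarrow> Cinf_on J B (\<lambda>x. G x $ i)" "G ` B \<subseteq> A"
    "A \<subseteq> coord_space I"
  shows "Cinf_on J B (\<lambda>x. f (G x))"
  unfolding Cinf_on_def
proof
  fix r show "Ck_on r J B (\<lambda>x. f (G x))"
    by (rule Ck_on_compose[of I r J B G A f]) (use assms in \<open>auto simp: Cinf_on_def\<close>)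
qed

lemma Cinf_on_local:
  assumes "openin (top_of_set (coord_space I)) A"
    and "\<And>x. x \<in> A \<Longrightarrow> \<exists>V. openin (top_of_set (coord_space I)) V \<and> x \<in> V \<and> V \<subseteq> A \<and> Cinf_on I V f"
  shows "Cinf_on I A f"
  unfolding Cinf_on_def
proof
  fix r show "Ck_on r I A f"
  proof (rule Ck_on_local[OF assms(1)])
    show "\<exists>V. openin (top_of_set (coord_space I)) V \<and> x \<in> V \<and> V \<subseteq> A \<and> Ck_on r I V f" if "x \<in> A" for x
      using assms(2)[OF that] unfolding Cinf_on_def by blast
  qed
qed

lemma Cinf_on_continuous: "Cinf_on I A f \<Longrightarrow> continuous_on A f"
  unfolding Cinf_on_def Ck_on.simps(1)[of I A f, symmetric] by (rule spec)

lemma Cinf_on_partial: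
  assumes "openin (top_of_set (coord_space I)) A" "Cinf_on I A f" "i \<in> I"
  shows "Cinf_on I A (partial_deriv i f)"
  unfolding Cinf_on_def
proof
  fix r
  have "Ck_on (Suc r) I A f" using assms(2) by (simp only: Cinf_on_def)
  then show "Ck_on r I A (partial_deriv i f)"
    using assms(3) by (simp only: Ck_on_Suc_partial[OF assms(1)])
qed

lemma Cinf_on_has_derivative:
  assumes "openin (top_of_set (coord_space I)) A" "Cinf_on I A f" "x \<in> A"
  shows "(f has_derivative (\<lambda>h. \<Sum>i\<in>I. h $ i * partial_deriv i f x)) (at x within A)"
proof -
  have "Ck_on (Suc 0) I A f" using assms(2) by (simp only: Cinf_on_def)
  then show ?thesis
    using assms(3) by (simp only: Ck_on_Suc_partial[OF assms(1)])
qed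

context
  fixes I :: "'n::finite set" and A :: "('k::{real_normed_field, euclidean_space} ^ 'n) set" and x
  assumes A: "openin (top_of_set (coord_space I)) A" and x: "x \<in> A"
begin

lemma partial_deriv_const: "i \<in> I \<Longrightarrow> partial_deriv i (\<lambda>x. c) x = 0"
  by (rule partial_deriv_eq[OF A x, where c = "\<lambda>_. 0", simplified]) auto

lemma partial_deriv_add:
  assumes "Cinf_on I A f" "Cinf_on I A g" "i \<in> I"
  shows "partial_deriv i (\<lambda>x. f x + g x) x = partial_deriv i f x + partial_deriv i g x"
proof (rule partial_deriv_eq[OF A x assms(3)])
  show "((\<lambda>x. f x + g x) has_derivative
      (\<lambda>h. \<Sum>i\<in>I. h $ i * (partial_deriv i f x + partial_deriv i g x))) (at x within A)"
    using has_derivative_add[OF Cinf_on_has_derivative[OF A assms(1) x] Cinf_on_has_derivative[OF A assms(2) x]]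
    by (simp add: algebra_simps sum.distrib)
qed

lemma partial_deriv_mult:
  assumes "Cinf_on I A f" "Cinf_on I A g" "i \<in> I"
  shows "partial_deriv i (\<lambda>x. f x * g x) x = f x * partial_deriv i g x + g x * partial_deriv i f x"
proof (rule partial_deriv_eq[OF A x assms(3)])
  show "((\<lambda>x. f x * g x) has_derivative
      (\<lambda>h. \<Sum>i\<in>I. h $ i * (f x * partial_deriv i g x + g x * partial_deriv i f x))) (at x within A)"
    using has_derivative_mult[OF Cinf_on_has_derivative[OF A assms(1) x] Cinf_on_has_derivative[OF A assms(2) x]]
    by (simp add: algebra_simps sum.distrib sum_distrib_left)
qed

lemma partial_deriv_coord:
  assumes "i \<in> I" "j \<in> I"
  shows "partial_deriv i (\<lambda>x. x $ j) x = (if i = j then 1 else 0)"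
proof (rule partial_deriv_eq[OF A x assms(1)])
  have "(\<Sum>i\<in>I. h $ i * (if i = j then 1 else 0)) = h $ j" for h :: "'k ^ 'n"
  proof -
    have "(\<Sum>i\<in>I. h $ i * (if i = j then 1 else 0)) = (\<Sum>i\<in>I. if i = j then h $ i else 0)"
      by (intro sum.cong) auto
    then show ?thesis using assms by simp
  qed
  then show "((\<lambda>x. x $ j) has_derivative (\<lambda>h. \<Sum>i\<in>I. h $ i * (if i = j then 1 else 0))) (at x within A)"
    using has_derivative_nth[of j "at x within A"] by presburger
qed

lemma partial_deriv_compose:
  fixes G :: "'k ^ 'n \<Rightarrow> 'k ^ 'n"
  assumes B: "openin (top_of_set (coord_space L)) B"
    and G: "\<And>l. l \<in> L \<Longrightarrow> Cinf_on I A (\<lambda>x. G x $ l)" and GA: "G ` A \<subseteq> B"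
    and f: "Cinf_on L B f" and i: "i \<in> I"
  shows "partial_deriv i (\<lambda>x. f (G x)) x
       = (\<Sum>l\<in>L. partial_deriv i (\<lambda>x. G x $ l) x * partial_deriv l f (G x))"
proof (rule partial_deriv_eq[OF A x i])
  have 1: "(G has_derivative
      (\<lambda>h. \<chi> l. if l \<in> L then (\<Sum>j\<in>I. h $ j * partial_deriv j (\<lambda>x. G x $ l) x) else 0)) (at x within A)"
    using openin_imp_subset[OF B] GA
    by (intro has_derivative_into_coord_space) (auto intro: Cinf_on_has_derivative[OF A G x] simp: x)
  have "(f has_derivative (\<lambda>h. \<Sum>i\<in>L. h $ i * partial_deriv i f (G x))) (at (G x) within G ` A)"
    using has_derivative_subset[OF Cinf_on_has_derivative[OF B f] GA] GA x by blast
  from has_derivative_in_compose[OF 1 this]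
  have "((\<lambda>x. f (G x)) has_derivative
      (\<lambda>h. \<Sum>l\<in>L. (\<Sum>j\<in>I. h $ j * partial_deriv j (\<lambda>x. G x $ l) x) * partial_deriv l f (G x))) (at x within A)"
    by (simp cong: sum.cong)
  then show "((\<lambda>x. f (G x)) has_derivative (\<lambda>h. \<Sum>i\<in>I. h $ i *
      (\<Sum>l\<in>L. partial_deriv i (\<lambda>x. G x $ l) x * partial_deriv l f (G x)))) (at x within A)"
    by (simp add: sum_distrib_left sum_distrib_right mult_ac sum.swap[of _ I L])
qed

end

subsection \<open>A dichotomy for solutions of linear differential inequalities\<close>

text \<open>Gronwall's argument: \<open>\<phi> e\<^sup>-\<^sup>L\<^sup>t\<close> does not increase.\<close>

lemma gronwall_zero:
  fixes \<phi> \<phi>' :: "real \<Rightarrow> real"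
  assumes der: "\<And>t. t \<in> {0..1} \<Longrightarrow> (\<phi> has_real_derivative \<phi>' t) (at t within {0..1})"
    and le: "\<And>t. t \<in> {0..1} \<Longrightarrow> \<phi>' t \<le> L * \<phi> t" and zero: "\<phi> 0 = 0"
  shows "\<phi> 1 \<le> 0"
proof -
  let ?h = "\<lambda>t. \<phi> t * exp (- L * t)"
  have h: "(?h has_real_derivative (\<phi>' t - L * \<phi> t) * exp (- L * t)) (at t within {0..1})" if "t \<in> {0..1}" for t
    by (auto intro!: derivative_eq_intros der[OF that] simp: algebra_simps)
  have "?h 1 \<le> ?h 0"
  proof (rule DERIV_nonpos_imp_decreasing_open[where f = ?h and a = 0 and b = 1])
    fix t :: real assume t: "0 < t" "t < 1"
    then have "at t within {0..1} = at t" by (rule at_within_Icc_at)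
    then have "(?h has_real_derivative (\<phi>' t - L * \<phi> t) * exp (- L * t)) (at t)"
      using h[of t] t by simp
    moreover have "(\<phi>' t - L * \<phi> t) * exp (- L * t) \<le> 0"
      using le[of t] t by (intro mult_nonpos_nonneg) auto
    ultimately show "\<exists>y. (?h has_real_derivative y) (at t) \<and> y \<le> 0" by blast
  next
    show "continuous_on {0..1} ?h"
      unfolding continuous_on_eq_continuous_within using DERIV_continuous[OF h] by blast
  qed simp
  then show ?thesis using zero by (simp add: mult_le_0_iff)
qed

lemma closed_coord_space: "closed (coord_space I :: ('k::real_normed_field ^ 'n::finite) set)"
proof -
  have eq: "coord_space I = (\<Inter>i\<in>- I. {x :: 'k ^ 'n. x $ i = 0})" by (auto simp: coord_space_def)
  show ?thesis unfolding eq by (intro closed_INT ballI closed_Collect_eq continuous_intros)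
qed

lemma convex_coord_space: "convex (coord_space I :: ('k::real_normed_field ^ 'n::finite) set)"
  by (rule convexI) (simp add: coord_space_def)

lemma Cinf_on_line:
  fixes G :: "'k::{real_normed_field, euclidean_space} ^ 'n::finite \<Rightarrow> 'k"
  assumes A: "openin (top_of_set (coord_space J)) A" and G: "Cinf_on J A G"
    and seg: "\<And>t. t \<in> {0..1} \<Longrightarrow> y + t *\<^sub>R w \<in> A" and t: "t \<in> {0..1}"
  shows "((\<lambda>t. G (y + t *\<^sub>R w)) has_derivative
      (\<lambda>s. s *\<^sub>R (\<Sum>j\<in>J. w $ j * partial_deriv j G (y + t *\<^sub>R w)))) (at t within {0..1})"
proof -
  let ?g = "\<lambda>t. y + t *\<^sub>R w"
  have 1: "(?g has_derivative (\<lambda>s. s *\<^sub>R w)) (at t within {0..1})"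
    by (auto intro!: derivative_eq_intros)
  have 2: "(G has_derivative (\<lambda>h. \<Sum>j\<in>J. h $ j * partial_deriv j G (?g t))) (at (?g t) within ?g ` {0..1})"
    by (rule has_derivative_subset[OF Cinf_on_has_derivative[OF A G seg[OF t]]]) (use seg in auto)
  show ?thesis
    using has_derivative_in_compose[OF 1 2] by (simp add: scaleR_sum_right)
qed

text \<open>
  Let \<open>f = |F|\<^sup>2 + |dF|\<^sup>2\<close>.  Where \<open>f\<close> is not 0, the hypothesis on the Hessian gives \<open>|df| \<le> L f\<close>, with \<open>L\<close>
  uniform near the point.  At a zero of \<open>f\<close> the hypothesis says nothing, but there \<open>df = 0\<close>, since \<open>f\<close> is
  quadratic in the 1-jet.  So Gronwall's argument applies along all segments.
\<close>

lemma jet_zero_dichotomy: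
  fixes F :: "'k::{real_normed_field, euclidean_space} ^ 'n::finite \<Rightarrow> 'k"
  assumes A: "openin (top_of_set (coord_space J)) A" and F: "Cinf_on J A F" and x0: "x0 \<in> A"
    and hess: "\<And>x i j. x \<in> A \<Longrightarrow> i \<in> J \<Longrightarrow> j \<in> J \<Longrightarrow> F x \<noteq> 0 \<or> (\<exists>l\<in>J. partial_deriv l F x \<noteq> 0) \<Longrightarrow>
      partial_deriv j (partial_deriv i F) x = b i j x * F x + (\<Sum>l\<in>J. c i j l x * partial_deriv l F x)"
    and b: "\<And>i j. i \<in> J \<Longrightarrow> j \<in> J \<Longrightarrow> continuous_on A (b i j)"
    and c: "\<And>i j l. i \<in> J \<Longrightarrow> j \<in> J \<Longrightarrow> l \<in> J \<Longrightarrow> continuous_on A (c i j l)"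
  obtains B where "openin (top_of_set (coord_space J)) B" "x0 \<in> B" "B \<subseteq> A"
    "(\<forall>x\<in>B. F x = 0) \<or> (\<forall>x\<in>B. F x \<noteq> 0 \<or> (\<exists>l\<in>J. partial_deriv l F x \<noteq> 0))"
proof -
  obtain T where T: "open T" "A = coord_space J \<inter> T" using A by (auto simp: openin_open)
  obtain r where r: "0 < r" "cball x0 r \<subseteq> T" using T x0 open_contains_cball by blast
  let ?K = "cball x0 r \<inter> coord_space J"
  have KA: "?K \<subseteq> A" using r T by auto
  have K: "compact ?K" by (intro compact_Int_closed compact_cball closed_coord_space)
  have bound: "bounded (h ` ?K)" if "continuous_on A h" for h :: "'k ^ 'n \<Rightarrow> 'k"
    using compact_continuous_image[OF continuous_on_subset[OF that KA] K] by (rule compact_imp_bounded)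
  have "bounded (\<Union>i\<in>J. \<Union>j\<in>J. b i j ` ?K)"
    by (intro bounded_UN finite ballI bound b)
  then obtain Cb where "0 < Cb" and Cb': "\<forall>v\<in>(\<Union>i\<in>J. \<Union>j\<in>J. b i j ` ?K). norm v \<le> Cb"
    unfolding bounded_pos by blast
  have Cb: "norm (b i j x) \<le> Cb" if "i \<in> J" "j \<in> J" "x \<in> ?K" for i j x
    by (rule bspec[OF Cb']) (use that in blast)
  have "bounded (\<Union>i\<in>J. \<Union>j\<in>J. \<Union>l\<in>J. c i j l ` ?K)"
    by (intro bounded_UN finite ballI bound c)
  then obtain Cc where "0 < Cc" and Cc': "\<forall>v\<in>(\<Union>i\<in>J. \<Union>j\<in>J. \<Union>l\<in>J. c i j l ` ?K). norm v \<le> Cc"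
    unfolding bounded_pos by blast
  have Cc: "norm (c i j l x) \<le> Cc" if "i \<in> J" "j \<in> J" "l \<in> J" "x \<in> ?K" for i j l x
    by (rule bspec[OF Cc']) (use that in blast)
  define C where "C = Cb + Cc"
  have C0: "0 \<le> C" unfolding C_def using \<open>0 < Cb\<close> \<open>0 < Cc\<close> by simp
  define P where "P i = partial_deriv i F" for i
  define s where "s x = norm (F x) + (\<Sum>l\<in>J. norm (P l x))" for x
  define f where "f x = F x \<bullet> F x + (\<Sum>l\<in>J. P l x \<bullet> P l x)" for x
  have s0: "0 \<le> s x" for x unfolding s_def by (intro add_nonneg_nonneg sum_nonneg) auto
  have f0: "0 \<le> f x" for x unfolding f_def by (intro add_nonneg_nonneg sum_nonneg) auto
  have sF: "norm (F x) \<le> s x" for x unfolding s_def by (simp add: sum_nonneg)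
  have sP: "norm (P l x) \<le> s x" if "l \<in> J" for l x
  proof -
    have "norm (P l x) \<le> (\<Sum>l\<in>J. norm (P l x))" using that by (intro member_le_sum) auto
    then show ?thesis unfolding s_def using norm_ge_zero[of "F x"] by linarith
  qed
  have f_eq_0: "f x = 0 \<longleftrightarrow> F x = 0 \<and> (\<forall>l\<in>J. P l x = 0)" for x
    unfolding f_def by (subst add_nonneg_eq_0_iff) (auto simp: sum_nonneg sum_nonneg_eq_0_iff)
  define D where "D = 2 * (1 + real (card J))"
  have s2: "(s x)\<^sup>2 \<le> D * f x" for x
  proof -
    have "(\<Sum>l\<in>J. norm (P l x))\<^sup>2 \<le> (\<Sum>l\<in>J. (norm (P l x))\<^sup>2) * real (card J)"
      by (rule sum_squared_le_sum_of_squares)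
    moreover have "(s x)\<^sup>2 \<le> 2 * (norm (F x))\<^sup>2 + 2 * (\<Sum>l\<in>J. norm (P l x))\<^sup>2"
      using sum_squares_bound[of "norm (F x)" "\<Sum>l\<in>J. norm (P l x)"] unfolding s_def power2_sum by linarith
    ultimately have "(s x)\<^sup>2 \<le> 2 * (F x \<bullet> F x) + 2 * ((\<Sum>l\<in>J. P l x \<bullet> P l x) * real (card J))"
      by (simp add: power2_norm_eq_inner)
    also have "\<dots> \<le> D * f x"
    proof -
      have "0 \<le> (F x \<bullet> F x) * real (card J)" "0 \<le> (\<Sum>l\<in>J. P l x \<bullet> P l x)"
        by (auto intro: sum_nonneg)
      then show ?thesis unfolding D_def f_def by (simp add: algebra_simps)
    qed
    finally show ?thesis .
  qed
  let ?B = "ball x0 r \<inter> coord_space J"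
  have zero: "f z = 0" if y: "y \<in> ?B" "f y = 0" and z: "z \<in> ?B" for y z
  proof -
    define w where "w = z - y"
    define R where "R = norm w"
    have R0: "0 \<le> R" by (simp add: R_def)
    have seg: "y + t *\<^sub>R w \<in> ?B" if "t \<in> {0..1}" for t
    proof -
      have "convex ?B" by (intro convex_Int convex_ball convex_coord_space)
      then have "(1 - t) *\<^sub>R y + t *\<^sub>R z \<in> ?B" using y(1) z that by (intro convexD) auto
      then show ?thesis by (simp add: w_def algebra_simps)
    qed
    have segA: "y + t *\<^sub>R w \<in> A" and segK: "y + t *\<^sub>R w \<in> ?K" if "t \<in> {0..1}" for t
      using seg[OF that] KA by auto
    have wj: "norm (w $ j) \<le> R" for j unfolding R_def by (rule Finite_Cartesian_Product.norm_nth_le)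
    define F' where "F' t = (\<Sum>j\<in>J. w $ j * P j (y + t *\<^sub>R w))" for t
    define P' where "P' i t = (\<Sum>j\<in>J. w $ j * partial_deriv j (P i) (y + t *\<^sub>R w))" for i t
    define \<phi> where "\<phi> t = f (y + t *\<^sub>R w)" for t
    define \<phi>' where "\<phi>' t = 2 * (F (y + t *\<^sub>R w) \<bullet> F' t) + (\<Sum>i\<in>J. 2 * (P i (y + t *\<^sub>R w) \<bullet> P' i t))" for t
    have sq: "((\<lambda>t. G (y + t *\<^sub>R w) \<bullet> G (y + t *\<^sub>R w)) has_real_derivative
        2 * (G (y + t *\<^sub>R w) \<bullet> (\<Sum>j\<in>J. w $ j * partial_deriv j G (y + t *\<^sub>R w)))) (at t within {0..1})"
      if G: "Cinf_on J A G" and t: "t \<in> {0..1}" for G t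
    proof -
      note d = Cinf_on_line[OF A G segA t]
      show ?thesis
        unfolding has_field_derivative_def
        by (rule has_derivative_eq_rhs[OF has_derivative_inner[OF d d]])
           (auto simp: inner_commute algebra_simps)
    qed
    have "(\<phi> has_real_derivative \<phi>' t) (at t within {0..1})" if t: "t \<in> {0..1}" for t
      unfolding \<phi>_def \<phi>'_def f_def F'_def P'_def P_def
      by (intro DERIV_add DERIV_sum sq F Cinf_on_partial[OF A F] t)
    moreover have "\<phi>' t \<le> (2 * (real (card J) * R) + real (card J) * (2 * (real (card J) * (R * C)))) * D * \<phi> t"
      if t: "t \<in> {0..1}" for t
    proof -
      let ?x = "y + t *\<^sub>R w"
      have F't: "norm (F' t) \<le> real (card J) * R * s ?x"
      proof -
        have "norm (F' t) \<le> (\<Sum>j\<in>J. R * s ?x)"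
          unfolding F'_def
          by (rule sum_norm_le) (auto simp: norm_mult intro!: mult_mono wj sP R0)
        then show ?thesis by simp
      qed
      have P't: "norm (P i ?x) * norm (P' i t) \<le> s ?x * (real (card J) * (R * C) * s ?x)" if i: "i \<in> J" for i
      proof (cases "F ?x \<noteq> 0 \<or> (\<exists>l\<in>J. P l ?x \<noteq> 0)")
        case True
        have "norm (partial_deriv j (P i) ?x) \<le> C * s ?x" if j: "j \<in> J" for j
        proof -
          have "partial_deriv j (P i) ?x = b i j ?x * F ?x + (\<Sum>l\<in>J. c i j l ?x * P l ?x)"
            unfolding P_def by (rule hess[OF segA[OF t] i j]) (use True in \<open>simp add: P_def\<close>)
          also have "norm \<dots> \<le> norm (b i j ?x) * norm (F ?x) + (\<Sum>l\<in>J. norm (c i j l ?x) * norm (P l ?x))"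
            by (intro norm_triangle_le add_mono sum_norm_le) (auto simp: norm_mult)
          also have "\<dots> \<le> Cb * norm (F ?x) + (\<Sum>l\<in>J. Cc * norm (P l ?x))"
            using i j segK[OF t] by (intro add_mono mult_right_mono sum_mono Cb Cc norm_ge_zero) auto
          also have "\<dots> \<le> C * norm (F ?x) + C * (\<Sum>l\<in>J. norm (P l ?x))"
            unfolding sum_distrib_left[symmetric] C_def using \<open>0 < Cb\<close> \<open>0 < Cc\<close>
            by (intro add_mono mult_right_mono sum_nonneg norm_ge_zero) auto
          also have "\<dots> = C * s ?x" by (simp add: s_def distrib_left)
          finally show ?thesis .
        qed
        then have "norm (P' i t) \<le> (\<Sum>j\<in>J. R * (C * s ?x))"
          unfolding P'_def by (intro sum_norm_le) (auto simp: norm_mult intro!: mult_mono wj R0)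
        then have "norm (P' i t) \<le> real (card J) * (R * C) * s ?x" by (simp add: mult_ac)
        then show ?thesis by (intro mult_mono sP i s0) auto
      next
        case False
        then have "P i ?x = 0" using i by simp
        then show ?thesis using s0 R0 C0 by simp
      qed
      have "2 * (F ?x \<bullet> F' t) \<le> 2 * (s ?x * (real (card J) * R * s ?x))"
        using norm_cauchy_schwarz[of "F ?x" "F' t"] mult_mono[OF sF[of ?x] F't s0 norm_ge_zero] by linarith
      moreover have "(\<Sum>i\<in>J. 2 * (P i ?x \<bullet> P' i t)) \<le> (\<Sum>i\<in>J. 2 * (s ?x * (real (card J) * (R * C) * s ?x)))"
        using norm_cauchy_schwarz[of "P i ?x" "P' i t" for i] P't
        by (intro sum_mono mult_left_mono) (auto intro: order_trans)
      ultimately have "\<phi>' t \<le> 2 * (s ?x * (real (card J) * R * s ?x))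
          + real (card J) * (2 * (s ?x * (real (card J) * (R * C) * s ?x)))"
        unfolding \<phi>'_def by simp
      also have "\<dots> = (2 * (real (card J) * R) + real (card J) * (2 * (real (card J) * (R * C)))) * (s ?x)\<^sup>2"
        by (simp add: power2_eq_square algebra_simps)
      also have "\<dots> \<le> (2 * (real (card J) * R) + real (card J) * (2 * (real (card J) * (R * C)))) * (D * f ?x)"
        using R0 C0 by (intro mult_left_mono s2) simp
      finally show ?thesis by (simp add: \<phi>_def mult.assoc)
    qed
    moreover have "\<phi> 0 = 0" using y(2) by (simp add: \<phi>_def)
    ultimately have "\<phi> 1 \<le> 0" by (rule gronwall_zero)
    then show ?thesis using f0[of z] by (simp add: \<phi>_def w_def)
  qed
  have "(\<forall>x\<in>?B. F x = 0) \<or> (\<forall>x\<in>?B. F x \<noteq> 0 \<or> (\<exists>l\<in>J. partial_deriv l F x \<noteq> 0))"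
  proof (cases "\<exists>y\<in>?B. f y = 0")
    case True
    then show ?thesis using zero f_eq_0 by blast
  next
    case False
    then show ?thesis using f_eq_0 unfolding P_def by blast
  qed
  moreover have "openin (top_of_set (coord_space J)) ?B"
    using open_ball[of x0 r] by (auto simp: openin_open)
  ultimately show ?thesis
    using that[of ?B] r(1) x0 KA T(2) by (auto simp: subset_iff)
qed

declare Ck_on.simps(2) [simp del]

lemma connected_local_dichotomy:
  fixes S :: "'a::topological_space set"
  assumes S: "connected S"
    and loc: "\<And>p. p \<in> S \<Longrightarrow> \<exists>B. openin (top_of_set S) B \<and> p \<in> B \<and> ((\<forall>q\<in>B. P q) \<or> (\<forall>q\<in>B. \<not> P q))"
  shows "(\<forall>p\<in>S. P p) \<or> (\<forall>p\<in>S. \<not> P p)"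
proof -
  have "P p = P q" if "p \<in> S" "q \<in> S" for p q
  proof (rule connected_local_const[OF S that], rule ballI)
    fix a assume "a \<in> S"
    then obtain B where B: "openin (top_of_set S) B" "a \<in> B" "(\<forall>q\<in>B. P q) \<or> (\<forall>q\<in>B. \<not> P q)"
      using loc by blast
    then obtain T where T: "open T" "B = S \<inter> T" by (auto simp: openin_open)
    show "\<forall>\<^sub>F b in at a within S. P a = P b"
      unfolding eventually_at_topological
      by (rule exI[of _ T]) (use T B in auto)
  qed
  then show ?thesis by blast
qed

section \<open>Charts, smooth functions, tangent vectors\<close>

lemma chart_inv_into: "is_chart S I (U, \<kappa>) \<Longrightarrow> p \<in> U \<Longrightarrow> inv_into U \<kappa> (\<kappa> p) = p"
  by (simp add: is_chart_def)

lemma chart_open_image: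
  assumes "is_chart S I (U, \<kappa>)" "openin (top_of_set S) W"
  shows "openin (top_of_set (coord_space I)) (\<kappa> ` (U \<inter> W))"
proof -
  have c: "openin (top_of_set S) U" "openin (top_of_set (coord_space I)) (\<kappa> ` U)"
    "homeomorphism U (\<kappa> ` U) \<kappa> (inv_into U \<kappa>)"
    using assms(1) by (auto simp: is_chart_def)
  have "openin (top_of_set U) (U \<inter> W)"
    using c(1) assms(2) by (meson Int_lower1 openin_Int openin_imp_subset openin_subset_trans)
  from homeomorphism_imp_open_map[OF c(3) this]
  show ?thesis using c(2) by (rule openin_trans)
qed

lemma chart_preimage_open:
  assumes "is_chart S I (U, \<kappa>)" "openin (top_of_set (coord_space I)) B"
  shows "openin (top_of_set S) (U \<inter> \<kappa> -` B)"
proof -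
  have c: "openin (top_of_set S) U" "openin (top_of_set (coord_space I)) (\<kappa> ` U)"
    "homeomorphism U (\<kappa> ` U) \<kappa> (inv_into U \<kappa>)"
    using assms(1) by (auto simp: is_chart_def)
  have "openin (top_of_set U) (U \<inter> \<kappa> -` B)"
    using c assms(2) openin_imp_subset[OF c(2)]
    by (intro continuous_openin_preimage[of _ _ "coord_space I"]) (auto simp: homeomorphism_def)
  then show ?thesis using c(1) by (rule openin_trans)
qed

lemma Cinf_on_change_chart:
  assumes c: "is_chart S I (U, \<kappa>)" and d: "is_chart S I (V, \<mu>)"
    and t: "smooth_transition I (U, \<kappa>) (V, \<mu>)"
    and f: "Cinf_on I (\<mu> ` (V \<inter> W)) (\<lambda>x. f (inv_into V \<mu> x))"
  shows "Cinf_on I (\<kappa> ` (U \<inter> V \<inter> W)) (\<lambda>x. f (inv_into U \<kappa> x))"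
proof (rule Cinf_on_cong)
  let ?G = "\<lambda>x. \<mu> (inv_into U \<kappa> x)"
  have "Cinf_on I (\<kappa> ` (U \<inter> V \<inter> W)) (\<lambda>x. ?G x $ i)" if "i \<in> I" for i
    using t that by (auto simp: smooth_transition_def intro: Cinf_on_subset)
  moreover have "?G ` (\<kappa> ` (U \<inter> V \<inter> W)) \<subseteq> \<mu> ` (V \<inter> W)"
    using chart_inv_into[OF c] by auto
  moreover have "\<mu> ` (V \<inter> W) \<subseteq> coord_space I"
    using d openin_imp_subset by (fastforce simp: is_chart_def)
  ultimately show "Cinf_on I (\<kappa> ` (U \<inter> V \<inter> W)) (\<lambda>x. f (inv_into V \<mu> (?G x)))"
    by (intro Cinf_on_compose[OF f])
qed (use chart_inv_into[OF c] chart_inv_into[OF d] in auto)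

locale smooth_manifold =
  fixes X :: "('m::t2_space, 'k::{real_normed_field, euclidean_space}, 'n::finite) manifold"
  assumes manifold: "is_manifold X"
begin

lemma atlas_max: "c \<in> atlas X \<Longrightarrow> c \<in> max_atlas X"
  using manifold by (auto simp: is_manifold_def max_atlas_def)

lemma max_chart: "c \<in> max_atlas X \<Longrightarrow> is_chart (pts X) (idx X) c"
  by (simp add: max_atlas_def)

lemma chart_domain_open: "(U, \<kappa>) \<in> max_atlas X \<Longrightarrow> open_in X U"
  by (auto simp: max_atlas_def is_chart_def open_in_def)

lemma chart_image_coord_space: "(U, \<kappa>) \<in> max_atlas X \<Longrightarrow> \<kappa> ` U \<subseteq> coord_space (idx X)"
  using openin_imp_subset by (fastforce simp: max_atlas_def is_chart_def)

lemma max_inv_into: "(U, \<kappa>) \<in> max_atlas X \<Longrightarrow> p \<in> U \<Longrightarrow> inv_into U \<kappa> (\<kappa> p) = p"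
  using max_chart chart_inv_into by blast

lemma max_open_image:
  "(U, \<kappa>) \<in> max_atlas X \<Longrightarrow> open_in X W \<Longrightarrow> openin (top_of_set (coord_space (idx X))) (\<kappa> ` (U \<inter> W))"
  using max_chart chart_open_image unfolding open_in_def by blast

lemma max_open_image_subset:
  "(U, \<kappa>) \<in> max_atlas X \<Longrightarrow> open_in X W \<Longrightarrow> W \<subseteq> U \<Longrightarrow> openin (top_of_set (coord_space (idx X))) (\<kappa> ` W)"
  using max_open_image[of U \<kappa> W] by (simp add: Int_absorb1)

lemma open_in_Int: "open_in X V \<Longrightarrow> open_in X W \<Longrightarrow> open_in X (V \<inter> W)"
  by (simp add: open_in_def openin_Int)

lemma open_in_subset: "open_in X W \<Longrightarrow> W \<subseteq> pts X"
  by (simp add: open_in_def openin_imp_subset)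

lemma open_in_pts: "open_in X (pts X)"
  by (simp add: open_in_def)

lemma chart_at: "p \<in> pts X \<Longrightarrow> \<exists>U \<kappa>. (U, \<kappa>) \<in> atlas X \<and> p \<in> U"
  using manifold by (fastforce simp: is_manifold_def)

lemma max_transition:
  assumes c: "(U, \<kappa>) \<in> max_atlas X" and d: "(V, \<mu>) \<in> max_atlas X"
  shows "smooth_transition (idx X) (U, \<kappa>) (V, \<mu>)"
  unfolding smooth_transition_def prod.case
proof
  fix i assume i: "i \<in> idx X"
  note UV = open_in_Int[OF chart_domain_open[OF c] chart_domain_open[OF d]]
  show "Cinf_on (idx X) (\<kappa> ` (U \<inter> V)) (\<lambda>x. \<mu> (inv_into U \<kappa> x) $ i)"
  proof (rule Cinf_on_local)
    show "openin (top_of_set (coord_space (idx X))) (\<kappa> ` (U \<inter> V))"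
      using max_open_image[OF c UV] by (simp add: Int_absorb1)
    fix x assume "x \<in> \<kappa> ` (U \<inter> V)"
    then obtain p where p: "p \<in> U" "p \<in> V" "x = \<kappa> p" by auto
    then have "p \<in> pts X" using UV open_in_subset by blast
    then obtain O\<^sub>p \<omega> where o: "(O\<^sub>p, \<omega>) \<in> atlas X" "p \<in> O\<^sub>p" using chart_at by blast
    have od: "smooth_transition (idx X) (O\<^sub>p, \<omega>) (V, \<mu>)" and co: "smooth_transition (idx X) (U, \<kappa>) (O\<^sub>p, \<omega>)"
      using c d o(1) by (auto simp: max_atlas_def)
    have "Cinf_on (idx X) (\<omega> ` (O\<^sub>p \<inter> V)) (\<lambda>x. \<mu> (inv_into O\<^sub>p \<omega> x) $ i)"
      using od i by (simp add: smooth_transition_def)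
    from Cinf_on_change_chart[OF max_chart[OF c] max_chart[OF atlas_max[OF o(1)]] co, OF this]
    have 1: "Cinf_on (idx X) (\<kappa> ` (U \<inter> O\<^sub>p \<inter> V)) (\<lambda>x. \<mu> (inv_into U \<kappa> x) $ i)" .
    have 2: "openin (top_of_set (coord_space (idx X))) (\<kappa> ` (U \<inter> O\<^sub>p \<inter> V))"
      using max_open_image[OF c open_in_Int[OF chart_domain_open[OF atlas_max[OF o(1)]] chart_domain_open[OF d]]]
      by (simp add: Int_assoc)
    show "\<exists>B. openin (top_of_set (coord_space (idx X))) B \<and> x \<in> B \<and> B \<subseteq> \<kappa> ` (U \<inter> V) \<and>
        Cinf_on (idx X) B (\<lambda>x. \<mu> (inv_into U \<kappa> x) $ i)"
      by (rule exI[of _ "\<kappa> ` (U \<inter> O\<^sub>p \<inter> V)"]) (use 1 2 p o(2) in auto)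
  qed
qed

lemma Cinf_on_max_change:
  assumes "(U, \<kappa>) \<in> max_atlas X" "(V, \<mu>) \<in> max_atlas X"
    and "Cinf_on (idx X) (\<mu> ` (V \<inter> W)) (\<lambda>x. f (inv_into V \<mu> x))"
  shows "Cinf_on (idx X) (\<kappa> ` (U \<inter> V \<inter> W)) (\<lambda>x. f (inv_into U \<kappa> x))"
  using Cinf_on_change_chart max_chart max_transition assms by blast

subsection \<open>Smooth functions\<close>

text \<open>
  Smoothness is defined by the charts of the given atlas.  Since a slice chart is only compatible
  with this atlas, functions must be read in charts of the maximal atlas too.
\<close>

lemma smooth_fun_max:
  assumes c: "(U, \<kappa>) \<in> max_atlas X" and W: "open_in X W" and f: "smooth_fun X W f"
  shows "Cinf_on (idx X) (\<kappa> ` (U \<inter> W)) (\<lambda>x. f (inv_into U \<kappa> x))"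
proof (rule Cinf_on_local[OF max_open_image[OF c W]])
  fix x assume "x \<in> \<kappa> ` (U \<inter> W)"
  then obtain p where p: "p \<in> U" "p \<in> W" "x = \<kappa> p" by auto
  then have "p \<in> pts X" using W open_in_subset by blast
  then obtain V \<mu> where d: "(V, \<mu>) \<in> atlas X" "p \<in> V" using chart_at by blast
  have "Cinf_on (idx X) (\<mu> ` (V \<inter> W)) (\<lambda>x. f (inv_into V \<mu> x))"
    using f d(1) by (auto simp: smooth_fun_def)
  from Cinf_on_max_change[OF c atlas_max[OF d(1)] this]
  have 1: "Cinf_on (idx X) (\<kappa> ` (U \<inter> V \<inter> W)) (\<lambda>x. f (inv_into U \<kappa> x))" .
  have 2: "openin (top_of_set (coord_space (idx X))) (\<kappa> ` (U \<inter> V \<inter> W))"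
    using max_open_image[OF c open_in_Int[OF chart_domain_open[OF atlas_max[OF d(1)]] W]]
    by (simp add: Int_assoc)
  show "\<exists>B. openin (top_of_set (coord_space (idx X))) B \<and> x \<in> B \<and> B \<subseteq> \<kappa> ` (U \<inter> W) \<and>
      Cinf_on (idx X) B (\<lambda>x. f (inv_into U \<kappa> x))"
    by (rule exI[of _ "\<kappa> ` (U \<inter> V \<inter> W)"]) (use 1 2 p d(2) in auto)
qed

lemma smooth_fun_chartI:
  assumes c: "(U, \<kappa>) \<in> max_atlas X" and WU: "W \<subseteq> U"
    and f: "Cinf_on (idx X) (\<kappa> ` W) (\<lambda>x. f (inv_into U \<kappa> x))"
  shows "smooth_fun X W f"
  unfolding smooth_fun_def
proof (clarify)
  fix V \<mu> assume d: "(V, \<mu>) \<in> atlas X"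
  have "Cinf_on (idx X) (\<mu> ` (V \<inter> U \<inter> W)) (\<lambda>x. f (inv_into V \<mu> x))"
    by (rule Cinf_on_max_change[OF atlas_max[OF d] c]) (use f WU in \<open>simp add: Int_absorb1\<close>)
  moreover have "V \<inter> U \<inter> W = V \<inter> W" using WU by auto
  ultimately show "Cinf_on (idx X) (\<mu> ` (V \<inter> W)) (\<lambda>x. f (inv_into V \<mu> x))" by simp
qed

lemma smooth_fun_chart:
  assumes "(U, \<kappa>) \<in> max_atlas X" "W \<subseteq> U" "open_in X W" "smooth_fun X W f"
  shows "Cinf_on (idx X) (\<kappa> ` W) (\<lambda>x. f (inv_into U \<kappa> x))"
  using smooth_fun_max[OF assms(1,3,4)] assms(2) by (simp add: Int_absorb1)

lemma smooth_fun_subset: "smooth_fun X W f \<Longrightarrow> V \<subseteq> W \<Longrightarrow> smooth_fun X V f"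
  by (auto simp: smooth_fun_def intro: Cinf_on_subset dest!: bspec)

lemma smooth_fun_cong:
  assumes "smooth_fun X W f" "\<And>p. p \<in> W \<Longrightarrow> g p = f p"
  shows "smooth_fun X W g"
  unfolding smooth_fun_def
proof clarify
  fix U \<kappa> assume c: "(U, \<kappa>) \<in> atlas X"
  show "Cinf_on (idx X) (\<kappa> ` (U \<inter> W)) (\<lambda>x. g (inv_into U \<kappa> x))"
  proof (rule Cinf_on_cong)
    show "Cinf_on (idx X) (\<kappa> ` (U \<inter> W)) (\<lambda>x. f (inv_into U \<kappa> x))"
      using assms(1) c by (auto simp: smooth_fun_def)
  qed (use assms(2) max_inv_into[OF atlas_max[OF c]] in auto)
qed

lemma smooth_fun_local:
  assumes W: "open_in X W" and loc: "\<And>p. p \<in> W \<Longrightarrow> smooth_near X p f"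
  shows "smooth_fun X W f"
  unfolding smooth_fun_def
proof clarify
  fix U \<kappa> assume c: "(U, \<kappa>) \<in> atlas X"
  note cm = atlas_max[OF c]
  show "Cinf_on (idx X) (\<kappa> ` (U \<inter> W)) (\<lambda>x. f (inv_into U \<kappa> x))"
  proof (rule Cinf_on_local[OF max_open_image[OF cm W]])
    fix x assume "x \<in> \<kappa> ` (U \<inter> W)"
    then obtain p where p: "p \<in> U" "p \<in> W" "x = \<kappa> p" by auto
    obtain V where V: "open_in X V" "p \<in> V" "smooth_fun X V f"
      using loc[OF p(2)] by (auto simp: smooth_near_def)
    have "Cinf_on (idx X) (\<kappa> ` (U \<inter> (V \<inter> W))) (\<lambda>x. f (inv_into U \<kappa> x))"
      using smooth_fun_max[OF cm V(1,3)] by (rule Cinf_on_subset) auto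
    then show "\<exists>B. openin (top_of_set (coord_space (idx X))) B \<and> x \<in> B \<and> B \<subseteq> \<kappa> ` (U \<inter> W) \<and>
        Cinf_on (idx X) B (\<lambda>x. f (inv_into U \<kappa> x))"
      using max_open_image[OF cm open_in_Int[OF V(1) W]] p V(2)
      by (intro exI[of _ "\<kappa> ` (U \<inter> (V \<inter> W))"]) auto
  qed
qed

lemma smooth_fun_nearD: "open_in X W \<Longrightarrow> smooth_fun X W f \<Longrightarrow> p \<in> W \<Longrightarrow> smooth_near X p f"
  by (auto simp: smooth_near_def)

lemma smooth_fun_const [simp]: "smooth_fun X W (\<lambda>p. c)"
  by (auto simp: smooth_fun_def)

lemma smooth_fun_add: "smooth_fun X W f \<Longrightarrow> smooth_fun X W g \<Longrightarrow> smooth_fun X W (\<lambda>p. f p + g p)"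
  unfolding smooth_fun_def by (fast intro: Cinf_on_add)

lemma smooth_fun_mult: "smooth_fun X W f \<Longrightarrow> smooth_fun X W g \<Longrightarrow> smooth_fun X W (\<lambda>p. f p * g p)"
  unfolding smooth_fun_def by (fast intro: Cinf_on_mult)

lemma smooth_fun_uminus: "smooth_fun X W f \<Longrightarrow> smooth_fun X W (\<lambda>p. - f p)"
  using smooth_fun_mult[OF smooth_fun_const[of W "-1"], of f] by simp

lemma smooth_fun_diff: "smooth_fun X W f \<Longrightarrow> smooth_fun X W g \<Longrightarrow> smooth_fun X W (\<lambda>p. f p - g p)"
  using smooth_fun_add[OF _ smooth_fun_uminus] by fastforce

lemma smooth_fun_sum:
  "(\<And>s. s \<in> S \<Longrightarrow> smooth_fun X W (f s)) \<Longrightarrow> smooth_fun X W (\<lambda>p. \<Sum>s\<in>S. f s p)"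
  by (induction S rule: infinite_finite_induct) (auto intro: smooth_fun_add)

lemma smooth_fun_prod:
  "(\<And>s. s \<in> S \<Longrightarrow> smooth_fun X W (f s)) \<Longrightarrow> smooth_fun X W (\<lambda>p. \<Prod>s\<in>S. f s p)"
  by (induction S rule: infinite_finite_induct) (auto intro: smooth_fun_mult)

lemma smooth_fun_det:
  fixes A :: "'m \<Rightarrow> 'k ^ 'l ^ 'l::finite"
  assumes "\<And>i j. smooth_fun X W (\<lambda>q. A q $ i $ j)"
  shows "smooth_fun X W (\<lambda>q. det (A q))"
  unfolding det_def by (intro smooth_fun_sum smooth_fun_mult smooth_fun_prod smooth_fun_const assms)

lemma smooth_fun_inverse:
  assumes "smooth_fun X W f" "\<And>p. p \<in> W \<Longrightarrow> f p \<noteq> 0"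
  shows "smooth_fun X W (\<lambda>p. inverse (f p))"
  unfolding smooth_fun_def
proof clarify
  fix U \<kappa> assume c: "(U, \<kappa>) \<in> atlas X"
  show "Cinf_on (idx X) (\<kappa> ` (U \<inter> W)) (\<lambda>x. inverse (f (inv_into U \<kappa> x)))"
  proof (rule Cinf_on_inverse)
    show "Cinf_on (idx X) (\<kappa> ` (U \<inter> W)) (\<lambda>x. f (inv_into U \<kappa> x))"
      using assms(1) c by (auto simp: smooth_fun_def)
  qed (use assms(2) max_inv_into[OF atlas_max[OF c]] in auto)
qed

lemma smooth_fun_divide:
  assumes "smooth_fun X W f" "smooth_fun X W g" "\<And>p. p \<in> W \<Longrightarrow> g p \<noteq> 0"
  shows "smooth_fun X W (\<lambda>p. f p / g p)"
  using smooth_fun_mult[OF assms(1) smooth_fun_inverse[OF assms(2,3)]] by (simp add: divide_inverse)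

lemma smooth_fun_coord:
  assumes c: "(U, \<kappa>) \<in> max_atlas X"
  shows "smooth_fun X U (\<lambda>p. \<kappa> p $ i)"
proof (rule smooth_fun_chartI[OF c order_refl], rule Cinf_on_cong)
  show "Cinf_on (idx X) (\<kappa> ` U) (\<lambda>x. x $ i)"
    using chart_image_coord_space[OF c] by (rule Cinf_on_coord)
qed (auto simp: max_inv_into[OF c])

lemma smooth_fun_continuous:
  assumes W: "open_in X W" and f: "smooth_fun X W f"
  shows "continuous_on W f"
  unfolding continuous_on_eq_continuous_within
proof
  fix p assume p: "p \<in> W"
  then obtain U \<kappa> where c: "(U, \<kappa>) \<in> atlas X" "p \<in> U" using W open_in_subset chart_at by blast
  note cm = atlas_max[OF c(1)]
  let ?V = "U \<inter> W"
  have "continuous_on (\<kappa> ` ?V) (\<lambda>x. f (inv_into U \<kappa> x))"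
    using smooth_fun_max[OF cm W f] by (rule Cinf_on_continuous)
  moreover have "continuous_on ?V \<kappa>"
    using max_chart[OF cm] by (auto simp: is_chart_def homeomorphism_def intro: continuous_on_subset)
  ultimately have "continuous_on ?V (\<lambda>p. f (inv_into U \<kappa> (\<kappa> p)))"
    by (rule continuous_on_compose2) auto
  then have "continuous_on ?V f"
    by (rule continuous_on_eq) (auto simp: max_inv_into[OF cm])
  then have "continuous (at p within ?V) f"
    using c(2) p by (simp add: continuous_on_eq_continuous_within)
  moreover have "at p within ?V = at p within W"
    using open_in_Int[OF chart_domain_open[OF cm] W] open_in_subset[OF W] p c(2)
    by (intro at_within_openin[of "pts X"]) (auto simp: open_in_def)
  ultimately show "continuous (at p within W) f" by simp
qed

lemma smooth_near_const [simp]: "p \<in> pts X \<Longrightarrow> smooth_near X p (\<lambda>q. c)"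
  unfolding smooth_near_def by (intro exI[of _ "pts X"]) (simp add: open_in_pts)

lemma open_in_nonzero:
  assumes "open_in X W" "smooth_fun X W f"
  shows "open_in X {q \<in> W. f q \<noteq> 0}"
proof -
  have "openin (top_of_set W) (W \<inter> f -` (- {0}))"
    using smooth_fun_continuous[OF assms] by (rule continuous_openin_preimage_gen) auto
  moreover have "W \<inter> f -` (- {0}) = {q \<in> W. f q \<noteq> 0}" by auto
  ultimately show ?thesis using assms(1) openin_trans unfolding open_in_def by metis
qed

lemma smooth_near2:
  assumes "smooth_near X p f" "smooth_near X p g"
  obtains W where "open_in X W" "p \<in> W" "smooth_fun X W f" "smooth_fun X W g"
proof -
  obtain V W where "open_in X V" "p \<in> V" "smooth_fun X V f" "open_in X W" "p \<in> W" "smooth_fun X W g"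
    using assms unfolding smooth_near_def by blast
  then show ?thesis
    by (intro that[of "V \<inter> W"]) (auto intro: open_in_Int smooth_fun_subset)
qed

lemma smooth_near_add: "smooth_near X p f \<Longrightarrow> smooth_near X p g \<Longrightarrow> smooth_near X p (\<lambda>q. f q + g q)"
  by (erule (1) smooth_near2) (auto simp: smooth_near_def intro: smooth_fun_add)

lemma smooth_near_mult: "smooth_near X p f \<Longrightarrow> smooth_near X p g \<Longrightarrow> smooth_near X p (\<lambda>q. f q * g q)"
  by (erule (1) smooth_near2) (auto simp: smooth_near_def intro: smooth_fun_mult)

lemma smooth_near_cong:
  assumes "open_in X W" "p \<in> W" "\<And>q. q \<in> W \<Longrightarrow> f q = g q"
  shows "smooth_near X p f \<longleftrightarrow> smooth_near X p g"
proof -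
  have "smooth_near X p g" if "smooth_near X p f" "\<And>q. q \<in> W \<Longrightarrow> f q = g q" for f g
  proof -
    obtain V where "open_in X V" "p \<in> V" "smooth_fun X V f" using \<open>smooth_near X p f\<close> by (auto simp: smooth_near_def)
    moreover have "smooth_fun X (V \<inter> W) g"
      by (rule smooth_fun_cong[of _ f]) (use calculation that(2) in \<open>auto intro: smooth_fun_subset\<close>)
    ultimately show ?thesis
      using assms(1,2) open_in_Int unfolding smooth_near_def by blast
  qed
  from this[of f g] this[of g f] show ?thesis using assms(3) by auto
qed

end

subsection \<open>Partial derivatives in a chart\<close>

definition chart_partial ::
    "('m, 'k::{real_normed_field, euclidean_space}, 'n::finite) chart \<Rightarrow> 'n \<Rightarrow> ('m \<Rightarrow> 'k) \<Rightarrow> 'm \<Rightarrow> 'k" where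
  "chart_partial c i f p = partial_deriv i (\<lambda>x. f (inv_into (fst c) (snd c) x)) (snd c p)"

lemma tangent_vector_apply:
  "tangent_vector X (U, \<kappa>) p a f =
     (if smooth_near X p f then \<Sum>i\<in>idx X. a $ i * chart_partial (U, \<kappa>) i f p else 0)"
  by (simp add: tangent_vector_def chart_partial_def)

context smooth_manifold
begin

context
  fixes U \<kappa> p
  assumes c: "(U, \<kappa>) \<in> max_atlas X" and p: "p \<in> U"
begin

lemma smooth_near_Cinf:
  assumes "smooth_near X p f"
  obtains W where "open_in X W" "p \<in> W" "smooth_fun X W f" "W \<subseteq> U"
    "openin (top_of_set (coord_space (idx X))) (\<kappa> ` W)" "\<kappa> p \<in> \<kappa> ` W"
    "Cinf_on (idx X) (\<kappa> ` W) (\<lambda>x. f (inv_into U \<kappa> x))"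
proof -
  obtain W where W: "open_in X W" "p \<in> W" "smooth_fun X W f"
    using assms by (auto simp: smooth_near_def)
  let ?W = "U \<inter> W"
  have o: "open_in X ?W" using W(1) chart_domain_open[OF c] by (simp add: open_in_Int)
  show ?thesis
    by (rule that[of ?W])
       (use o W p max_open_image[OF c W(1)] smooth_fun_max[OF c W(1,3)] in \<open>auto intro: smooth_fun_subset\<close>)
qed

lemma smooth_near_Cinf2:
  assumes "smooth_near X p f" "smooth_near X p g"
  obtains W where "openin (top_of_set (coord_space (idx X))) (\<kappa> ` W)" "\<kappa> p \<in> \<kappa> ` W"
    "Cinf_on (idx X) (\<kappa> ` W) (\<lambda>x. f (inv_into U \<kappa> x))"
    "Cinf_on (idx X) (\<kappa> ` W) (\<lambda>x. g (inv_into U \<kappa> x))"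
proof -
  obtain V where V: "open_in X V" "p \<in> V" "smooth_fun X V f" "V \<subseteq> U"
    using smooth_near_Cinf[OF assms(1)] by metis
  obtain W where W: "open_in X W" "p \<in> W" "smooth_fun X W g" "W \<subseteq> U"
    using smooth_near_Cinf[OF assms(2)] by metis
  have o: "open_in X (V \<inter> W)" using V(1) W(1) by (rule open_in_Int)
  have s: "V \<inter> W \<subseteq> U" using V(4) by auto
  show ?thesis
    by (rule that[of "V \<inter> W"], rule max_open_image_subset[OF c o s])
       (use V(2) W(2) smooth_fun_chart[OF c s o] V(3) W(3) in \<open>auto intro: smooth_fun_subset\<close>)
qed

lemma chart_partial_cong:
  assumes W: "open_in X W" "p \<in> W" "\<And>q. q \<in> W \<Longrightarrow> f q = g q" and i: "i \<in> idx X"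
  shows "chart_partial (U, \<kappa>) i f p = chart_partial (U, \<kappa>) i g p"
  unfolding chart_partial_def fst_conv snd_conv
  by (rule partial_deriv_cong[OF max_open_image[OF c W(1)] _ i]) (use W p max_inv_into[OF c] in auto)

lemma chart_partial_const: "i \<in> idx X \<Longrightarrow> chart_partial (U, \<kappa>) i (\<lambda>q. a) p = 0"
  unfolding chart_partial_def fst_conv snd_conv
  by (rule partial_deriv_const[OF max_open_image_subset[OF c chart_domain_open[OF c] order_refl]]) (use p in auto)

lemma chart_partial_add:
  assumes "smooth_near X p f" "smooth_near X p g" "i \<in> idx X"
  shows "chart_partial (U, \<kappa>) i (\<lambda>q. f q + g q) p = chart_partial (U, \<kappa>) i f p + chart_partial (U, \<kappa>) i g p"
  unfolding chart_partial_def fst_conv snd_conv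
  by (rule smooth_near_Cinf2[OF assms(1,2)], rule partial_deriv_add[OF _ _ _ _ assms(3)])

lemma chart_partial_mult:
  assumes "smooth_near X p f" "smooth_near X p g" "i \<in> idx X"
  shows "chart_partial (U, \<kappa>) i (\<lambda>q. f q * g q) p
    = f p * chart_partial (U, \<kappa>) i g p + g p * chart_partial (U, \<kappa>) i f p"
proof -
  obtain W where "openin (top_of_set (coord_space (idx X))) (\<kappa> ` W)" "\<kappa> p \<in> \<kappa> ` W"
    "Cinf_on (idx X) (\<kappa> ` W) (\<lambda>x. f (inv_into U \<kappa> x))"
    "Cinf_on (idx X) (\<kappa> ` W) (\<lambda>x. g (inv_into U \<kappa> x))"
    by (rule smooth_near_Cinf2[OF assms(1,2)])
  from partial_deriv_mult[OF this assms(3)] show ?thesis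
    unfolding chart_partial_def fst_conv snd_conv by (simp add: max_inv_into[OF c p])
qed

lemma chart_partial_coord:
  assumes i: "i \<in> idx X" and j: "j \<in> idx X"
  shows "chart_partial (U, \<kappa>) i (\<lambda>q. \<kappa> q $ j) p = (if i = j then 1 else 0)"
proof -
  note o = max_open_image_subset[OF c chart_domain_open[OF c] order_refl]
  have "partial_deriv i (\<lambda>x. \<kappa> (inv_into U \<kappa> x) $ j) (\<kappa> p) = partial_deriv i (\<lambda>x. x $ j) (\<kappa> p)"
    by (rule partial_deriv_cong[OF o _ i]) (use p max_inv_into[OF c] in auto)
  also have "\<dots> = (if i = j then 1 else 0)"
    by (rule partial_deriv_coord[OF o _ i j]) (use p in auto)
  finally show ?thesis by (simp add: chart_partial_def)
qed

lemma chart_partial_change: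
  assumes d: "(V, \<mu>) \<in> max_atlas X" and pV: "p \<in> V" and f: "smooth_near X p f" and i: "i \<in> idx X"
  shows "chart_partial (U, \<kappa>) i f p
    = (\<Sum>j\<in>idx X. chart_partial (U, \<kappa>) i (\<lambda>q. \<mu> q $ j) p * chart_partial (V, \<mu>) j f p)"
proof -
  obtain W0 where W0: "open_in X W0" "p \<in> W0" "smooth_fun X W0 f"
    using f by (auto simp: smooth_near_def)
  define W where "W = U \<inter> V \<inter> W0"
  have W: "open_in X W" "p \<in> W" "W \<subseteq> U" "W \<subseteq> V" "W \<subseteq> W0"
    unfolding W_def using W0 p pV open_in_Int chart_domain_open c d by auto
  note sf = smooth_fun_subset[OF W0(3) W(5)]
  note oU = max_open_image_subset[OF c W(1,3)] and oV = max_open_image_subset[OF d W(1,4)]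
  let ?G = "\<lambda>x. \<mu> (inv_into U \<kappa> x)"
  have "partial_deriv i (\<lambda>x. f (inv_into U \<kappa> x)) (\<kappa> p)
      = partial_deriv i (\<lambda>x. f (inv_into V \<mu> (?G x))) (\<kappa> p)"
    by (rule partial_deriv_cong[OF oU _ i])
       (use W(2) max_inv_into[OF c subsetD[OF W(3)]] max_inv_into[OF d subsetD[OF W(4)]] in auto)
  also have "\<dots> = (\<Sum>l\<in>idx X. partial_deriv i (\<lambda>x. ?G x $ l) (\<kappa> p) *
      partial_deriv l (\<lambda>x. f (inv_into V \<mu> x)) (?G (\<kappa> p)))"
  proof (rule partial_deriv_compose[OF oU _ oV _ _ _ i])
    show "\<kappa> p \<in> \<kappa> ` W" using W by auto
    show "Cinf_on (idx X) (\<kappa> ` W) (\<lambda>x. ?G x $ l)" for l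
      by (rule smooth_fun_chart[OF c W(3,1) smooth_fun_subset[OF smooth_fun_coord[OF d] W(4)]])
    show "?G ` \<kappa> ` W \<subseteq> \<mu> ` W" using W(3) max_inv_into[OF c] by auto
    show "Cinf_on (idx X) (\<mu> ` W) (\<lambda>x. f (inv_into V \<mu> x))"
      by (rule smooth_fun_chart[OF d W(4,1) sf])
  qed
  finally show ?thesis
    by (simp add: chart_partial_def max_inv_into[OF c p])
qed

end

lemma smooth_fun_chart_partial:
  assumes c: "(U, \<kappa>) \<in> max_atlas X" and W: "open_in X W" "W \<subseteq> U" and f: "smooth_fun X W f"
    and i: "i \<in> idx X"
  shows "smooth_fun X W (chart_partial (U, \<kappa>) i f)"
proof (rule smooth_fun_chartI[OF c W(2)], rule Cinf_on_cong)
  show "Cinf_on (idx X) (\<kappa> ` W) (partial_deriv i (\<lambda>x. f (inv_into U \<kappa> x)))"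
    by (rule Cinf_on_partial[OF max_open_image_subset[OF c W] smooth_fun_chart[OF c W(2,1) f] i])
  show "chart_partial (U, \<kappa>) i f (inv_into U \<kappa> x) = partial_deriv i (\<lambda>x. f (inv_into U \<kappa> x)) x"
    if "x \<in> \<kappa> ` W" for x
    using that W(2) max_inv_into[OF c] by (auto simp: chart_partial_def)
qed

subsection \<open>Tangent spaces\<close>

lemma smooth_near_coord: "(U, \<kappa>) \<in> max_atlas X \<Longrightarrow> p \<in> U \<Longrightarrow> smooth_near X p (\<lambda>q. \<kappa> q $ j)"
  using smooth_fun_coord chart_domain_open unfolding smooth_near_def by blast

lemma tangent_vector_change:
  assumes c: "(U, \<kappa>) \<in> max_atlas X" "p \<in> U" and d: "(V, \<mu>) \<in> max_atlas X" "p \<in> V"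
  shows "tangent_vector X (U, \<kappa>) p a
    = tangent_vector X (V, \<mu>) p (\<chi> j. \<Sum>i\<in>idx X. a $ i * chart_partial (U, \<kappa>) i (\<lambda>q. \<mu> q $ j) p)"
proof
  fix f
  show "tangent_vector X (U, \<kappa>) p a f
    = tangent_vector X (V, \<mu>) p (\<chi> j. \<Sum>i\<in>idx X. a $ i * chart_partial (U, \<kappa>) i (\<lambda>q. \<mu> q $ j) p) f"
  proof (cases "smooth_near X p f")
    case True
    have "(\<Sum>i\<in>idx X. a $ i * chart_partial (U, \<kappa>) i f p) = (\<Sum>i\<in>idx X. a $ i *
        (\<Sum>j\<in>idx X. chart_partial (U, \<kappa>) i (\<lambda>q. \<mu> q $ j) p * chart_partial (V, \<mu>) j f p))"
      using chart_partial_change[OF c d True] by (intro sum.cong) auto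
    also have "\<dots> = (\<Sum>j\<in>idx X. (\<Sum>i\<in>idx X. a $ i * chart_partial (U, \<kappa>) i (\<lambda>q. \<mu> q $ j) p)
        * chart_partial (V, \<mu>) j f p)"
      unfolding sum_distrib_left sum_distrib_right by (subst sum.swap) (simp add: mult.assoc)
    finally show ?thesis using True by (simp add: tangent_vector_apply)
  qed (simp add: tangent_vector_apply)
qed

text \<open>Under a change of chart the components of a tangent vector change by the Jacobian matrix.\<close>

lemma tangent_space_chart:
  assumes c: "(U, \<kappa>) \<in> max_atlas X" "p \<in> U"
  shows "tangent_space X p = range (tangent_vector X (U, \<kappa>) p)"
proof
  show "tangent_space X p \<subseteq> range (tangent_vector X (U, \<kappa>) p)"
  proof
    fix v assume "v \<in> tangent_space X p"
    then obtain V \<mu> a where "(V, \<mu>) \<in> atlas X" "p \<in> V" "v = tangent_vector X (V, \<mu>) p a"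
      by (auto simp: tangent_space_def)
    then show "v \<in> range (tangent_vector X (U, \<kappa>) p)"
      using tangent_vector_change[OF atlas_max _ c] by auto
  qed
  have "p \<in> pts X" using c chart_domain_open open_in_subset by blast
  then obtain V \<mu> where d: "(V, \<mu>) \<in> atlas X" "p \<in> V" using chart_at by blast
  show "range (tangent_vector X (U, \<kappa>) p) \<subseteq> tangent_space X p"
  proof
    fix v assume "v \<in> range (tangent_vector X (U, \<kappa>) p)"
    then obtain a where a: "v = tangent_vector X (U, \<kappa>) p a" by auto
    show "v \<in> tangent_space X p"
      unfolding a tangent_vector_change[OF c atlas_max[OF d(1)] d(2)]
      using d by (auto simp: tangent_space_def)
  qed
qed

lemma tangent_vectorI: "(U, \<kappa>) \<in> max_atlas X \<Longrightarrow> p \<in> U \<Longrightarrow> tangent_vector X (U, \<kappa>) p a \<in> tangent_space X p"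
  using tangent_space_chart by blast

lemma tangent_space_pts:
  assumes "v \<in> tangent_space X p"
  shows "p \<in> pts X"
  using assms chart_domain_open[OF atlas_max] open_in_subset by (fastforce simp: tangent_space_def)

lemma tangent_chartE:
  assumes "v \<in> tangent_space X p"
  obtains U \<kappa> a where "(U, \<kappa>) \<in> max_atlas X" "p \<in> U" "v = tangent_vector X (U, \<kappa>) p a"
proof -
  obtain U \<kappa> a where "(U, \<kappa>) \<in> atlas X" "p \<in> U" "v = tangent_vector X (U, \<kappa>) p a"
    using assms by (auto simp: tangent_space_def)
  then show ?thesis using that atlas_max by blast
qed

lemma tangent_not_smooth: "v \<in> tangent_space X p \<Longrightarrow> \<not> smooth_near X p f \<Longrightarrow> v f = 0"
  by (auto elim!: tangent_chartE simp: tangent_vector_apply)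

lemma tangent_const: "v \<in> tangent_space X p \<Longrightarrow> v (\<lambda>q. a) = 0"
  by (erule tangent_chartE) (simp add: tangent_vector_apply chart_partial_const)

lemma tangent_cong:
  assumes "v \<in> tangent_space X p" "open_in X W" "p \<in> W" "\<And>q. q \<in> W \<Longrightarrow> f q = g q"
  shows "v f = v g"
  using assms(1)
proof (rule tangent_chartE)
  fix U \<kappa> a assume c: "(U, \<kappa>) \<in> max_atlas X" "p \<in> U" and v: "v = tangent_vector X (U, \<kappa>) p a"
  show "v f = v g"
    using smooth_near_cong[OF assms(2-4)] chart_partial_cong[OF c assms(2-4)]
    by (simp add: v tangent_vector_apply cong: sum.cong)
qed

lemma tangent_add:
  assumes "v \<in> tangent_space X p" "smooth_near X p f" "smooth_near X p g"
  shows "v (\<lambda>q. f q + g q) = v f + v g"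
  using assms(1)
proof (rule tangent_chartE)
  fix U \<kappa> a assume c: "(U, \<kappa>) \<in> max_atlas X" "p \<in> U" and v: "v = tangent_vector X (U, \<kappa>) p a"
  show ?thesis
    using assms(2,3) smooth_near_add[OF assms(2,3)] chart_partial_add[OF c assms(2,3)]
    by (simp add: v tangent_vector_apply distrib_left sum.distrib cong: sum.cong)
qed

lemma tangent_mult:
  assumes "v \<in> tangent_space X p" "smooth_near X p f" "smooth_near X p g"
  shows "v (\<lambda>q. f q * g q) = f p * v g + g p * v f"
  using assms(1)
proof (rule tangent_chartE)
  fix U \<kappa> a assume c: "(U, \<kappa>) \<in> max_atlas X" "p \<in> U" and v: "v = tangent_vector X (U, \<kappa>) p a"
  show ?thesis
    using assms(2,3) smooth_near_mult[OF assms(2,3)] chart_partial_mult[OF c assms(2,3)]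
    by (simp add: v tangent_vector_apply distrib_left sum.distrib sum_distrib_left mult_ac cong: sum.cong)
qed

lemma tangent_vector_coord:
  assumes c: "(U, \<kappa>) \<in> max_atlas X" "p \<in> U" and j: "j \<in> idx X"
  shows "tangent_vector X (U, \<kappa>) p a (\<lambda>q. \<kappa> q $ j) = a $ j"
proof -
  have "(\<Sum>i\<in>idx X. a $ i * chart_partial (U, \<kappa>) i (\<lambda>q. \<kappa> q $ j) p) = (\<Sum>i\<in>idx X. if i = j then a $ i else 0)"
    using chart_partial_coord[OF c _ j] by (intro sum.cong) auto
  then show ?thesis
    using smooth_near_coord[OF c, of j] j by (simp add: tangent_vector_apply)
qed

lemma tangent_vector_cong:
  "(\<And>i. i \<in> idx X \<Longrightarrow> a $ i = b $ i) \<Longrightarrow> tangent_vector X c p a = tangent_vector X c p b"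
  by (cases c) (auto simp: tangent_vector_apply fun_eq_iff intro: sum.cong)

lemma tangent_coords:
  assumes c: "(U, \<kappa>) \<in> max_atlas X" "p \<in> U" and v: "v \<in> tangent_space X p"
  shows "v = tangent_vector X (U, \<kappa>) p (\<chi> i. v (\<lambda>q. \<kappa> q $ i))"
proof -
  obtain a where a: "v = tangent_vector X (U, \<kappa>) p a"
    using v tangent_space_chart[OF c] by auto
  show ?thesis
    by (subst a, rule tangent_vector_cong) (simp add: a tangent_vector_coord[OF c])
qed

lemma tangent_apply_coords:
  assumes c: "(U, \<kappa>) \<in> max_atlas X" "p \<in> U" and v: "v \<in> tangent_space X p" and f: "smooth_near X p f"
  shows "v f = (\<Sum>i\<in>idx X. v (\<lambda>q. \<kappa> q $ i) * chart_partial (U, \<kappa>) i f p)"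
  by (subst tangent_coords[OF c v]) (simp add: tangent_vector_apply f)

lemma tangent_vector_plus:
  "tangent_vector X c p a + tangent_vector X c p b = tangent_vector X c p (a + b)"
  by (cases c) (auto simp: fun_eq_iff tangent_vector_apply distrib_right sum.distrib)

lemma tangent_vector_smul: "s \<bullet>\<^sub>v tangent_vector X c p a = tangent_vector X c p (\<chi> i. s * a $ i)"
  by (cases c) (auto simp: fun_eq_iff smul_def tangent_vector_apply sum_distrib_left mult.assoc)

lemma tangent_space_plus:
  assumes "v \<in> tangent_space X p" "w \<in> tangent_space X p"
  shows "v + w \<in> tangent_space X p"
proof -
  obtain U \<kappa> where c: "(U, \<kappa>) \<in> max_atlas X" "p \<in> U" using assms(1) by (rule tangent_chartE)
  show ?thesis using assms unfolding tangent_space_chart[OF c] by (auto simp: tangent_vector_plus)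
qed

lemma tangent_space_smul:
  assumes "v \<in> tangent_space X p"
  shows "s \<bullet>\<^sub>v v \<in> tangent_space X p"
proof -
  obtain U \<kappa> where c: "(U, \<kappa>) \<in> max_atlas X" "p \<in> U" using assms(1) by (rule tangent_chartE)
  show ?thesis using assms unfolding tangent_space_chart[OF c] by (auto simp: tangent_vector_smul)
qed

lemma smul_minus_one: "(- 1 :: 'k) \<bullet>\<^sub>v v = - v"
  by (simp add: smul_def fun_eq_iff)

lemma smul_zero: "(0 :: 'k) \<bullet>\<^sub>v v = 0"
  by (simp add: smul_def fun_eq_iff)

lemma tangent_space_uminus: "v \<in> tangent_space X p \<Longrightarrow> - v \<in> tangent_space X p"
  using tangent_space_smul[of v p "- 1"] by (simp add: smul_minus_one)

lemma tangent_space_diff: "v \<in> tangent_space X p \<Longrightarrow> w \<in> tangent_space X p \<Longrightarrow> v - w \<in> tangent_space X p"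
  using tangent_space_plus[OF _ tangent_space_uminus] by fastforce

lemma tangent_space_0: "p \<in> pts X \<Longrightarrow> 0 \<in> tangent_space X p"
  using chart_at[of p] tangent_space_smul[OF tangent_vectorI[OF atlas_max], of _ _ p _ 0] smul_zero by metis

subsection \<open>Vector fields\<close>

lemma vector_field_open: "vector_field X W V \<Longrightarrow> open_in X W"
  by (simp add: vector_field_def)

lemma vector_field_in: "vector_field X W V \<Longrightarrow> p \<in> W \<Longrightarrow> V p \<in> tangent_space X p"
  by (simp add: vector_field_def)

lemma vector_field_apply:
  "vector_field X W V \<Longrightarrow> open_in X W' \<Longrightarrow> W' \<subseteq> W \<Longrightarrow> smooth_fun X W' f \<Longrightarrow> smooth_fun X W' (\<lambda>p. V p f)"
  by (simp add: vector_field_def)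

lemma vector_field_apply_near:
  assumes "vector_field X W V" "p \<in> W" "smooth_near X p f"
  shows "smooth_near X p (\<lambda>p. V p f)"
proof -
  obtain W' where W': "open_in X W'" "p \<in> W'" "smooth_fun X W' f" using assms(3) by (auto simp: smooth_near_def)
  have "open_in X (W \<inter> W')" using open_in_Int vector_field_open assms(1) W'(1) by blast
  then show ?thesis
    using vector_field_apply[OF assms(1) _ _ smooth_fun_subset[OF W'(3)], of "W \<inter> W'"] assms(2) W'(2)
    unfolding smooth_near_def by blast
qed

lemma vector_field_subset: "vector_field X W V \<Longrightarrow> open_in X W' \<Longrightarrow> W' \<subseteq> W \<Longrightarrow> vector_field X W' V"
  unfolding vector_field_def by blast

lemma vector_field_cong:
  assumes "vector_field X W V" "\<And>p. p \<in> W \<Longrightarrow> V' p = V p"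
  shows "vector_field X W V'"
  unfolding vector_field_def
proof (intro conjI ballI allI impI)
  fix W' f assume *: "open_in X W' \<and> W' \<subseteq> W \<and> smooth_fun X W' f"
  show "smooth_fun X W' (\<lambda>p. V' p f)"
    by (rule smooth_fun_cong[OF vector_field_apply[OF assms(1), of W' f]]) (use * assms(2) in auto)
qed (use assms vector_field_open vector_field_in in auto)

lemma vector_field_local:
  assumes W: "open_in X W" and loc: "\<And>p. p \<in> W \<Longrightarrow> \<exists>W'. p \<in> W' \<and> vector_field X W' V"
  shows "vector_field X W V"
  unfolding vector_field_def
proof (intro conjI ballI allI impI)
  fix p assume "p \<in> W" then show "V p \<in> tangent_space X p" using loc vector_field_in by blast
next
  fix W' f assume *: "open_in X W' \<and> W' \<subseteq> W \<and> smooth_fun X W' f"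
  show "smooth_fun X W' (\<lambda>p. V p f)"
  proof (rule smooth_fun_local)
    fix p assume p: "p \<in> W'"
    then obtain W'' where "p \<in> W''" "vector_field X W'' V" using loc * by blast
    then show "smooth_near X p (\<lambda>p. V p f)"
      using vector_field_apply_near smooth_fun_nearD p * by blast
  qed (use * in auto)
qed (rule W)

lemma vector_field_plus:
  assumes "vector_field X W Y" "vector_field X W Z"
  shows "vector_field X W (\<lambda>p. Y p + Z p)"
  unfolding vector_field_def
proof (intro conjI ballI allI impI)
  fix W' f assume *: "open_in X W' \<and> W' \<subseteq> W \<and> smooth_fun X W' f"
  then show "smooth_fun X W' (\<lambda>p. (Y p + Z p) f)"
    unfolding plus_fun_apply by (intro smooth_fun_add vector_field_apply[OF assms(1)] vector_field_apply[OF assms(2)]) auto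
qed (use assms vector_field_open vector_field_in tangent_space_plus in auto)

lemma vector_field_smul:
  assumes "smooth_fun X W f" "vector_field X W Z"
  shows "vector_field X W (\<lambda>p. f p \<bullet>\<^sub>v Z p)"
  unfolding vector_field_def
proof (intro conjI ballI allI impI)
  fix W' h assume *: "open_in X W' \<and> W' \<subseteq> W \<and> smooth_fun X W' h"
  show "smooth_fun X W' (\<lambda>p. (f p \<bullet>\<^sub>v Z p) h)"
    unfolding smul_def
    using * by (intro smooth_fun_mult vector_field_apply[OF assms(2)] smooth_fun_subset[OF assms(1)]) auto
qed (use assms vector_field_open vector_field_in tangent_space_smul in auto)

lemma vector_field_diff:
  assumes "vector_field X W Y" "vector_field X W Z"
  shows "vector_field X W (\<lambda>p. Y p - Z p)"
proof (rule vector_field_cong)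
  show "vector_field X W (\<lambda>p. Y p + (- 1) \<bullet>\<^sub>v Z p)"
    by (rule vector_field_plus[OF assms(1) vector_field_smul[OF smooth_fun_const assms(2)]])
qed (simp add: smul_minus_one)

lemma vector_field_chartI:
  assumes c: "(U, \<kappa>) \<in> max_atlas X" and W: "open_in X W" "W \<subseteq> U"
    and V: "\<And>p. p \<in> W \<Longrightarrow> V p = tangent_vector X (U, \<kappa>) p (\<chi> i. A i p)"
    and A: "\<And>i. i \<in> idx X \<Longrightarrow> smooth_fun X W (A i)"
  shows "vector_field X W V"
  unfolding vector_field_def
proof (intro conjI ballI allI impI)
  fix p assume "p \<in> W" then show "V p \<in> tangent_space X p" using V W(2) tangent_vectorI[OF c] by auto
next
  fix W' f assume *: "open_in X W' \<and> W' \<subseteq> W \<and> smooth_fun X W' f"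
  show "smooth_fun X W' (\<lambda>p. V p f)"
  proof (rule smooth_fun_cong)
    show "smooth_fun X W' (\<lambda>p. \<Sum>i\<in>idx X. A i p * chart_partial (U, \<kappa>) i f p)"
      using * W(2) A by (intro smooth_fun_sum smooth_fun_mult smooth_fun_chart_partial[OF c]) (auto intro: smooth_fun_subset)
    show "V p f = (\<Sum>i\<in>idx X. A i p * chart_partial (U, \<kappa>) i f p)" if "p \<in> W'" for p
      using * that V smooth_fun_nearD[of W' f p] by (auto simp: tangent_vector_apply)
  qed
qed (rule W(1))

lemma vector_field_const:
  "(U, \<kappa>) \<in> max_atlas X \<Longrightarrow> vector_field X U (\<lambda>p. tangent_vector X (U, \<kappa>) p a)"
  by (rule vector_field_chartI[where A = "\<lambda>i _. a $ i"]) (auto simp: chart_domain_open)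

lemma tangent_extend:
  assumes "v \<in> tangent_space X p"
  obtains W V where "vector_field X W V" "p \<in> W" "V p = v"
proof -
  obtain U \<kappa> a where "(U, \<kappa>) \<in> max_atlas X" "p \<in> U" "v = tangent_vector X (U, \<kappa>) p a"
    using assms by (rule tangent_chartE)
  then show ?thesis using that vector_field_const by blast
qed

end

section \<open>Submanifolds\<close>

text \<open>Composition with the identity, viewed as a smooth map of the smaller coordinate space into the larger one.\<close>

lemma Cinf_on_fewer_coords:
  assumes f: "Cinf_on I A f" and A: "A \<subseteq> coord_space I" and B: "B \<subseteq> A" "B \<subseteq> coord_space J"
  shows "Cinf_on J B f"
  by (rule Cinf_on_compose[OF f, where G = "\<lambda>x. x"]) (use A B in \<open>auto intro: Cinf_on_coord\<close>)

text \<open>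
  All comparisons between the two manifolds go through pairs of a field of the submanifold and an
  extension of it to an open set of the ambient manifold.
\<close>

definition field_extends ::
    "('m::t2_space, 'k::{real_normed_field, euclidean_space}, 'n::finite) manifold \<Rightarrow>
     ('m, 'k, 'n) manifold \<Rightarrow> 'm set \<Rightarrow> ('m, 'k) vfield \<Rightarrow> ('m, 'k) vfield \<Rightarrow> bool" where
  "field_extends M N W Y' Y \<longleftrightarrow> vector_field M W Y' \<and> vector_field N (W \<inter> pts N) Y \<and>
     (\<forall>p\<in>W \<inter> pts N. Y' p = incl M p (Y p))"

lemma incl_plus: "incl M p (v + w) = incl M p v + incl M p w"
  by (auto simp: incl_def fun_eq_iff)

lemma incl_smul: "incl M p (a \<bullet>\<^sub>v v) = a \<bullet>\<^sub>v incl M p v"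
  by (auto simp: incl_def smul_def fun_eq_iff)

lemma incl_diff: "incl M p (v - w) = incl M p v - incl M p w"
  by (auto simp: incl_def fun_eq_iff)

lemma incl_zero: "incl M p 0 = 0"
  by (auto simp: incl_def fun_eq_iff)

lemma incl_apply: "smooth_near M p f \<Longrightarrow> incl M p v f = v f"
  by (simp add: incl_def)

locale smooth_submanifold = M: smooth_manifold M
  for M :: "('m::t2_space, 'k::{real_normed_field, euclidean_space}, 'n::finite) manifold" +
  fixes N :: "('m, 'k, 'n) manifold"
  assumes submanifold: "submanifold M N"
begin

abbreviation slice :: "'m set \<Rightarrow> ('m \<Rightarrow> 'k ^ 'n) \<Rightarrow> bool" where
  "slice U \<kappa> \<equiv> (U, \<kappa>) \<in> slice_charts M (pts N) (idx N)"

lemma pts_subset: "pts N \<subseteq> pts M" and idx_subset: "idx N \<subseteq> idx M"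
  using submanifold by (auto simp: submanifold_def)

lemma slice_max: "slice U \<kappa> \<Longrightarrow> (U, \<kappa>) \<in> max_atlas M"
  by (simp add: slice_charts_def)

lemma slice_image: "slice U \<kappa> \<Longrightarrow> \<kappa> ` (U \<inter> pts N) = \<kappa> ` U \<inter> coord_space (idx N)"
  by (simp add: slice_charts_def)

lemma slice_at: "p \<in> pts N \<Longrightarrow> \<exists>U \<kappa>. slice U \<kappa> \<and> p \<in> U"
  using submanifold unfolding submanifold_def by fastforce

lemma slice_atlas: "slice U \<kappa> \<Longrightarrow> (U \<inter> pts N, \<kappa>) \<in> atlas N"
  using submanifold by (auto simp: submanifold_def)

lemma atlas_slice:
  assumes "c \<in> atlas N"
  obtains U \<kappa> where "c = (U \<inter> pts N, \<kappa>)" "slice U \<kappa>"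
  using assms submanifold by (auto simp: submanifold_def)

lemma slice_inj: "slice U \<kappa> \<Longrightarrow> inj_on \<kappa> U"
  using M.max_chart[OF slice_max] by (simp add: is_chart_def)

lemma slice_inv_into: "slice U \<kappa> \<Longrightarrow> p \<in> U \<inter> pts N \<Longrightarrow> inv_into (U \<inter> pts N) \<kappa> (\<kappa> p) = p"
  using slice_inj by (meson inf_le1 inj_on_subset inv_into_f_f)

lemma slice_is_chart:
  assumes s: "slice U \<kappa>"
  shows "is_chart (pts N) (idx N) (U \<inter> pts N, \<kappa>)"
proof -
  have c: "openin (top_of_set (pts M)) U" "inj_on \<kappa> U" "openin (top_of_set (coord_space (idx M))) (\<kappa> ` U)"
    "homeomorphism U (\<kappa> ` U) \<kappa> (inv_into U \<kappa>)"
    using M.max_chart[OF slice_max[OF s]] by (auto simp: is_chart_def)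
  have 1: "openin (top_of_set (pts N)) (U \<inter> pts N)"
    using c(1) pts_subset by (auto simp: openin_open)
  have 2: "openin (top_of_set (coord_space (idx N))) (\<kappa> ` (U \<inter> pts N))"
    using c(3) coord_space_mono[OF idx_subset] unfolding slice_image[OF s] by (fastforce simp: openin_open)
  have "homeomorphism (U \<inter> pts N) (\<kappa> ` (U \<inter> pts N)) \<kappa> (inv_into U \<kappa>)"
    using homeomorphism_of_subsets[OF c(4), of "U \<inter> pts N" "\<kappa> ` U"] by auto
  then have "homeomorphism (U \<inter> pts N) (\<kappa> ` (U \<inter> pts N)) \<kappa> (inv_into (U \<inter> pts N) \<kappa>)"
    by (rule homeomorphism_cong) (use slice_inv_into[OF s] M.max_inv_into[OF slice_max[OF s]] in auto)
  then show ?thesis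
    using 1 2 c(2) by (auto simp: is_chart_def intro: inj_on_subset)
qed

lemma Cinf_on_slice:
  assumes s: "slice U \<kappa>" and B: "B \<subseteq> W" "B \<subseteq> pts N" "W \<subseteq> U"
    and f: "Cinf_on (idx M) (\<kappa> ` W) (\<lambda>x. f (inv_into U \<kappa> x))"
  shows "Cinf_on (idx N) (\<kappa> ` B) (\<lambda>x. f (inv_into (U \<inter> pts N) \<kappa> x))"
proof (rule Cinf_on_cong)
  show "Cinf_on (idx N) (\<kappa> ` B) (\<lambda>x. f (inv_into U \<kappa> x))"
  proof (rule Cinf_on_fewer_coords[OF f])
    show "\<kappa> ` W \<subseteq> coord_space (idx M)" using M.chart_image_coord_space[OF slice_max[OF s]] B(3) by blast
    show "\<kappa> ` B \<subseteq> coord_space (idx N)" using slice_image[OF s] B by blast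
  qed (use B in auto)
  show "f (inv_into (U \<inter> pts N) \<kappa> x) = f (inv_into U \<kappa> x)" if x: "x \<in> \<kappa> ` B" for x
  proof -
    obtain p where p: "p \<in> U \<inter> pts N" "x = \<kappa> p" using x B by blast
    then show ?thesis using slice_inv_into[OF s] M.max_inv_into[OF slice_max[OF s]] by auto
  qed
qed

text \<open>The transitions between slice charts are restrictions of transitions in the maximal atlas of \<open>M\<close>.\<close>

lemma submanifold_is_manifold: "is_manifold N"
  unfolding is_manifold_def
proof (intro conjI ballI)
  show "is_chart (pts N) (idx N) c" if "c \<in> atlas N" for c
    using that by (metis atlas_slice slice_is_chart)
  show "(\<Union>c\<in>atlas N. fst c) = pts N"
  proof
    show "(\<Union>c\<in>atlas N. fst c) \<subseteq> pts N" by (auto elim!: atlas_slice)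
    show "pts N \<subseteq> (\<Union>c\<in>atlas N. fst c)"
    proof
      fix p assume p: "p \<in> pts N"
      then obtain U \<kappa> where "slice U \<kappa>" "p \<in> U" using slice_at by blast
      then show "p \<in> (\<Union>c\<in>atlas N. fst c)"
        using p slice_atlas by (intro UN_I[of "(U \<inter> pts N, \<kappa>)"]) auto
    qed
  qed
  fix c d assume "c \<in> atlas N" "d \<in> atlas N"
  then obtain U \<kappa> V \<mu> where c: "c = (U \<inter> pts N, \<kappa>)" "slice U \<kappa>" and d: "d = (V \<inter> pts N, \<mu>)" "slice V \<mu>"
    by (metis atlas_slice)
  show "smooth_transition (idx N) c d"
    unfolding c(1) d(1) smooth_transition_def prod.case
  proof
    fix i assume "i \<in> idx N"
    then have "Cinf_on (idx M) (\<kappa> ` (U \<inter> V)) (\<lambda>x. \<mu> (inv_into U \<kappa> x) $ i)"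
      using M.max_transition[OF slice_max[OF c(2)] slice_max[OF d(2)]] idx_subset
      by (auto simp: smooth_transition_def)
    then show "Cinf_on (idx N) (\<kappa> ` (U \<inter> pts N \<inter> (V \<inter> pts N))) (\<lambda>x. \<mu> (inv_into (U \<inter> pts N) \<kappa> x) $ i)"
      by (rule Cinf_on_slice[OF c(2), rotated 3, where f = "\<lambda>p. \<mu> p $ i"]) auto
  qed
qed

sublocale N: smooth_manifold N
  by unfold_locales (rule submanifold_is_manifold)

lemma slice_N: "slice U \<kappa> \<Longrightarrow> (U \<inter> pts N, \<kappa>) \<in> max_atlas N"
  using slice_atlas N.atlas_max by blast

subsection \<open>Restriction and extension of functions\<close>

lemma open_in_restrict: "open_in M W \<Longrightarrow> open_in N (W \<inter> pts N)"
  using pts_subset by (auto simp: open_in_def openin_open)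

lemma open_in_extend:
  assumes "open_in N B"
  obtains W where "open_in M W" "B = W \<inter> pts N"
proof -
  obtain T where T: "open T" "B = pts N \<inter> T" using assms by (auto simp: open_in_def openin_open)
  then have "open_in M (pts M \<inter> T)" "B = (pts M \<inter> T) \<inter> pts N"
    using pts_subset by (auto simp: open_in_def openin_open)
  then show ?thesis by (rule that)
qed

lemma smooth_fun_restrict:
  assumes W: "open_in M W" and f: "smooth_fun M W f"
  shows "smooth_fun N (W \<inter> pts N) f"
  unfolding smooth_fun_def
proof clarify
  fix V \<kappa> assume "(V, \<kappa>) \<in> atlas N"
  then obtain U where U: "V = U \<inter> pts N" "slice U \<kappa>" by (auto elim: atlas_slice)
  have "Cinf_on (idx M) (\<kappa> ` (U \<inter> W)) (\<lambda>x. f (inv_into U \<kappa> x))"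
    by (rule M.smooth_fun_max[OF slice_max[OF U(2)] W f])
  then show "Cinf_on (idx N) (\<kappa> ` (V \<inter> (W \<inter> pts N))) (\<lambda>x. f (inv_into V \<kappa> x))"
    unfolding U(1) by (rule Cinf_on_slice[OF U(2), rotated 3]) auto
qed

lemma smooth_near_restrict:
  assumes "smooth_near M p f" "p \<in> pts N"
  shows "smooth_near N p f"
proof -
  obtain W where "open_in M W" "p \<in> W" "smooth_fun M W f" using assms(1) by (auto simp: smooth_near_def)
  then show ?thesis
    using open_in_restrict smooth_fun_restrict assms(2) unfolding smooth_near_def by (intro exI[of _ "W \<inter> pts N"]) auto
qed

text \<open>
  In a slice chart, a function on the submanifold is extended to be constant along the
  transversal coordinates.
\<close>

lemma smooth_fun_extend:
  assumes "smooth_near N p f"  "p \<in> pts N"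
  obtains W f' where "open_in M W" "p \<in> W" "smooth_fun M W f'" "\<And>q. q \<in> W \<inter> pts N \<Longrightarrow> f' q = f q"
proof -
  obtain U \<kappa> where s: "slice U \<kappa>" and pU: "p \<in> U" using slice_at assms(2) by blast
  note c = slice_max[OF s] and cN = slice_N[OF s]
  obtain B where B: "open_in N B" "p \<in> B" "smooth_fun N B f" "B \<subseteq> U \<inter> pts N"
    using N.smooth_near_Cinf[OF cN _ assms(1)] pU assms(2) by (metis IntI)
  define P :: "'k ^ 'n \<Rightarrow> 'k ^ 'n" where "P x = (\<chi> i. if i \<in> idx N then x $ i else 0)" for x
  define C where "C = \<kappa> ` B"
  define W where "W = U \<inter> \<kappa> -` (coord_space (idx M) \<inter> P -` C)"
  have C: "openin (top_of_set (coord_space (idx N))) C"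
    unfolding C_def by (rule N.max_open_image_subset[OF cN B(1,4)])
  have PC: "P x \<in> coord_space (idx N)" for x by (auto simp: P_def coord_space_def)
  have Pid: "P x = x" if "x \<in> coord_space (idx N)" for x
    using that by (auto simp: P_def coord_space_def vec_eq_iff)
  have "openin (top_of_set (coord_space (idx M))) (coord_space (idx M) \<inter> P -` C)"
  proof (rule continuous_openin_preimage[OF _ _ C])
    have "continuous_on (coord_space (idx M)) (\<lambda>x. if i \<in> idx N then x $ i else 0)" for i
      by (cases "i \<in> idx N") (auto intro: continuous_intros)
    then show "continuous_on (coord_space (idx M)) P"
      unfolding P_def by (intro continuous_on_vec_lambda)
  qed (use PC in auto)
  then have W: "open_in M W"
    unfolding W_def open_in_def by (rule chart_preimage_open[OF M.max_chart[OF c]])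
  have kU: "\<kappa> q \<in> coord_space (idx N)" if "q \<in> U \<inter> pts N" for q
    using slice_image[OF s] that by blast
  have pW: "p \<in> W"
    unfolding W_def using pU assms(2) B(2) M.chart_image_coord_space[OF c] Pid kU by (auto simp: C_def)
  have f: "Cinf_on (idx N) C (\<lambda>x. f (inv_into U \<kappa> x))"
  proof (rule Cinf_on_cong)
    show "Cinf_on (idx N) C (\<lambda>x. f (inv_into (U \<inter> pts N) \<kappa> x))"
      unfolding C_def by (rule N.smooth_fun_chart[OF cN B(4,1,3)])
    show "f (inv_into U \<kappa> x) = f (inv_into (U \<inter> pts N) \<kappa> x)" if x: "x \<in> C" for x
    proof -
      obtain q where "q \<in> U \<inter> pts N" "x = \<kappa> q" using x B(4) unfolding C_def by blast
      then show ?thesis using slice_inv_into[OF s] M.max_inv_into[OF c] by auto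
    qed
  qed
  define f' where "f' q = f (inv_into U \<kappa> (P (\<kappa> q)))" for q
  have WU: "W \<subseteq> U" by (auto simp: W_def)
  have "smooth_fun M W f'"
  proof (rule M.smooth_fun_chartI[OF c WU], rule Cinf_on_cong)
    show "Cinf_on (idx M) (\<kappa> ` W) (\<lambda>x. f (inv_into U \<kappa> (P x)))"
    proof (rule Cinf_on_compose[OF f])
      show "Cinf_on (idx M) (\<kappa> ` W) (\<lambda>x. P x $ i)" if "i \<in> idx N" for i
        using M.chart_image_coord_space[OF c] WU that by (auto simp: P_def intro!: Cinf_on_coord)
      show "C \<subseteq> coord_space (idx N)" using C openin_imp_subset by blast
    qed (auto simp: W_def)
    show "f' (inv_into U \<kappa> x) = f (inv_into U \<kappa> (P x))" if "x \<in> \<kappa> ` W" for x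
      using that M.max_inv_into[OF c] WU by (auto simp: f'_def subset_iff)
  qed
  moreover have "f' q = f q" if "q \<in> W \<inter> pts N" for q
    using that WU kU Pid M.max_inv_into[OF c] by (auto simp: f'_def subset_iff)
  ultimately show ?thesis using that W pW by blast
qed

subsection \<open>The differential of the inclusion\<close>

text \<open>
  In both charts the partial derivative is taken along the same line, which lies in the submanifold.
\<close>

lemma chart_partial_slice:
  assumes s: "slice U \<kappa>" and p: "p \<in> U \<inter> pts N" and j: "j \<in> idx N"
  shows "chart_partial (U \<inter> pts N, \<kappa>) j f p = chart_partial (U, \<kappa>) j f p"
  unfolding chart_partial_def fst_conv snd_conv
proof (rule partial_deriv_cong[OF N.max_open_image_subset[OF slice_N[OF s] N.chart_domain_open[OF slice_N[OF s]] order_refl] _ j])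
  fix x assume "x \<in> \<kappa> ` (U \<inter> pts N)"
  then show "f (inv_into (U \<inter> pts N) \<kappa> x) = f (inv_into U \<kappa> x)"
    using slice_inv_into[OF s] M.max_inv_into[OF slice_max[OF s]] by auto
qed (use p in auto)

lemma incl_tangent_vector:
  assumes s: "slice U \<kappa>" and p: "p \<in> U \<inter> pts N"
  shows "incl M p (tangent_vector N (U \<inter> pts N, \<kappa>) p a)
    = tangent_vector M (U, \<kappa>) p (\<chi> i. if i \<in> idx N then a $ i else 0)"
proof
  fix f
  show "incl M p (tangent_vector N (U \<inter> pts N, \<kappa>) p a) f
    = tangent_vector M (U, \<kappa>) p (\<chi> i. if i \<in> idx N then a $ i else 0) f"
  proof (cases "smooth_near M p f")
    case True
    have "(\<Sum>i\<in>idx M. (\<chi> i. if i \<in> idx N then a $ i else 0) $ i * chart_partial (U, \<kappa>) i f p)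
        = (\<Sum>i\<in>idx N. a $ i * chart_partial (U, \<kappa>) i f p)"
      using idx_subset by (intro sum.mono_neutral_cong_right) auto
    also have "\<dots> = (\<Sum>i\<in>idx N. a $ i * chart_partial (U \<inter> pts N, \<kappa>) i f p)"
      using chart_partial_slice[OF s p] by (intro sum.cong) auto
    finally show ?thesis
      using True smooth_near_restrict[OF True] p by (simp add: incl_def tangent_vector_apply)
  qed (simp add: incl_def tangent_vector_apply)
qed

lemma tangent_slice:
  assumes "p \<in> pts N"
  obtains U \<kappa> where "slice U \<kappa>" "p \<in> U \<inter> pts N"
    "tangent_space N p = range (tangent_vector N (U \<inter> pts N, \<kappa>) p)"
    "tangent_space M p = range (tangent_vector M (U, \<kappa>) p)"
proof -
  obtain U \<kappa> where s: "slice U \<kappa>" "p \<in> U" using slice_at assms by blast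
  then show ?thesis
    by (intro that[OF s(1)]) (use assms N.tangent_space_chart[OF slice_N] M.tangent_space_chart[OF slice_max] in auto)
qed

lemma incl_in:
  assumes "v \<in> tangent_space N p"
  shows "incl M p v \<in> tangent_space M p"
proof -
  have "p \<in> pts N" using assms by (rule N.tangent_space_pts)
  then obtain U \<kappa> where "slice U \<kappa>" "p \<in> U \<inter> pts N"
    "tangent_space N p = range (tangent_vector N (U \<inter> pts N, \<kappa>) p)"
    "tangent_space M p = range (tangent_vector M (U, \<kappa>) p)"
    by (rule tangent_slice)
  then show ?thesis using assms incl_tangent_vector by auto
qed

text \<open>
  Derivatives along the submanifold are transferred by this rule: \<open>f\<close> is an expression in fields of
  \<open>M\<close>, and \<open>h\<close> the corresponding expression in fields of \<open>N\<close>.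
\<close>

lemma incl_apply_cong:
  assumes v: "v \<in> tangent_space N p" and W: "open_in M W" "p \<in> W"
    and f: "smooth_fun M W f" and eq: "\<And>q. q \<in> W \<inter> pts N \<Longrightarrow> f q = h q"
  shows "incl M p v f = v h"
proof -
  have "smooth_near M p f" using W f by (auto simp: smooth_near_def)
  then have "incl M p v f = v f" by (rule incl_apply)
  also have "\<dots> = v h"
    by (rule N.tangent_cong[OF v open_in_restrict[OF W(1)]]) (use W(2) N.tangent_space_pts[OF v] eq in auto)
  finally show ?thesis .
qed

text \<open>
  A tangent vector of \<open>N\<close> is tested on functions that are smooth on \<open>N\<close> only; these extend to \<open>M\<close>, so
  the action on functions of \<open>M\<close> determines the vector.
\<close>

lemma incl_inj:
  assumes v: "v \<in> tangent_space N p" and w: "w \<in> tangent_space N p" and eq: "incl M p v = incl M p w"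
  shows "v = w"
proof
  fix f
  have p: "p \<in> pts N" using v by (rule N.tangent_space_pts)
  show "v f = w f"
  proof (cases "smooth_near N p f")
    case True
    obtain W f' where W: "open_in M W" "p \<in> W" "smooth_fun M W f'" "\<And>q. q \<in> W \<inter> pts N \<Longrightarrow> f' q = f q"
      by (rule smooth_fun_extend[OF True p]) blast
    have "incl M p u f' = u f" if "u \<in> tangent_space N p" for u
      by (rule incl_apply_cong[OF that W])
    from this[OF v] this[OF w] have "v f = w f" using eq by simp
    then show ?thesis .
  next
    case False
    then show ?thesis using N.tangent_not_smooth[OF v] N.tangent_not_smooth[OF w] by simp
  qed
qed

lemma sub_tangent_spaceE:
  assumes "w \<in> sub_tangent_space M N p"
  obtains v where "v \<in> tangent_space N p" "w = incl M p v"
  using assms by (auto simp: sub_tangent_space_def)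

lemma sub_tangent_spaceI: "v \<in> tangent_space N p \<Longrightarrow> incl M p v \<in> sub_tangent_space M N p"
  by (auto simp: sub_tangent_space_def)

subsection \<open>Restriction and extension of vector fields\<close>

lemma field_extendsD:
  assumes "field_extends M N W Y' Y"
  shows "vector_field M W Y'" "vector_field N (W \<inter> pts N) Y" "open_in M W"
    "\<And>p. p \<in> W \<Longrightarrow> p \<in> pts N \<Longrightarrow> Y' p = incl M p (Y p)"
    "\<And>p. p \<in> W \<Longrightarrow> p \<in> pts N \<Longrightarrow> Y p \<in> tangent_space N p"
    "\<And>p. p \<in> W \<Longrightarrow> Y' p \<in> tangent_space M p"
  using assms M.vector_field_open M.vector_field_in N.vector_field_in by (auto simp: field_extends_def)

lemma field_extends_subset:
  assumes "field_extends M N W Y' Y" "open_in M V" "V \<subseteq> W"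
  shows "field_extends M N V Y' Y"
proof -
  have "vector_field N (V \<inter> pts N) Y"
    using N.vector_field_subset[OF field_extendsD(2)[OF assms(1)] open_in_restrict[OF assms(2)]] assms(3) by blast
  then show ?thesis
    using assms M.vector_field_subset unfolding field_extends_def by blast
qed

text \<open>The components in a slice chart are extended as functions; the transversal components are set to 0.\<close>

lemma field_extend:
  assumes Y: "vector_field N B Y" and p: "p \<in> B"
  obtains W Y' where "field_extends M N W Y' Y" "p \<in> W" "W \<inter> pts N \<subseteq> B"
proof -
  have B: "open_in N B" using Y by (rule N.vector_field_open)
  have pN: "p \<in> pts N" using B p N.open_in_subset by blast
  obtain U \<kappa> where s: "slice U \<kappa>" and pU: "p \<in> U" using slice_at pN by blast
  note c = slice_max[OF s] and cN = slice_N[OF s]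
  obtain W1 where W1: "open_in M W1" "B = W1 \<inter> pts N" using B by (rule open_in_extend)
  define Q where "Q j W f' \<longleftrightarrow> open_in M W \<and> p \<in> W \<and> smooth_fun M W f' \<and>
      (\<forall>q\<in>W \<inter> pts N. f' q = Y q (\<lambda>q. \<kappa> q $ j))" for j W f'
  have "\<exists>W f'. Q j W f'" for j
  proof -
    have "smooth_near N p (\<lambda>q. Y q (\<lambda>q. \<kappa> q $ j))"
      by (rule N.vector_field_apply_near[OF Y p N.smooth_near_coord[OF cN]]) (use pU pN in auto)
    then obtain W f' where "open_in M W" "p \<in> W" "smooth_fun M W f'"
        "\<And>q. q \<in> W \<inter> pts N \<Longrightarrow> f' q = Y q (\<lambda>q. \<kappa> q $ j)"
      by (rule smooth_fun_extend[OF _ pN]) blast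
    then show ?thesis unfolding Q_def by blast
  qed
  then obtain Wj A where "\<And>j. Q j (Wj j) (A j)" by metis
  then have WA: "\<And>j. open_in M (Wj j)" "\<And>j. p \<in> Wj j" "\<And>j. smooth_fun M (Wj j) (A j)"
      "\<And>j q. q \<in> Wj j \<inter> pts N \<Longrightarrow> A j q = Y q (\<lambda>q. \<kappa> q $ j)"
    unfolding Q_def by blast+
  define W where "W = U \<inter> W1 \<inter> ((\<Inter>j\<in>idx N. Wj j) \<inter> pts M)"
  have "open_in M ((\<Inter>j\<in>idx N. Wj j) \<inter> pts M)"
    using openin_INT[of "idx N" "top_of_set (pts M)" Wj] WA(1) by (simp add: open_in_def)
  then have W: "open_in M W"
    unfolding W_def using M.chart_domain_open[OF c] W1(1) M.open_in_Int by blast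
  have WU: "W \<subseteq> U" "W \<subseteq> W1" and WW: "\<And>j. j \<in> idx N \<Longrightarrow> W \<subseteq> Wj j" by (auto simp: W_def)
  define Y' where "Y' q = tangent_vector M (U, \<kappa>) q (\<chi> i. if i \<in> idx N then A i q else 0)" for q
  have "vector_field M W Y'"
  proof (rule M.vector_field_chartI[OF c W WU(1)])
    show "Y' q = tangent_vector M (U, \<kappa>) q (\<chi> i. (\<lambda>i q. if i \<in> idx N then A i q else 0) i q)" for q
      by (simp add: Y'_def)
    show "smooth_fun M W (\<lambda>q. if i \<in> idx N then A i q else 0)" for i
      using M.smooth_fun_subset[OF WA(3) WW] by (cases "i \<in> idx N") auto
  qed
  moreover have WB: "W \<inter> pts N \<subseteq> B" using WU W1(2) by auto
  moreover have "vector_field N (W \<inter> pts N) Y"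
    using N.vector_field_subset[OF Y open_in_restrict[OF W] WB] .
  moreover have "Y' q = incl M q (Y q)" if q: "q \<in> W \<inter> pts N" for q
  proof -
    have q': "q \<in> U \<inter> pts N" "q \<in> B" using q WU WB by auto
    have "Y q = tangent_vector N (U \<inter> pts N, \<kappa>) q (\<chi> i. Y q (\<lambda>q. \<kappa> q $ i))"
      by (rule N.tangent_coords[OF cN q'(1) N.vector_field_in[OF Y q'(2)]])
    then have "incl M q (Y q) = tangent_vector M (U, \<kappa>) q
        (\<chi> i. if i \<in> idx N then (\<chi> i. Y q (\<lambda>q. \<kappa> q $ i)) $ i else 0)"
      using incl_tangent_vector[OF s q'(1)] by metis
    moreover have "A i q = Y q (\<lambda>q. \<kappa> q $ i)" if "i \<in> idx N" for i
      using WA(4)[of q i] WW[OF that] q by blast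
    then have "tangent_vector M (U, \<kappa>) q (\<chi> i. if i \<in> idx N then (\<chi> i. Y q (\<lambda>q. \<kappa> q $ i)) $ i else 0) = Y' q"
      unfolding Y'_def by (intro M.tangent_vector_cong) auto
    ultimately show ?thesis by simp
  qed
  moreover have "p \<in> W" unfolding W_def using pU p W1(2) WA(2) pN pts_subset by auto
  ultimately show ?thesis
    using that unfolding field_extends_def by blast
qed

lemma field_extend_list:
  assumes "p \<in> A" "open_in N A" "\<forall>Y\<in>set Ys. vector_field N A Y"
  shows "\<exists>W F. open_in M W \<and> p \<in> W \<and> W \<inter> pts N \<subseteq> A \<and> (\<forall>Y\<in>set Ys. field_extends M N W (F Y) Y)"
  using assms(3)
proof (induction Ys)
  case Nil
  obtain W where "open_in M W" "A = W \<inter> pts N" using assms(2) by (rule open_in_extend)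
  then show ?case using assms(1) by auto
next
  case (Cons Y Ys)
  then obtain W F where W: "open_in M W" "p \<in> W" "W \<inter> pts N \<subseteq> A" "\<forall>Y\<in>set Ys. field_extends M N W (F Y) Y"
    by auto
  obtain V Y' where V: "field_extends M N V Y' Y" "p \<in> V" "V \<inter> pts N \<subseteq> A"
    by (rule field_extend[of A Y p]) (use Cons assms(1) in auto)
  have o: "open_in M (W \<inter> V)" using W(1) field_extendsD(3)[OF V(1)] by (rule M.open_in_Int)
  have "\<forall>Z\<in>set (Y # Ys). field_extends M N (W \<inter> V) ((F(Y := Y')) Z) Z"
    using W(4) V(1) field_extends_subset[OF _ o Int_lower1] field_extends_subset[OF _ o Int_lower2] by auto
  then show ?case
    using o W(2,3) V(2) by (intro exI[of _ "W \<inter> V"] exI[of _ "F(Y := Y')"]) auto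
qed

text \<open>
  A function of \<open>N\<close> is differentiated by extending it to \<open>M\<close>; hence the restricted field is smooth.
\<close>

lemma field_restrict:
  assumes Y': "vector_field M W Y'"
    and Y: "\<And>p. p \<in> W \<inter> pts N \<Longrightarrow> Y p \<in> tangent_space N p \<and> Y' p = incl M p (Y p)"
  shows "field_extends M N W Y' Y"
proof -
  have W: "open_in M W" using Y' by (rule M.vector_field_open)
  have "vector_field N (W \<inter> pts N) Y"
    unfolding vector_field_def
  proof (intro conjI ballI allI impI)
    fix B f assume B: "open_in N B \<and> B \<subseteq> W \<inter> pts N \<and> smooth_fun N B f"
    show "smooth_fun N B (\<lambda>p. Y p f)"
    proof (rule N.smooth_fun_local)
      fix p assume p: "p \<in> B"
      then have pN: "p \<in> pts N" using B by auto
      have "smooth_near N p f" using B p by (auto simp: smooth_near_def)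
      then obtain V f' where V: "open_in M V" "p \<in> V" "smooth_fun M V f'"
          "\<And>q. q \<in> V \<inter> pts N \<Longrightarrow> f' q = f q"
        by (rule smooth_fun_extend[OF _ pN]) blast
      let ?V = "V \<inter> W"
      have o: "open_in M ?V" using V(1) W by (rule M.open_in_Int)
      have f': "smooth_fun M ?V f'" using M.smooth_fun_subset[OF V(3)] by auto
      have "smooth_fun M ?V (\<lambda>q. Y' q f')"
        by (rule M.vector_field_apply[OF Y' o _ f']) auto
      then have 1: "smooth_fun N (?V \<inter> pts N) (\<lambda>q. Y' q f')"
        by (rule smooth_fun_restrict[OF o])
      have "smooth_fun N (?V \<inter> pts N) (\<lambda>q. Y q f)"
      proof (rule N.smooth_fun_cong[OF 1])
        fix q assume q: "q \<in> ?V \<inter> pts N"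
        then have "Y q \<in> tangent_space N q" "Y' q = incl M q (Y q)" using Y by auto
        then show "Y q f = Y' q f'"
          using incl_apply_cong[OF _ o _ f', of "Y q" q f] V(4) q by auto
      qed
      then show "smooth_near N p (\<lambda>q. Y q f)"
        unfolding smooth_near_def using open_in_restrict[OF o] V(2) B p pN
        by (intro exI[of _ "?V \<inter> pts N"]) auto
    qed (use B in auto)
  qed (use Y open_in_restrict[OF W] in auto)
  then show ?thesis using Y' Y by (auto simp: field_extends_def)
qed

lemma lie_bracket_incl:
  assumes Y: "field_extends M N W Y' Y" and Z: "field_extends M N W Z' Z" and p: "p \<in> W" "p \<in> pts N"
  shows "lie_bracket M Y' Z' p = incl M p (lie_bracket N Y Z p)"
proof
  fix f
  show "lie_bracket M Y' Z' p f = incl M p (lie_bracket N Y Z p) f"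
  proof (cases "smooth_near M p f")
    case True
    have *: "A' p (\<lambda>q. B' q f) = A p (\<lambda>q. B q f)"
      if A: "field_extends M N W A' A" and B: "field_extends M N W B' B" for A A' B B'
    proof -
      obtain V where V: "open_in M V" "p \<in> V" "smooth_fun M V f" using True by (auto simp: smooth_near_def)
      let ?V = "V \<inter> W"
      have o: "open_in M ?V" using V(1) field_extendsD(3)[OF A] by (rule M.open_in_Int)
      have f: "smooth_fun M ?V f" using M.smooth_fun_subset[OF V(3)] by auto
      have Bf: "smooth_fun M ?V (\<lambda>q. B' q f)"
        by (rule M.vector_field_apply[OF field_extendsD(1)[OF B] o _ f]) auto
      have "incl M p (A p) (\<lambda>q. B' q f) = A p (\<lambda>q. B q f)"
      proof (rule incl_apply_cong[OF field_extendsD(5)[OF A p] o _ Bf])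
        fix q assume "q \<in> ?V \<inter> pts N"
        then show "B' q f = B q f"
          using field_extendsD(4)[OF B, of q] incl_apply[OF M.smooth_fun_nearD[OF o f, of q]] by auto
      qed (use V p in auto)
      then show ?thesis using field_extendsD(4)[OF A p] by simp
    qed
    show ?thesis
      using *[OF Y Z] *[OF Z Y] True smooth_near_restrict[OF True p(2)]
      by (simp add: lie_bracket_def incl_apply)
  qed (simp add: lie_bracket_def incl_def)
qed

end

section \<open>Metrics and Levi-Civita connections\<close>

locale metric_manifold = smooth_manifold X
  for X :: "('m::t2_space, 'k::{real_normed_field, euclidean_space}, 'n::finite) manifold" +
  fixes g :: "('m, 'k) metric_field"
  assumes metric: "is_metric X g"
begin

lemma g_sym: "u \<in> tangent_space X p \<Longrightarrow> v \<in> tangent_space X p \<Longrightarrow> g p u v = g p v u"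
  using metric[unfolded is_metric_def, THEN conjunct1] tangent_space_pts[of u p] by blast

lemma g_plus_left:
  "u \<in> tangent_space X p \<Longrightarrow> u' \<in> tangent_space X p \<Longrightarrow> v \<in> tangent_space X p \<Longrightarrow>
   g p (u + u') v = g p u v + g p u' v"
  using metric[unfolded is_metric_def, THEN conjunct2, THEN conjunct1] tangent_space_pts[of u p] by blast

lemma g_smul_left:
  "u \<in> tangent_space X p \<Longrightarrow> v \<in> tangent_space X p \<Longrightarrow> g p (a \<bullet>\<^sub>v u) v = a * g p u v"
  using metric[unfolded is_metric_def, THEN conjunct2, THEN conjunct2, THEN conjunct1] tangent_space_pts[of u p] by blast

lemma g_plus_right:
  "u \<in> tangent_space X p \<Longrightarrow> u' \<in> tangent_space X p \<Longrightarrow> v \<in> tangent_space X p \<Longrightarrow>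
   g p v (u + u') = g p v u + g p v u'"
  using g_sym g_plus_left tangent_space_plus by metis

lemma g_smul_right:
  "u \<in> tangent_space X p \<Longrightarrow> v \<in> tangent_space X p \<Longrightarrow> g p v (a \<bullet>\<^sub>v u) = a * g p v u"
  using g_sym g_smul_left tangent_space_smul by metis

lemma g_zero_left: "v \<in> tangent_space X p \<Longrightarrow> g p 0 v = 0"
  using g_smul_left[of v p v 0] by (simp add: smul_zero)

lemma g_diff_left:
  assumes "u \<in> tangent_space X p" "u' \<in> tangent_space X p" "v \<in> tangent_space X p"
  shows "g p (u - u') v = g p u v - g p u' v"
  using g_plus_left[OF tangent_space_diff[OF assms(1,2)] assms(2,3)] by simp

lemma g_diff_right:
  assumes "u \<in> tangent_space X p" "u' \<in> tangent_space X p" "v \<in> tangent_space X p"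
  shows "g p v (u - u') = g p v u - g p v u'"
  using g_plus_right[OF tangent_space_diff[OF assms(1,2)] assms(2,3)] by simp

lemma g_nondegenerate:
  assumes "u \<in> tangent_space X p" "\<And>v. v \<in> tangent_space X p \<Longrightarrow> g p u v = 0"
  shows "u = 0"
  using metric[unfolded is_metric_def, THEN conjunct2, THEN conjunct2, THEN conjunct2, THEN conjunct1] tangent_space_pts[OF assms(1)] assms by blast

lemma g_smooth: "vector_field X W Y \<Longrightarrow> vector_field X W Z \<Longrightarrow> smooth_fun X W (\<lambda>p. g p (Y p) (Z p))"
  using metric[unfolded is_metric_def, THEN conjunct2, THEN conjunct2, THEN conjunct2, THEN conjunct2] by blast

lemma g_coords:
  assumes c: "(U, \<kappa>) \<in> max_atlas X" "p \<in> U" and v: "v \<in> tangent_space X p"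
  shows "g p (tangent_vector X (U, \<kappa>) p a) v
    = (\<Sum>i\<in>idx X. a $ i * g p (tangent_vector X (U, \<kappa>) p (axis i 1)) v)"
proof -
  have *: "g p (tangent_vector X (U, \<kappa>) p (\<chi> i. if i \<in> F then a $ i else 0)) v
      = (\<Sum>i\<in>F. a $ i * g p (tangent_vector X (U, \<kappa>) p (axis i 1)) v)" if "finite F" for F
    using that
  proof (induction F)
    case empty
    have "tangent_vector X (U, \<kappa>) p (\<chi> i. if i \<in> {} then a $ i else 0) = 0"
      by (auto simp: fun_eq_iff tangent_vector_apply)
    then show ?case by (simp only: sum.empty g_zero_left[OF v])
  next
    case (insert k F)
    have eq: "tangent_vector X (U, \<kappa>) p (\<chi> i. if i \<in> insert k F then a $ i else 0)
        = tangent_vector X (U, \<kappa>) p (\<chi> i. if i \<in> F then a $ i else 0)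
          + a $ k \<bullet>\<^sub>v tangent_vector X (U, \<kappa>) p (axis k 1)"
      unfolding tangent_vector_smul tangent_vector_plus
      by (rule tangent_vector_cong) (use insert(2) in \<open>auto simp: axis_def\<close>)
    have "g p (tangent_vector X (U, \<kappa>) p (\<chi> i. if i \<in> insert k F then a $ i else 0)) v
        = g p (tangent_vector X (U, \<kappa>) p (\<chi> i. if i \<in> F then a $ i else 0)) v
          + g p (a $ k \<bullet>\<^sub>v tangent_vector X (U, \<kappa>) p (axis k 1)) v"
      unfolding eq by (intro g_plus_left tangent_space_smul tangent_vectorI[OF c] v)
    also have "\<dots> = (\<Sum>i\<in>F. a $ i * g p (tangent_vector X (U, \<kappa>) p (axis i 1)) v)
          + a $ k * g p (tangent_vector X (U, \<kappa>) p (axis k 1)) v"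
      by (simp only: insert.IH g_smul_left[OF tangent_vectorI[OF c] v])
    finally show ?case unfolding sum.insert[OF insert(1,2)] by (simp only: add.commute)
  qed
  have "tangent_vector X (U, \<kappa>) p a = tangent_vector X (U, \<kappa>) p (\<chi> i. if i \<in> idx X then a $ i else 0)"
    by (rule tangent_vector_cong) simp
  then show ?thesis using *[of "idx X"] by simp
qed

end

locale levi_civita_manifold = metric_manifold X g
  for X :: "('m::t2_space, 'k::{real_normed_field, euclidean_space}, 'n::finite) manifold" and g +
  fixes D :: "('m, 'k) covd"
  assumes levi_civita: "is_levi_civita X g D"
begin

lemma connection: "is_connection X D"
  using levi_civita by (simp add: is_levi_civita_def)

lemma D_field: "vector_field X W Y \<Longrightarrow> vector_field X W Z \<Longrightarrow> vector_field X W (D Y Z)"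
  using connection[unfolded is_connection_def, THEN conjunct1] by blast

lemma D_in: "vector_field X W Y \<Longrightarrow> vector_field X W Z \<Longrightarrow> p \<in> W \<Longrightarrow> D Y Z p \<in> tangent_space X p"
  using D_field vector_field_in by blast

lemma D_cong:
  assumes "vector_field X W Y" "vector_field X W Z" "\<And>p. p \<in> W \<Longrightarrow> Y' p = Y p" "\<And>p. p \<in> W \<Longrightarrow> Z' p = Z p"
    and "p \<in> W"
  shows "D Y' Z' p = D Y Z p"
  using connection[unfolded is_connection_def, THEN conjunct2, THEN conjunct1] assms by blast

lemma D_plus_left:
  "vector_field X W Y \<Longrightarrow> vector_field X W Y' \<Longrightarrow> vector_field X W Z \<Longrightarrow> p \<in> W \<Longrightarrow>
   D (\<lambda>q. Y q + Y' q) Z p = D Y Z p + D Y' Z p"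
  using connection[unfolded is_connection_def, THEN conjunct2, THEN conjunct2, THEN conjunct1] by blast

lemma D_plus_right:
  "vector_field X W Y \<Longrightarrow> vector_field X W Z \<Longrightarrow> vector_field X W Z' \<Longrightarrow> p \<in> W \<Longrightarrow>
   D Y (\<lambda>q. Z q + Z' q) p = D Y Z p + D Y Z' p"
  using connection[unfolded is_connection_def, THEN conjunct2, THEN conjunct2, THEN conjunct2, THEN conjunct2, THEN conjunct1] by blast

lemma D_diff_left:
  assumes "vector_field X W Y" "vector_field X W Y'" "vector_field X W Z" "p \<in> W"
  shows "D (\<lambda>q. Y q - Y' q) Z p = D Y Z p - D Y' Z p"
  using D_plus_left[OF vector_field_diff[OF assms(1,2)] assms(2,3,4)] by simp

lemma D_diff_right:
  assumes "vector_field X W Y" "vector_field X W Z" "vector_field X W Z'" "p \<in> W"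
  shows "D Y (\<lambda>q. Z q - Z' q) p = D Y Z p - D Y Z' p"
  using D_plus_right[OF assms(1) vector_field_diff[OF assms(2,3)] assms(3,4)] by simp

lemma torsion_free:
  "vector_field X W Y \<Longrightarrow> vector_field X W Z \<Longrightarrow> p \<in> W \<Longrightarrow> lie_bracket X Y Z p = D Y Z p - D Z Y p"
  using levi_civita[unfolded is_levi_civita_def, THEN conjunct2, THEN conjunct1] by metis

lemma metric_compatible:
  "vector_field X W Y \<Longrightarrow> vector_field X W Z \<Longrightarrow> vector_field X W Z' \<Longrightarrow> p \<in> W \<Longrightarrow>
   Y p (\<lambda>q. g q (Z q) (Z' q)) = g p (D Y Z p) (Z' p) + g p (Z p) (D Y Z' p)"
  using levi_civita[unfolded is_levi_civita_def, THEN conjunct2, THEN conjunct2] by blast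

text \<open>Koszul's formula; the right-hand side does not mention the connection.\<close>

lemma koszul:
  assumes "vector_field X W Y" "vector_field X W Z" "vector_field X W V" "p \<in> W"
  shows "2 * g p (D Y Z p) (V p) =
     Y p (\<lambda>q. g q (Z q) (V q)) + Z p (\<lambda>q. g q (Y q) (V q)) - V p (\<lambda>q. g q (Y q) (Z q))
     + g p (lie_bracket X Y Z p) (V p) - g p (lie_bracket X Y V p) (Z p) - g p (lie_bracket X Z V p) (Y p)"
proof -
  have mem: "Y p \<in> tangent_space X p" "Z p \<in> tangent_space X p" "V p \<in> tangent_space X p"
    "D Y Z p \<in> tangent_space X p" "D Z Y p \<in> tangent_space X p" "D Y V p \<in> tangent_space X p"
    "D V Y p \<in> tangent_space X p" "D V Z p \<in> tangent_space X p" "D Z V p \<in> tangent_space X p"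
    using assms D_in vector_field_in by blast+
  show ?thesis
    using mem by (simp add: metric_compatible[OF assms(1,2,3,4)] metric_compatible[OF assms(2,1,3,4)]
        metric_compatible[OF assms(3,1,2,4)] torsion_free[OF assms(1,2,4)] torsion_free[OF assms(1,3,4)]
        torsion_free[OF assms(2,3,4)] g_diff_left g_sym[of "Y p"] g_sym[of "Z p"] g_sym[of "V p" p])
qed

text \<open>
  Since the metric is parallel, its Lie derivative is the symmetric part of \<open>\<nabla>E\<close>.  In this form the
  homothety condition can be compared between a manifold and a submanifold.
\<close>

lemma lie_derivative_metric:
  assumes "vector_field X W E" "vector_field X W Y" "vector_field X W Z" "p \<in> W"
  shows "E p (\<lambda>q. g q (Y q) (Z q)) - g p (lie_bracket X E Y p) (Z p) - g p (Y p) (lie_bracket X E Z p)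
    = g p (D Y E p) (Z p) + g p (Y p) (D Z E p)"
proof -
  have mem: "Y p \<in> tangent_space X p" "Z p \<in> tangent_space X p" "D E Y p \<in> tangent_space X p"
    "D E Z p \<in> tangent_space X p" "D Y E p \<in> tangent_space X p" "D Z E p \<in> tangent_space X p"
    using assms D_in vector_field_in by blast+
  then show ?thesis
    by (simp add: metric_compatible[OF assms] torsion_free[OF assms(1,2,4)] torsion_free[OF assms(1,3,4)]
        g_diff_left g_diff_right)
qed

text \<open>
  The tensor \<open>S(Y, Z, V) = g(\<nabla>\<^sub>Y\<nabla>\<^sub>ZE - \<nabla>\<^bsub>\<nabla>\<^sub>YZ\<^esub>E, V)\<close> is symmetric in \<open>Y, Z\<close> by flatness, and antisymmetric in
  \<open>Z, V\<close> by differentiating the homothety equation; so it is its own negative.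
\<close>

lemma homothetic_imp_affine:
  assumes flat: "is_flat X D" and E: "vector_field X (pts X) E"
    and hom: "\<And>A Y Z p. vector_field X A Y \<Longrightarrow> vector_field X A Z \<Longrightarrow> p \<in> A \<Longrightarrow>
      g p (D Y E p) (Z p) + g p (Y p) (D Z E p) = d * g p (Y p) (Z p)"
    and Y: "vector_field X A Y" and Z: "vector_field X A Z" and p: "p \<in> A"
  shows "D Y (D Z E) p - D (D Y Z) E p = 0"
proof -
  define S where "S Y Z V = g p (D Y (D Z E) p - D (D Y Z) E p) (V p)" for Y Z V
  have S_anti: "S Y Z V = - S Y V Z"
    if f: "vector_field X B Y" "vector_field X B Z" "vector_field X B V" "p \<in> B" for B Y Z V
  proof -
    have B: "open_in X B" using f(1) by (rule vector_field_open)
    have e: "vector_field X B E" using vector_field_subset[OF E B open_in_subset[OF B]] .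
    note DZ = D_field[OF f(2) e] and DV = D_field[OF f(3) e] and YZ = D_field[OF f(1,2)] and YV = D_field[OF f(1,3)]
    have Tp: "Y p \<in> tangent_space X p" using vector_field_in f by blast
    have "Y p (\<lambda>q. g q (D Z E q) (V q) + g q (Z q) (D V E q)) = Y p (\<lambda>q. d * g q (Z q) (V q))"
      by (rule tangent_cong[OF Tp B f(4)]) (rule hom[OF f(2,3)])
    moreover have "Y p (\<lambda>q. g q (D Z E q) (V q) + g q (Z q) (D V E q))
        = Y p (\<lambda>q. g q (D Z E q) (V q)) + Y p (\<lambda>q. g q (Z q) (D V E q))"
      by (intro tangent_add[OF Tp] smooth_fun_nearD[OF B _ f(4)] g_smooth f DZ DV)
    moreover have "Y p (\<lambda>q. d * g q (Z q) (V q)) = d * Y p (\<lambda>q. g q (Z q) (V q))"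
      using tangent_mult[OF Tp, of "\<lambda>q. d" "\<lambda>q. g q (Z q) (V q)"]
        smooth_fun_nearD[OF B g_smooth[OF f(2,3)] f(4)] tangent_const[OF Tp] tangent_space_pts[OF Tp] by simp
    ultimately have "g p (D Y (D Z E) p) (V p) + g p (D Z E p) (D Y V p) + (g p (D Y Z p) (D V E p) + g p (Z p) (D Y (D V E) p))
        = d * g p (D Y Z p) (V p) + d * g p (Z p) (D Y V p)"
      using metric_compatible[OF f(1) DZ f(3,4)] metric_compatible[OF f(1,2) DV f(4)]
        metric_compatible[OF f(1,2,3,4)] by (simp add: distrib_left)
    also have "\<dots> = g p (D (D Y Z) E p) (V p) + g p (D Y Z p) (D V E p)
        + (g p (D Z E p) (D Y V p) + g p (Z p) (D (D Y V) E p))"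
      by (simp only: hom[OF YZ f(3,4)] hom[OF f(2) YV f(4)])
    finally have "g p (D Y (D Z E) p) (V p) - g p (D (D Y Z) E p) (V p)
        = - (g p (Z p) (D Y (D V E) p) - g p (Z p) (D (D Y V) E p))"
      by (simp add: algebra_simps)
    moreover have mem: "Z p \<in> tangent_space X p" "V p \<in> tangent_space X p" "D Y (D Z E) p \<in> tangent_space X p"
      "D Y (D V E) p \<in> tangent_space X p" "D (D Y Z) E p \<in> tangent_space X p" "D (D Y V) E p \<in> tangent_space X p"
      using vector_field_in[OF f(2,4)] vector_field_in[OF f(3,4)] D_in[OF f(1) DZ f(4)] D_in[OF f(1) DV f(4)]
        D_in[OF YZ e f(4)] D_in[OF YV e f(4)] by auto
    ultimately show ?thesis
      unfolding S_def by (simp add: g_diff_left g_sym[of "Z p"])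
  qed
  have S_sym: "S Y Z V = S Z Y V"
    if f: "vector_field X B Y" "vector_field X B Z" "vector_field X B V" "p \<in> B" for B Y Z V
  proof -
    have B: "open_in X B" using f(1) by (rule vector_field_open)
    have e: "vector_field X B E" using vector_field_subset[OF E B open_in_subset[OF B]] .
    have "D (lie_bracket X Y Z) E p = D (\<lambda>q. D Y Z q - D Z Y q) E p"
      by (rule D_cong[OF vector_field_diff[OF D_field[OF f(1,2)] D_field[OF f(2,1)]] e _ _ f(4)])
         (simp_all add: torsion_free[OF f(1,2)])
    also have "\<dots> = D (D Y Z) E p - D (D Z Y) E p"
      by (rule D_diff_left[OF D_field[OF f(1,2)] D_field[OF f(2,1)] e f(4)])
    finally have "D Y (D Z E) p - D Z (D Y E) p - (D (D Y Z) E p - D (D Z Y) E p) = 0"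
      using flat f e unfolding is_flat_def by metis
    then have "D Y (D Z E) p - D (D Y Z) E p = D Z (D Y E) p - D (D Z Y) E p"
      by (simp add: algebra_simps)
    then show ?thesis unfolding S_def by simp
  qed
  show ?thesis
  proof (rule g_nondegenerate)
    have A: "open_in X A" using Y by (rule vector_field_open)
    have e: "vector_field X A E" using vector_field_subset[OF E A open_in_subset[OF A]] .
    show "D Y (D Z E) p - D (D Y Z) E p \<in> tangent_space X p"
      by (rule tangent_space_diff[OF D_in[OF Y D_field[OF Z e] p] D_in[OF D_field[OF Y Z] e p]])
    fix v assume "v \<in> tangent_space X p"
    then obtain W V where V: "vector_field X W V" "p \<in> W" "V p = v" by (rule tangent_extend)
    let ?B = "A \<inter> W"
    have B: "open_in X ?B" using A vector_field_open[OF V(1)] by (rule open_in_Int)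
    have f: "vector_field X ?B Y" "vector_field X ?B Z" "vector_field X ?B V" "p \<in> ?B"
      using vector_field_subset[OF Y B] vector_field_subset[OF Z B] vector_field_subset[OF V(1) B] p V(2) by auto
    have "S Y Z V = - S Y V Z" using S_anti[OF f(1,2,3,4)] .
    also have "\<dots> = - S V Y Z" using S_sym[OF f(1,3,2,4)] by simp
    also have "\<dots> = S V Z Y" using S_anti[OF f(3,1,2,4)] by simp
    also have "\<dots> = S Z V Y" using S_sym[OF f(3,2,1,4)] .
    also have "\<dots> = - S Z Y V" using S_anti[OF f(2,3,1,4)] .
    also have "\<dots> = - S Y Z V" using S_sym[OF f(2,1,3,4)] by simp
    finally have "2 * S Y Z V = 0" by simp
    then show "g p (D Y (D Z E) p - D (D Y Z) E p) v = 0" unfolding S_def V(3) by simp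
  qed
qed

end

locale frobenius_algebra_manifold = levi_civita_manifold X g D
  for X :: "('m::t2_space, 'k::{real_normed_field, euclidean_space}, 'n::finite) manifold" and g D +
  fixes m :: "('m, 'k) product_field"
  assumes multiplication: "is_multiplication X m"
    and invariant: "\<forall>p\<in>pts X. \<forall>u\<in>tangent_space X p. \<forall>v\<in>tangent_space X p. \<forall>w\<in>tangent_space X p.
           g p (m p u v) w = g p u (m p v w)"
begin

lemma m_in: "u \<in> tangent_space X p \<Longrightarrow> v \<in> tangent_space X p \<Longrightarrow> m p u v \<in> tangent_space X p"
  using multiplication[unfolded is_multiplication_def, THEN conjunct1] tangent_space_pts[of u p] by blast

lemma m_comm: "u \<in> tangent_space X p \<Longrightarrow> v \<in> tangent_space X p \<Longrightarrow> m p u v = m p v u"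
  using multiplication[unfolded is_multiplication_def, THEN conjunct2, THEN conjunct1] tangent_space_pts[of u p] by blast

lemma m_plus_left:
  "u \<in> tangent_space X p \<Longrightarrow> u' \<in> tangent_space X p \<Longrightarrow> v \<in> tangent_space X p \<Longrightarrow>
   m p (u + u') v = m p u v + m p u' v"
  using multiplication[unfolded is_multiplication_def, THEN conjunct2, THEN conjunct2, THEN conjunct1] tangent_space_pts[of u p] by blast

lemma m_smul_left:
  "u \<in> tangent_space X p \<Longrightarrow> v \<in> tangent_space X p \<Longrightarrow> m p (a \<bullet>\<^sub>v u) v = a \<bullet>\<^sub>v m p u v"
  using multiplication[unfolded is_multiplication_def, THEN conjunct2, THEN conjunct2, THEN conjunct2, THEN conjunct1] tangent_space_pts[of u p] by blast

lemma m_zero_left: "u \<in> tangent_space X p \<Longrightarrow> m p 0 u = 0"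
  using m_smul_left[of u p u 0] by (simp add: smul_zero)

lemma m_assoc:
  "u \<in> tangent_space X p \<Longrightarrow> v \<in> tangent_space X p \<Longrightarrow> w \<in> tangent_space X p \<Longrightarrow>
   m p (m p u v) w = m p u (m p v w)"
  using multiplication[unfolded is_multiplication_def, THEN conjunct2, THEN conjunct2, THEN conjunct2, THEN conjunct2, THEN conjunct1] tangent_space_pts[of u p] by blast

lemma m_field: "vector_field X W Y \<Longrightarrow> vector_field X W Z \<Longrightarrow> vector_field X W (\<lambda>p. m p (Y p) (Z p))"
  using multiplication[unfolded is_multiplication_def, THEN conjunct2, THEN conjunct2, THEN conjunct2, THEN conjunct2, THEN conjunct2] by blast

lemma m_diff_left:
  assumes "u \<in> tangent_space X p" "u' \<in> tangent_space X p" "v \<in> tangent_space X p"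
  shows "m p (u - u') v = m p u v - m p u' v"
  using m_plus_left[OF tangent_space_diff[OF assms(1,2)] assms(2,3)] by simp

lemma m_invariant:
  "u \<in> tangent_space X p \<Longrightarrow> v \<in> tangent_space X p \<Longrightarrow> w \<in> tangent_space X p \<Longrightarrow>
   g p (m p u v) w = g p u (m p v w)"
  using invariant tangent_space_pts[of u p] by blast

lemma nabla_c_plus:
  assumes Y: "vector_field X W Y" and U: "vector_field X W U" and U': "vector_field X W U'"
    and Z: "vector_field X W Z" and V: "vector_field X W V" and p: "p \<in> W"
  shows "nabla_c g m D Y (\<lambda>q. U q + U' q) Z V p = nabla_c g m D Y U Z V p + nabla_c g m D Y U' Z V p"
proof -
  have W: "open_in X W" using Y by (rule vector_field_open)
  have mem: "U q \<in> tangent_space X q" "U' q \<in> tangent_space X q" "Z q \<in> tangent_space X q" "V q \<in> tangent_space X q"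
    if "q \<in> W" for q using that U U' Z V vector_field_in by blast+
  have c_plus: "g q (m q (a + b) u) v = g q (m q a u) v + g q (m q b u) v"
    if "a \<in> tangent_space X q" "b \<in> tangent_space X q" "u \<in> tangent_space X q" "v \<in> tangent_space X q" for q a b u v
    unfolding m_plus_left[OF that(1,2,3)] by (intro g_plus_left m_in that)
  have "Y p (\<lambda>q. g q (m q (U q + U' q) (Z q)) (V q))
      = Y p (\<lambda>q. g q (m q (U q) (Z q)) (V q) + g q (m q (U' q) (Z q)) (V q))"
    by (rule tangent_cong[OF vector_field_in[OF Y p] W p], rule c_plus) (use mem in auto)
  also have "\<dots> = Y p (\<lambda>q. g q (m q (U q) (Z q)) (V q)) + Y p (\<lambda>q. g q (m q (U' q) (Z q)) (V q))"
    by (intro tangent_add[OF vector_field_in[OF Y p]] smooth_fun_nearD[OF W _ p] g_smooth m_field U U' Z V)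
  finally show ?thesis
    unfolding nabla_c_def ctensor_def D_plus_right[OF Y U U' p]
    by (simp add: c_plus mem[OF p] D_in[OF Y _ p] U U' Z V)
qed

text \<open>
  The metric being parallel, the terms in which \<open>E\<close> differentiates combine to \<open>\<nabla>\<^sub>Ec\<close>; the others only
  involve \<open>\<nabla>E\<close>.
\<close>

lemma lie_derivative_product:
  assumes E: "vector_field X W E" and Y: "vector_field X W Y" and Z: "vector_field X W Z"
    and V: "vector_field X W V" and p: "p \<in> W"
  shows "g p (lie_bracket X E (\<lambda>q. m q (Y q) (Z q)) p
      - m p (lie_bracket X E Y p) (Z p) - m p (Y p) (lie_bracket X E Z p)) (V p)
    = nabla_c g m D E Y Z V p - g p (D (\<lambda>q. m q (Y q) (Z q)) E p) (V p)
      + g p (D Y E p) (m p (Z p) (V p)) + g p (D Z E p) (m p (Y p) (V p))"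
proof -
  note YZ = m_field[OF Y Z]
  have mem: "Y p \<in> tangent_space X p" "Z p \<in> tangent_space X p" "V p \<in> tangent_space X p"
    "D E Y p \<in> tangent_space X p" "D E Z p \<in> tangent_space X p" "D Y E p \<in> tangent_space X p"
    "D Z E p \<in> tangent_space X p" "D E (\<lambda>q. m q (Y q) (Z q)) p \<in> tangent_space X p"
    "D (\<lambda>q. m q (Y q) (Z q)) E p \<in> tangent_space X p" "D E V p \<in> tangent_space X p"
    using vector_field_in[OF Y p] vector_field_in[OF Z p] vector_field_in[OF V p] D_in[OF E Y p] D_in[OF E Z p]
      D_in[OF Y E p] D_in[OF Z E p] D_in[OF E YZ p] D_in[OF YZ E p] D_in[OF E V p] by auto
  have "nabla_c g m D E Y Z V p = g p (D E (\<lambda>q. m q (Y q) (Z q)) p) (V p)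
      - g p (m p (D E Y p) (Z p)) (V p) - g p (m p (Y p) (D E Z p)) (V p)"
    using metric_compatible[OF E YZ V p] by (simp add: nabla_c_def ctensor_def)
  moreover have "lie_bracket X E (\<lambda>q. m q (Y q) (Z q)) p
      - m p (lie_bracket X E Y p) (Z p) - m p (Y p) (lie_bracket X E Z p)
    = D E (\<lambda>q. m q (Y q) (Z q)) p - D (\<lambda>q. m q (Y q) (Z q)) E p
      - (m p (D E Y p) (Z p) - m p (D Y E p) (Z p)) - (m p (D E Z p) (Y p) - m p (D Z E p) (Y p))"
    using mem by (simp add: torsion_free[OF E YZ p] torsion_free[OF E Y p] torsion_free[OF E Z p]
        m_comm[of "Y p"] m_diff_left tangent_space_diff)
  ultimately show ?thesis
    using mem by (simp add: g_diff_left g_plus_left tangent_space_diff m_in m_comm[of "Y p" p "D E Z p"]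
        m_invariant[of "D Y E p"] m_invariant[of "D Z E p"])
qed

end

context metric_manifold
begin

text \<open>
  Cramer's rule, applied to the Gram matrix of a coordinate frame.  The matrix is padded with an
  identity block, since the coordinates of the chart are only part of the index type.
\<close>

lemma raise_index:
  assumes c: "(U, \<kappa>) \<in> max_atlas X" and W: "open_in X W" "W \<subseteq> U"
    and b: "\<And>i. i \<in> idx X \<Longrightarrow> smooth_fun X W (b i)"
  shows "\<exists>u. vector_field X W u \<and>
    (\<forall>q\<in>W. \<forall>i\<in>idx X. g q (u q) (tangent_vector X (U, \<kappa>) q (axis i 1)) = b i q)"
proof -
  define tv where "tv q = tangent_vector X (U, \<kappa>) q" for q
  define G :: "'m \<Rightarrow> 'k ^ 'n ^ 'n" where
    "G q = (\<chi> i j. if i \<in> idx X \<and> j \<in> idx X then g q (tv q (axis i 1)) (tv q (axis j 1))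
        else if i = j then 1 else 0)" for q
  define bv :: "'m \<Rightarrow> 'k ^ 'n" where "bv q = (\<chi> i. if i \<in> idx X then b i q else 0)" for q
  define A :: "'m \<Rightarrow> 'n \<Rightarrow> 'k ^ 'n ^ 'n" where
    "A q k = (\<chi> i j. if j = k then bv q $ i else G q $ i $ j)" for q k
  define u where "u q = tv q (\<chi> k. det (A q k) / det (G q))" for q
  have tvin: "tv q a \<in> tangent_space X q" if "q \<in> W" for q a
    unfolding tv_def using tangent_vectorI[OF c] W(2) that by auto
  have row: "(G q *v x) $ i = g q (tv q x) (tv q (axis i 1))" if q: "q \<in> W" and i: "i \<in> idx X" for q x i
  proof -
    have "(G q *v x) $ i = (\<Sum>j\<in>idx X. g q (tv q (axis i 1)) (tv q (axis j 1)) * x $ j)"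
      unfolding matrix_vector_mult_def G_def using i
      by (auto intro!: sum.mono_neutral_cong_right)
    also have "\<dots> = (\<Sum>j\<in>idx X. x $ j * g q (tv q (axis j 1)) (tv q (axis i 1)))"
      by (intro sum.cong refl) (simp add: g_sym[OF tvin[OF q] tvin[OF q], of "axis i 1"])
    also have "\<dots> = g q (tv q x) (tv q (axis i 1))"
      using g_coords[OF c _ tvin[OF q], of x "axis i 1"] q W(2) by (auto simp: tv_def)
    finally show ?thesis .
  qed
  have row_out: "(G q *v x) $ i = x $ i" if i: "i \<notin> idx X" for q x i
  proof -
    have "(G q *v x) $ i = (\<Sum>j\<in>UNIV. (if i = j then 1 else 0) * x $ j)"
      by (simp add: matrix_vector_mult_def G_def i)
    also have "\<dots> = (\<Sum>j\<in>UNIV. if i = j then x $ j else 0)"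
      by (intro sum.cong) auto
    finally show ?thesis by simp
  qed
  have det: "det (G q) \<noteq> 0" if q: "q \<in> W" for q
  proof -
    have "x = 0" if x: "G q *v x = 0" for x
    proof -
      have "tv q x = 0"
      proof (rule g_nondegenerate[OF tvin[OF q]])
        fix v assume v: "v \<in> tangent_space X q"
        have qU: "q \<in> U" using q W(2) by auto
        obtain a where a: "v = tv q a" using v tangent_space_chart[OF c qU] by (auto simp: tv_def)
        have "g q (tv q x) v = g q v (tv q x)" by (rule g_sym[OF tvin[OF q] v])
        also have "\<dots> = (\<Sum>i\<in>idx X. a $ i * g q (tv q (axis i 1)) (tv q x))"
          unfolding a using g_coords[OF c qU tvin[OF q, of x], of a] by (simp add: tv_def)
        also have "\<dots> = (\<Sum>i\<in>idx X. a $ i * (G q *v x) $ i)"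
          by (intro sum.cong refl) (simp add: row[OF q] g_sym[OF tvin[OF q] tvin[OF q], of x])
        finally show "g q (tv q x) v = 0" using x by simp
      qed
      then have "x $ i = 0" if "i \<in> idx X" for i
        using tangent_vector_coord[OF c _ that, of q x] q W(2) by (auto simp: tv_def)
      moreover have "x $ i = 0" if "i \<notin> idx X" for i
        using row_out[OF that, of q x] x by simp
      ultimately show "x = 0" by (auto simp: vec_eq_iff)
    qed
    then have "invertible (G q)"
      using matrix_left_invertible_ker[of "G q"] invertible_left_inverse[of "G q"] by blast
    then show ?thesis by (simp add: invertible_det_nz)
  qed
  have sG: "smooth_fun X W (\<lambda>q. G q $ i $ j)" for i j
  proof (cases "i \<in> idx X \<and> j \<in> idx X")
    case True
    have "vector_field X W (\<lambda>q. tv q (axis i 1))" for i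
      unfolding tv_def by (rule vector_field_subset[OF vector_field_const[OF c] W])
    then show ?thesis using True by (simp add: G_def g_smooth)
  next
    case False
    then have "(\<lambda>q. G q $ i $ j) = (\<lambda>q. if i = j then 1 else 0)" by (auto simp: G_def)
    then show ?thesis by simp
  qed
  have sb: "smooth_fun X W (\<lambda>q. bv q $ i)" for i
    using b by (cases "i \<in> idx X") (simp_all add: bv_def)
  have sA: "smooth_fun X W (\<lambda>q. A q k $ i $ j)" for k i j
    using sb sG by (cases "j = k") (simp_all add: A_def)
  have "vector_field X W u"
  proof (rule vector_field_chartI[OF c W])
    show "u q = tangent_vector X (U, \<kappa>) q (\<chi> k. (\<lambda>k q. det (A q k) / det (G q)) k q)" for q
      by (simp add: u_def tv_def)
    show "smooth_fun X W (\<lambda>q. det (A q k) / det (G q))" for k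
      using det by (intro smooth_fun_divide smooth_fun_det sA sG) auto
  qed
  moreover have "g q (u q) (tangent_vector X (U, \<kappa>) q (axis i 1)) = b i q" if q: "q \<in> W" and i: "i \<in> idx X" for q i
  proof -
    have "G q *v (\<chi> k. det (A q k) / det (G q)) = bv q"
      using cramer[OF det[OF q]] unfolding A_def by blast
    then have "g q (u q) (tv q (axis i 1)) = bv q $ i"
      unfolding u_def using row[OF q i, of "\<chi> k. det (A q k) / det (G q)"] by simp
    then show ?thesis using i by (simp add: tv_def bv_def)
  qed
  ultimately show ?thesis by blast
qed

end

section \<open>Orthogonal projection\<close>

locale metric_submanifold = smooth_submanifold M N + M: metric_manifold M g
  for M N :: "('m::t2_space, 'k::{real_normed_field, euclidean_space}, 'n::finite) manifold" and g +
  assumes nondegenerate: "nondegenerate N (restrict_metric M g)"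
begin

abbreviation "gN \<equiv> restrict_metric M g"

lemma submanifold_is_metric: "is_metric N gN"
proof -
  have 5: "smooth_fun N B (\<lambda>p. gN p (Y p) (Z p))" if f: "vector_field N B Y" "vector_field N B Z" for B Y Z
  proof (rule N.smooth_fun_local[OF N.vector_field_open[OF f(1)]])
    fix p assume p: "p \<in> B"
    obtain V Y' where V: "field_extends M N V Y' Y" "p \<in> V" "V \<inter> pts N \<subseteq> B" by (rule field_extend[OF f(1) p])
    obtain W Z' where W: "field_extends M N W Z' Z" "p \<in> W" "W \<inter> pts N \<subseteq> B" by (rule field_extend[OF f(2) p])
    have o: "open_in M (V \<inter> W)"
      using field_extendsD(3)[OF V(1)] field_extendsD(3)[OF W(1)] by (rule M.open_in_Int)
    note Y = field_extends_subset[OF V(1) o Int_lower1] and Z = field_extends_subset[OF W(1) o Int_lower2]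
    have "smooth_fun N (V \<inter> W \<inter> pts N) (\<lambda>p. g p (Y' p) (Z' p))"
      by (rule smooth_fun_restrict[OF o M.g_smooth[OF field_extendsD(1)[OF Y] field_extendsD(1)[OF Z]]])
    then have "smooth_fun N (V \<inter> W \<inter> pts N) (\<lambda>p. gN p (Y p) (Z p))"
      by (rule N.smooth_fun_cong) (use field_extendsD(4)[OF Y] field_extendsD(4)[OF Z] in \<open>auto simp: restrict_metric_def\<close>)
    moreover have "p \<in> pts N" using p N.open_in_subset[OF N.vector_field_open[OF f(1)]] by auto
    ultimately show "smooth_near N p (\<lambda>p. gN p (Y p) (Z p))"
      unfolding smooth_near_def using open_in_restrict[OF o] V(2) W(2) by (intro exI[of _ "V \<inter> W \<inter> pts N"]) auto
  qed
  have 4: "u = 0" if "p \<in> pts N" "u \<in> tangent_space N p" "\<forall>v\<in>tangent_space N p. gN p u v = 0" for p u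
    using nondegenerate that unfolding nondegenerate_def by blast
  have 1: "gN p u v = gN p v u" if "u \<in> tangent_space N p" "v \<in> tangent_space N p" for p u v
    unfolding restrict_metric_def using that by (intro M.g_sym incl_in)
  have 2: "gN p (u + u') v = gN p u v + gN p u' v"
    if "u \<in> tangent_space N p" "u' \<in> tangent_space N p" "v \<in> tangent_space N p" for p u u' v
    unfolding restrict_metric_def incl_plus using that by (intro M.g_plus_left incl_in)
  have 3: "gN p (a \<bullet>\<^sub>v u) v = a * gN p u v"
    if "u \<in> tangent_space N p" "v \<in> tangent_space N p" for p u v a
    unfolding restrict_metric_def incl_smul using that by (intro M.g_smul_left incl_in)
  show ?thesis
    unfolding is_metric_def
    by (intro conjI ballI allI impI; rule 1 2 3 4 5; (assumption | erule conjunct1 | erule conjunct2))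
qed

sublocale N: metric_manifold N gN
  by unfold_locales (rule submanifold_is_metric)

definition normal :: "'m \<Rightarrow> ('m, 'k) tvec \<Rightarrow> bool" where
  "normal p w \<longleftrightarrow> w \<in> tangent_space M p \<and> (\<forall>v\<in>tangent_space N p. g p w (incl M p v) = 0)"

lemma normal_in: "normal p w \<Longrightarrow> w \<in> tangent_space M p"
  by (simp add: normal_def)

lemma normalD: "normal p w \<Longrightarrow> v \<in> tangent_space N p \<Longrightarrow> g p w (incl M p v) = 0"
  by (simp add: normal_def)

lemma normal_diff: "normal p v \<Longrightarrow> normal p w \<Longrightarrow> normal p (v - w)"
  unfolding normal_def using M.g_diff_left incl_in M.tangent_space_diff by auto

lemma normal_smul: "normal p w \<Longrightarrow> normal p (a \<bullet>\<^sub>v w)"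
  unfolding normal_def by (auto simp: M.g_smul_left incl_in intro: M.tangent_space_smul)

lemma normal_tangent:
  assumes "normal p (incl M p v)" "v \<in> tangent_space N p"
  shows "v = 0"
  by (rule N.g_nondegenerate[OF assms(2)]) (use assms(1) in \<open>auto simp: normal_def restrict_metric_def\<close>)

text \<open>
  Two candidates for the projection differ by a vector that is both tangent and normal, hence 0, the
  metric of \<open>N\<close> being nondegenerate.
\<close>

lemma pr_eqI:
  assumes w: "w \<in> tangent_space M p" and u: "u \<in> tangent_space N p" and n: "normal p (w - incl M p u)"
  shows "pr M N g p w = u"
  unfolding pr_def
proof (rule the_equality)
  show "u \<in> tangent_space N p \<and> (\<forall>v\<in>sub_tangent_space M N p. g p (w - incl M p u) v = 0)"
    using u n by (auto simp: sub_tangent_space_def normal_def)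
  fix u' assume u': "u' \<in> tangent_space N p \<and> (\<forall>v\<in>sub_tangent_space M N p. g p (w - incl M p u') v = 0)"
  then have "normal p (w - incl M p u')"
    using w by (auto simp: normal_def sub_tangent_space_def intro!: M.tangent_space_diff incl_in)
  from normal_diff[OF n this] have "normal p (incl M p (u' - u))"
    by (simp add: incl_diff)
  then have "u' - u = 0"
    using u u' by (intro normal_tangent N.tangent_space_diff) auto
  then show "u' = u" by simp
qed

lemma pr_incl: "u \<in> tangent_space N p \<Longrightarrow> pr M N g p (incl M p u) = u"
  by (rule pr_eqI)
     (auto simp: normal_def incl_in M.g_zero_left intro: M.tangent_space_0 M.tangent_space_pts[OF incl_in])

text \<open>
  The projection raises the index of the covector field \<open>g(V, \<cdot>)\<close>, restricted to \<open>TN\<close>, with the metric of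
  \<open>N\<close>.  This gives existence and smoothness at once.
\<close>

lemma proj_field_smooth:
  assumes V: "vector_field M W V"
  shows "vector_field N (W \<inter> pts N) (proj_field M N g V)"
    and "\<And>p. p \<in> W \<Longrightarrow> p \<in> pts N \<Longrightarrow> normal p (V p - incl M p (proj_field M N g V p))"
proof -
  have W: "open_in M W" using V by (rule M.vector_field_open)
  have loc: "\<exists>B. p \<in> B \<and> vector_field N B (proj_field M N g V) \<and> normal p (V p - incl M p (proj_field M N g V p))"
    if p: "p \<in> W" "p \<in> pts N" for p
  proof -
    obtain U \<kappa> where s: "slice U \<kappa>" and pU: "p \<in> U" using slice_at p(2) by blast
    note c = slice_max[OF s] and cN = slice_N[OF s]
    let ?B = "W \<inter> U \<inter> pts N"
    let ?e = "\<lambda>i q. tangent_vector N (U \<inter> pts N, \<kappa>) q (axis i 1)"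
    have oU: "open_in M (W \<inter> U)" using W M.chart_domain_open[OF c] by (rule M.open_in_Int)
    have B: "open_in N ?B" "?B \<subseteq> U \<inter> pts N" using open_in_restrict[OF oU] by auto
    have sb: "smooth_fun N ?B (\<lambda>q. g q (V q) (incl M q (?e i q)))" if "i \<in> idx N" for i
    proof (rule N.smooth_fun_cong)
      show "smooth_fun N ?B (\<lambda>q. g q (V q) (tangent_vector M (U, \<kappa>) q (axis i 1)))"
        by (rule smooth_fun_restrict[OF oU], rule M.g_smooth)
           (rule M.vector_field_subset[OF V oU] M.vector_field_subset[OF M.vector_field_const[OF c] oU]; simp)+
      fix q assume "q \<in> ?B"
      then have "incl M q (?e i q) = tangent_vector M (U, \<kappa>) q (axis i 1)"
        by (subst incl_tangent_vector[OF s]) (use \<open>i \<in> idx N\<close> in \<open>auto intro!: M.tangent_vector_cong simp: axis_def\<close>)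
      then show "g q (V q) (incl M q (?e i q)) = g q (V q) (tangent_vector M (U, \<kappa>) q (axis i 1))" by simp
    qed
    from N.raise_index[OF cN B sb]
    obtain u where "vector_field N ?B u \<and>
        (\<forall>q\<in>?B. \<forall>i\<in>idx N. gN q (u q) (?e i q) = g q (V q) (incl M q (?e i q)))" ..
    then have u: "vector_field N ?B u"
        "\<And>q i. q \<in> ?B \<Longrightarrow> i \<in> idx N \<Longrightarrow> gN q (u q) (?e i q) = g q (V q) (incl M q (?e i q))"
      by blast+
    have n: "normal q (V q - incl M q (u q))" if q: "q \<in> ?B" for q
    proof -
      have Vq: "V q \<in> tangent_space M q" using M.vector_field_in[OF V] q by auto
      have uq: "u q \<in> tangent_space N q" using N.vector_field_in[OF u(1)] q by auto
      have qU: "q \<in> U \<inter> pts N" using q by auto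
      have "g q (V q - incl M q (u q)) (incl M q v) = 0" if v: "v \<in> tangent_space N q" for v
      proof -
        have "v \<in> range (tangent_vector N (U \<inter> pts N, \<kappa>) q)" using v N.tangent_space_chart[OF cN qU] by auto
        then obtain a where a: "v = tangent_vector N (U \<inter> pts N, \<kappa>) q a" by auto
        have e: "?e i q \<in> tangent_space N q" for i by (rule N.tangent_vectorI[OF cN qU])
        let ?a = "\<chi> i. if i \<in> idx N then a $ i else 0"
        have ie: "incl M q (?e i q) = tangent_vector M (U, \<kappa>) q (axis i 1)" if "i \<in> idx N" for i
          by (subst incl_tangent_vector[OF s qU]) (use that in \<open>auto intro!: M.tangent_vector_cong simp: axis_def\<close>)
        have "g q (V q) (incl M q v) = g q (tangent_vector M (U, \<kappa>) q ?a) (V q)"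
          unfolding a incl_tangent_vector[OF s qU] using qU by (intro M.g_sym[OF Vq] M.tangent_vectorI[OF c]) auto
        also have "\<dots> = (\<Sum>i\<in>idx M. ?a $ i * g q (tangent_vector M (U, \<kappa>) q (axis i 1)) (V q))"
          using qU by (intro M.g_coords[OF c _ Vq]) auto
        also have "\<dots> = (\<Sum>i\<in>idx N. a $ i * g q (tangent_vector M (U, \<kappa>) q (axis i 1)) (V q))"
          using idx_subset by (intro sum.mono_neutral_cong_right) auto
        also have "\<dots> = (\<Sum>i\<in>idx N. a $ i * gN q (?e i q) (u q))"
        proof (intro sum.cong refl arg_cong[where f = "\<lambda>x. _ * x"])
          fix i assume i: "i \<in> idx N"
          have "gN q (?e i q) (u q) = gN q (u q) (?e i q)" by (rule N.g_sym[OF e uq])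
          also have "\<dots> = g q (V q) (incl M q (?e i q))" by (rule u(2)[OF q i])
          also have "\<dots> = g q (incl M q (?e i q)) (V q)" by (rule M.g_sym[OF Vq incl_in[OF e]])
          finally show "g q (tangent_vector M (U, \<kappa>) q (axis i 1)) (V q) = gN q (?e i q) (u q)"
            using ie[OF i] by simp
        qed
        also have "\<dots> = gN q v (u q)"
          unfolding a by (rule N.g_coords[OF cN qU uq, symmetric])
        also have "\<dots> = gN q (u q) v" by (rule N.g_sym[OF v uq])
        also have "\<dots> = g q (incl M q (u q)) (incl M q v)" by (simp add: restrict_metric_def)
        finally show ?thesis using M.g_diff_left[OF Vq incl_in[OF uq] incl_in[OF v]] by simp
      qed
      then show ?thesis
        using M.tangent_space_diff[OF Vq incl_in[OF uq]] by (simp add: normal_def)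
    qed
    have eq: "proj_field M N g V q = u q" if q: "q \<in> ?B" for q
      unfolding proj_field_def
      by (rule pr_eqI[OF _ _ n[OF q]]) (use q M.vector_field_in[OF V] N.vector_field_in[OF u(1)] in auto)
    have "vector_field N ?B (proj_field M N g V)"
      using N.vector_field_cong[OF u(1) eq] .
    then show ?thesis using n[of p] eq[of p] p pU by (intro exI[of _ ?B]) auto
  qed
  show "vector_field N (W \<inter> pts N) (proj_field M N g V)"
  proof (rule N.vector_field_local[OF open_in_restrict[OF W]])
    show "\<exists>W'. p \<in> W' \<and> vector_field N W' (proj_field M N g V)" if "p \<in> W \<inter> pts N" for p
      using loc[of p] that by blast
  qed
  show "normal p (V p - incl M p (proj_field M N g V p))" if "p \<in> W" "p \<in> pts N" for p
    using loc[OF that] by blast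
qed

lemma tangent_extend_at:
  assumes v: "v \<in> tangent_space N p" and W: "open_in M W" "p \<in> W"
  obtains V' V B where "field_extends M N B V' V" "p \<in> B" "B \<subseteq> W" "V p = v"
proof -
  obtain C V where C: "vector_field N C V" "p \<in> C" "V p = v" using v by (rule N.tangent_extend)
  obtain B V' where B: "field_extends M N B V' V" "p \<in> B" "B \<inter> pts N \<subseteq> C" by (rule field_extend[OF C(1,2)])
  have o: "open_in M (B \<inter> W)" using field_extendsD(3)[OF B(1)] W(1) by (rule M.open_in_Int)
  show ?thesis
    by (rule that[OF field_extends_subset[OF B(1) o Int_lower1]]) (use B C W in auto)
qed

end

section \<open>Hypersurfaces\<close>

locale metric_hypersurface = metric_submanifold M N g
  for M N :: "('m::t2_space, 'k::{real_normed_field, euclidean_space}, 'n::finite) manifold" and g +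
  assumes codim_one: "card (idx M) = card (idx N) + 1"
begin

text \<open>
  In a slice chart one coordinate is left, and the normal field is the corresponding coordinate field
  minus its projection.  It cannot be isotropic: it would be orthogonal to everything.
\<close>

lemma normal_frame:
  assumes p: "p \<in> pts N"
  obtains W \<xi> where "vector_field M W \<xi>" "p \<in> W"
    "\<And>q. q \<in> W \<Longrightarrow> q \<in> pts N \<Longrightarrow> normal q (\<xi> q)"
    "\<And>q. q \<in> W \<Longrightarrow> q \<in> pts N \<Longrightarrow> g q (\<xi> q) (\<xi> q) \<noteq> 0"
    "\<And>q w. q \<in> W \<Longrightarrow> q \<in> pts N \<Longrightarrow> w \<in> tangent_space M q \<Longrightarrow>
      \<exists>c. \<exists>v\<in>tangent_space N q. w = c \<bullet>\<^sub>v \<xi> q + incl M q v"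
proof -
  obtain U \<kappa> where s: "slice U \<kappa>" and pU: "p \<in> U" using slice_at p by blast
  note c = slice_max[OF s] and cN = slice_N[OF s]
  have "card (idx M - idx N) = 1"
    using codim_one idx_subset by (simp add: card_Diff_subset)
  then obtain k where "idx M - idx N = {k}" by (auto simp: card_Suc_eq)
  then have k: "idx M = insert k (idx N)" "k \<notin> idx N" using idx_subset by auto
  define V where "V q = tangent_vector M (U, \<kappa>) q (axis k 1)" for q
  have V: "vector_field M U V" unfolding V_def by (rule M.vector_field_const[OF c])
  define P where "P = proj_field M N g V"
  have P: "vector_field N (U \<inter> pts N) P" unfolding P_def by (rule proj_field_smooth(1)[OF V])
  obtain B P' where B: "field_extends M N B P' P" "p \<in> B" "B \<inter> pts N \<subseteq> U \<inter> pts N"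
    by (rule field_extend[OF P]) (use p pU in auto)
  define W where "W = B \<inter> U"
  define \<xi> where "\<xi> q = V q - P' q" for q
  have W: "open_in M W" unfolding W_def using field_extendsD(3)[OF B(1)] M.chart_domain_open[OF c] by (rule M.open_in_Int)
  have \<xi>: "vector_field M W \<xi>"
    unfolding \<xi>_def
    by (rule M.vector_field_diff[OF M.vector_field_subset[OF V W] M.vector_field_subset[OF field_extendsD(1)[OF B(1)] W]])
       (auto simp: W_def)
  have \<xi>q: "\<xi> q = V q - incl M q (P q)" "P q \<in> tangent_space N q" "normal q (\<xi> q)" if q: "q \<in> W" "q \<in> pts N" for q
  proof -
    have qB: "q \<in> B" "q \<in> U" using q by (auto simp: W_def)
    show 1: "\<xi> q = V q - incl M q (P q)" using field_extendsD(4)[OF B(1) qB(1) q(2)] by (simp add: \<xi>_def)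
    show "P q \<in> tangent_space N q" using field_extendsD(5)[OF B(1) qB(1) q(2)] .
    show "normal q (\<xi> q)" unfolding 1 P_def by (rule proj_field_smooth(2)[OF V qB(2) q(2)])
  qed
  have dec: "\<exists>c. \<exists>v\<in>tangent_space N q. w = c \<bullet>\<^sub>v \<xi> q + incl M q v"
    if q: "q \<in> W" "q \<in> pts N" and w: "w \<in> tangent_space M q" for q w
  proof -
    have qU: "q \<in> U \<inter> pts N" using q by (auto simp: W_def)
    then have "w \<in> range (tangent_vector M (U, \<kappa>) q)" using w M.tangent_space_chart[OF c] by auto
    then obtain a where a: "w = tangent_vector M (U, \<kappa>) q a" by auto
    let ?v = "a $ k \<bullet>\<^sub>v P q + tangent_vector N (U \<inter> pts N, \<kappa>) q a"
    have "w = a $ k \<bullet>\<^sub>v V q + tangent_vector M (U, \<kappa>) q (\<chi> i. if i \<in> idx N then a $ i else 0)"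
      unfolding a V_def M.tangent_vector_smul M.tangent_vector_plus
      by (rule M.tangent_vector_cong) (use k in \<open>auto simp: axis_def\<close>)
    also have "tangent_vector M (U, \<kappa>) q (\<chi> i. if i \<in> idx N then a $ i else 0)
        = incl M q (tangent_vector N (U \<inter> pts N, \<kappa>) q a)"
      by (rule incl_tangent_vector[OF s qU, symmetric])
    also have "V q = \<xi> q + incl M q (P q)" using \<xi>q(1)[OF q] by simp
    finally have "w = a $ k \<bullet>\<^sub>v \<xi> q + incl M q ?v"
      unfolding incl_plus incl_smul by (simp add: smul_def fun_eq_iff distrib_left)
    moreover have "?v \<in> tangent_space N q"
      using \<xi>q(2)[OF q] N.tangent_vectorI[OF cN qU] by (intro N.tangent_space_plus N.tangent_space_smul)
    ultimately show ?thesis by blast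
  qed
  have nz: "g q (\<xi> q) (\<xi> q) \<noteq> 0" if q: "q \<in> W" "q \<in> pts N" for q
  proof
    assume z: "g q (\<xi> q) (\<xi> q) = 0"
    note n = \<xi>q(3)[OF q]
    have "\<xi> q = 0"
    proof (rule M.g_nondegenerate[OF normal_in[OF n]])
      fix w assume w: "w \<in> tangent_space M q"
      obtain c v where cv: "v \<in> tangent_space N q" "w = c \<bullet>\<^sub>v \<xi> q + incl M q v" using dec[OF q w] by auto
      have "g q (\<xi> q) w = g q (\<xi> q) (c \<bullet>\<^sub>v \<xi> q) + g q (\<xi> q) (incl M q v)"
        unfolding cv(2) by (intro M.g_plus_right M.tangent_space_smul normal_in[OF n] incl_in cv(1))
      then show "g q (\<xi> q) w = 0"
        using z normalD[OF n cv(1)] M.g_smul_right[OF normal_in[OF n] normal_in[OF n], of c] by simp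
    qed
    then have VP: "V q = incl M q (P q)" using \<xi>q(1)[OF q] by simp
    have qU: "q \<in> U" "q \<in> U \<inter> pts N" using q by (auto simp: W_def)
    have "P q \<in> range (tangent_vector N (U \<inter> pts N, \<kappa>) q)" using \<xi>q(2)[OF q] N.tangent_space_chart[OF cN qU(2)] by auto
    then obtain a where a: "P q = tangent_vector N (U \<inter> pts N, \<kappa>) q a" by auto
    have "V q (\<lambda>q. \<kappa> q $ k) = 1"
      unfolding V_def using M.tangent_vector_coord[OF c qU(1), of k] k by simp
    moreover have "incl M q (P q) (\<lambda>q. \<kappa> q $ k) = 0"
      unfolding a incl_tangent_vector[OF s qU(2)] using M.tangent_vector_coord[OF c qU(1), of k] k by simp
    ultimately show False using VP by simp
  qed
  show ?thesis
    by (rule that[OF \<xi> _ \<xi>q(3) nz dec]) (use B(2) pU in \<open>auto simp: W_def\<close>)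
qed

text \<open>Normal spaces are lines, so that any nonzero normal vector can replace the one of the frame.\<close>

lemma normal_spans:
  assumes p: "p \<in> pts N" and n: "normal p n" "n \<noteq> 0"
  shows "g p n n \<noteq> 0"
    and "\<And>w. normal p w \<Longrightarrow> \<exists>c. w = c \<bullet>\<^sub>v n"
    and "\<And>w. w \<in> tangent_space M p \<Longrightarrow> g p n w = 0 \<Longrightarrow> w \<in> sub_tangent_space M N p"
proof -
  obtain W \<xi> where W: "vector_field M W \<xi>" "p \<in> W" and
      \<xi>0: "\<And>q. q \<in> W \<Longrightarrow> q \<in> pts N \<Longrightarrow> normal q (\<xi> q)"
      "\<And>q. q \<in> W \<Longrightarrow> q \<in> pts N \<Longrightarrow> g q (\<xi> q) (\<xi> q) \<noteq> 0"
      "\<And>q w. q \<in> W \<Longrightarrow> q \<in> pts N \<Longrightarrow> w \<in> tangent_space M q \<Longrightarrow>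
        \<exists>c. \<exists>v\<in>tangent_space N q. w = c \<bullet>\<^sub>v \<xi> q + incl M q v"
    by (rule normal_frame[OF p]) blast
  note \<xi> = \<xi>0(1)[OF W(2) p] \<xi>0(2)[OF W(2) p] \<xi>0(3)[OF W(2) p]
  note \<xi>in = normal_in[OF \<xi>(1)]
  have line: "\<exists>c. w = c \<bullet>\<^sub>v \<xi> p" if w: "normal p w" for w
  proof -
    obtain c v where cv: "v \<in> tangent_space N p" "w = c \<bullet>\<^sub>v \<xi> p + incl M p v" using \<xi>(3)[OF normal_in[OF w]] by auto
    have "normal p (incl M p v)"
      using normal_diff[OF w normal_smul[OF \<xi>(1), of c]] cv(2) by simp
    then have "v = 0" using cv(1) by (rule normal_tangent)
    then show ?thesis using cv(2) by (auto simp: incl_zero)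
  qed
  obtain c where c: "n = c \<bullet>\<^sub>v \<xi> p" using line[OF n(1)] by blast
  have c0: "c \<noteq> 0" using c n(2) M.smul_zero by auto
  show "g p n n \<noteq> 0"
    unfolding c using \<xi>(2) c0 by (simp add: M.g_smul_left M.g_smul_right M.tangent_space_smul \<xi>in)
  show "\<exists>c. w = c \<bullet>\<^sub>v n" if w: "normal p w" for w
  proof -
    obtain d where "w = d \<bullet>\<^sub>v \<xi> p" using line[OF w] by blast
    then have "w = (d / c) \<bullet>\<^sub>v n" using c c0 by (simp add: smul_def fun_eq_iff)
    then show ?thesis by blast
  qed
  show "w \<in> sub_tangent_space M N p" if w: "w \<in> tangent_space M p" "g p n w = 0" for w
  proof -
    obtain d v where dv: "v \<in> tangent_space N p" "w = d \<bullet>\<^sub>v \<xi> p + incl M p v" using \<xi>(3)[OF w(1)] by auto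
    have "g p n w = g p n (d \<bullet>\<^sub>v \<xi> p) + g p n (incl M p v)"
      unfolding dv(2) by (intro M.g_plus_right M.tangent_space_smul \<xi>in incl_in dv(1) normal_in[OF n(1)])
    also have "\<dots> = d * (c * g p (\<xi> p) (\<xi> p))"
      using normalD[OF n(1) dv(1)] by (simp add: c M.g_smul_left M.g_smul_right M.tangent_space_smul \<xi>in)
    finally have "d = 0" using w(2) c0 \<xi>(2) by simp
    then show ?thesis using dv by (auto simp: M.smul_zero sub_tangent_space_def)
  qed
qed

end

section \<open>The second fundamental form\<close>

lemma levi_civita_unique:
  assumes D: "levi_civita_manifold X g D" and D': "levi_civita_manifold X g D'"
    and f: "vector_field X W Y" "vector_field X W Z" "p \<in> W"
  shows "D Y Z p = D' Y Z p"
proof -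
  interpret D: levi_civita_manifold X g D by (rule D)
  interpret D': levi_civita_manifold X g D' by (rule D')
  note DZ = D.D_in[OF f] and DZ' = D'.D_in[OF f]
  have "D Y Z p - D' Y Z p = 0"
  proof (rule D.g_nondegenerate[OF D.tangent_space_diff[OF DZ DZ']])
    fix v assume v: "v \<in> tangent_space X p"
    then obtain B V where V: "vector_field X B V" "p \<in> B" "V p = v" by (rule D.tangent_extend)
    have o: "open_in X (W \<inter> B)" using D.vector_field_open[OF f(1)] D.vector_field_open[OF V(1)] by (rule D.open_in_Int)
    note f' = D.vector_field_subset[OF f(1) o Int_lower1] D.vector_field_subset[OF f(2) o Int_lower1]
      D.vector_field_subset[OF V(1) o Int_lower2] IntI[OF f(3) V(2)]
    have "2 * g p (D Y Z p) (V p) = 2 * g p (D' Y Z p) (V p)"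
      using D.koszul[OF f'] D'.koszul[OF f'] by simp
    then show "g p (D Y Z p - D' Y Z p) v = 0"
      using D.g_diff_left[OF DZ DZ' v] V(3) by simp
  qed
  then show ?thesis by simp
qed

locale levi_civita_submanifold = metric_submanifold M N g + M: levi_civita_manifold M g DM
    + N: levi_civita_manifold N "restrict_metric M g" DN
  for M N :: "('m::t2_space, 'k::{real_normed_field, euclidean_space}, 'n::finite) manifold" and g DM DN
begin

text \<open>Koszul's formula has the same right-hand side on both manifolds.\<close>

lemma DM_tangential_part:
  assumes Y: "field_extends M N W Y' Y" and Z: "field_extends M N W Z' Z" and p: "p \<in> W" "p \<in> pts N"
  shows "normal p (DM Y' Z' p - incl M p (DN Y Z p))"
proof -
  have pW: "p \<in> W \<inter> pts N" using p by auto
  note DMin = M.D_in[OF field_extendsD(1)[OF Y] field_extendsD(1)[OF Z] p(1)]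
    and DNin = N.D_in[OF field_extendsD(2)[OF Y] field_extendsD(2)[OF Z] pW]
  have "g p (DM Y' Z' p - incl M p (DN Y Z p)) (incl M p v) = 0" if v: "v \<in> tangent_space N p" for v
  proof -
    obtain V' V B where V: "field_extends M N B V' V" "p \<in> B" "B \<subseteq> W" "V p = v"
      by (rule tangent_extend_at[OF v field_extendsD(3)[OF Y] p(1)])
    note o = field_extendsD(3)[OF V(1)]
    note Y1 = field_extends_subset[OF Y o V(3)] and Z1 = field_extends_subset[OF Z o V(3)]
    have pB: "p \<in> B \<inter> pts N" using V(2) p(2) by auto
    have der: "A' p (\<lambda>q. g q (B' q) (C' q)) = A p (\<lambda>q. gN q (B q) (C q))"
      if A: "field_extends M N W A' A" and B: "field_extends M N W B' B" and C: "field_extends M N W C' C"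
        and pp: "p \<in> W" for A' A B' B C' C W
    proof -
      have "incl M p (A p) (\<lambda>q. g q (B' q) (C' q)) = A p (\<lambda>q. gN q (B q) (C q))"
        by (rule incl_apply_cong[OF field_extendsD(5)[OF A pp p(2)] field_extendsD(3)[OF A] pp
              M.g_smooth[OF field_extendsD(1)[OF B] field_extendsD(1)[OF C]]])
           (use field_extendsD(4)[OF B] field_extendsD(4)[OF C] in \<open>auto simp: restrict_metric_def\<close>)
      then show ?thesis using field_extendsD(4)[OF A pp p(2)] by simp
    qed
    have lie: "g p (lie_bracket M A' B' p) (C' p) = gN p (lie_bracket N A B p) (C p)"
      if A: "field_extends M N W A' A" and B: "field_extends M N W B' B" and C: "field_extends M N W C' C"
        and pp: "p \<in> W" for A' A B' B C' C W
      using lie_bracket_incl[OF A B pp p(2)] field_extendsD(4)[OF C pp p(2)] by (simp add: restrict_metric_def)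
    have "2 * g p (DM Y' Z' p) (V' p) = 2 * gN p (DN Y Z p) (V p)"
      unfolding M.koszul[OF field_extendsD(1)[OF Y1] field_extendsD(1)[OF Z1] field_extendsD(1)[OF V(1)] V(2)]
        N.koszul[OF field_extendsD(2)[OF Y1] field_extendsD(2)[OF Z1] field_extendsD(2)[OF V(1)] pB]
        der[OF Y1 Z1 V(1) V(2)] der[OF Z1 Y1 V(1) V(2)] der[OF V(1) Y1 Z1 V(2)]
        lie[OF Y1 Z1 V(1) V(2)] lie[OF Y1 V(1) Z1 V(2)] lie[OF Z1 V(1) Y1 V(2)] by (rule refl)
    then have "g p (DM Y' Z' p) (incl M p v) = g p (incl M p (DN Y Z p)) (incl M p v)"
      using field_extendsD(4)[OF V(1,2) p(2)] V(4) by (simp add: restrict_metric_def)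
    then show ?thesis
      using M.g_diff_left[OF DMin incl_in[OF DNin] incl_in[OF v]] by simp
  qed
  then show ?thesis
    unfolding normal_def using M.tangent_space_diff[OF DMin incl_in[OF DNin]] by simp
qed

lemma g_DM_tangent:
  assumes Y: "field_extends M N W Y' Y" and Z: "field_extends M N W Z' Z" and p: "p \<in> W" "p \<in> pts N"
    and v: "v \<in> tangent_space N p"
  shows "g p (DM Y' Z' p) (incl M p v) = gN p (DN Y Z p) v"
proof -
  have pW: "p \<in> W \<inter> pts N" using p by auto
  note DMin = M.D_in[OF field_extendsD(1)[OF Y] field_extendsD(1)[OF Z] p(1)]
    and DNin = N.D_in[OF field_extendsD(2)[OF Y] field_extendsD(2)[OF Z] pW]
  show ?thesis
    using normalD[OF DM_tangential_part[OF Y Z p] v] M.g_diff_left[OF DMin incl_in[OF DNin] incl_in[OF v]]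
    by (simp add: restrict_metric_def)
qed

text \<open>
  Weingarten's equation.  The function \<open>g(\<nu>, Z)\<close> vanishes along the submanifold, and so does its
  derivative in a tangential direction.
\<close>

lemma weingarten:
  assumes n: "vector_field M W \<nu>" "\<And>q. q \<in> W \<Longrightarrow> q \<in> pts N \<Longrightarrow> normal q (\<nu> q)"
    and Y: "field_extends M N W Y' Y" and Z: "field_extends M N W Z' Z" and p: "p \<in> W" "p \<in> pts N"
  shows "g p (DM Y' \<nu> p) (Z' p) = - g p (\<nu> p) (DM Y' Z' p)"
proof -
  have Yp: "Y p \<in> tangent_space N p" using field_extendsD(5)[OF Y p] .
  have "incl M p (Y p) (\<lambda>q. g q (\<nu> q) (Z' q)) = Y p (\<lambda>q. 0)"
    by (rule incl_apply_cong[OF Yp field_extendsD(3)[OF Y] p(1) M.g_smooth[OF n(1) field_extendsD(1)[OF Z]]])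
       (use field_extendsD(4,5)[OF Z] normalD[OF n(2)] in auto)
  then have "Y' p (\<lambda>q. g q (\<nu> q) (Z' q)) = 0"
    using N.tangent_const[OF Yp] field_extendsD(4)[OF Y p] by simp
  then show ?thesis
    using M.metric_compatible[OF field_extendsD(1)[OF Y] n(1) field_extendsD(1)[OF Z] p(1)]
    by (simp add: eq_neg_iff_add_eq_0)
qed

text \<open>The antisymmetric part of \<open>\<nabla>\<^sub>YZ\<close> is the Lie bracket, which is tangent.\<close>

lemma sff_symmetric:
  assumes n: "normal p n" and Y: "field_extends M N W Y' Y" and Z: "field_extends M N W Z' Z"
    and p: "p \<in> W" "p \<in> pts N"
  shows "g p n (DM Y' Z' p) = g p n (DM Z' Y' p)"
proof -
  note YM = field_extendsD(1)[OF Y] and ZM = field_extendsD(1)[OF Z]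
  have pW: "p \<in> W \<inter> pts N" using p by auto
  have "DM Y' Z' p - DM Z' Y' p = incl M p (lie_bracket N Y Z p)"
    using M.torsion_free[OF YM ZM p(1)] lie_bracket_incl[OF Y Z p] by simp
  moreover have "lie_bracket N Y Z p \<in> tangent_space N p"
    unfolding N.torsion_free[OF field_extendsD(2)[OF Y] field_extendsD(2)[OF Z] pW]
    by (intro N.tangent_space_diff N.D_in[OF field_extendsD(2)[OF Y] field_extendsD(2)[OF Z] pW]
        N.D_in[OF field_extendsD(2)[OF Z] field_extendsD(2)[OF Y] pW])
  ultimately show ?thesis
    using normalD[OF n] M.g_diff_right[OF M.D_in[OF YM ZM p(1)] M.D_in[OF ZM YM p(1)] normal_in[OF n]] by simp
qed

text \<open>
  For a normal vector \<open>n\<close>, orthogonality to the second fundamental form is a condition on \<open>\<nabla>\<^sub>YZ\<close>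
  itself, the tangential part of \<open>\<nabla>\<^sub>YZ\<close> being orthogonal to \<open>n\<close> anyway.
\<close>

definition sff_orthogonal :: "'m \<Rightarrow> ('m, 'k) tvec \<Rightarrow> bool" where
  "sff_orthogonal p n \<longleftrightarrow> (\<forall>W Y' Y Z' Z. field_extends M N W Y' Y \<longrightarrow> field_extends M N W Z' Z \<longrightarrow>
     p \<in> W \<longrightarrow> g p n (DM Y' Z' p) = 0)"

lemma sff_orthogonalD:
  "sff_orthogonal p n \<Longrightarrow> field_extends M N W Y' Y \<Longrightarrow> field_extends M N W Z' Z \<Longrightarrow> p \<in> W \<Longrightarrow>
   g p n (DM Y' Z' p) = 0"
  unfolding sff_orthogonal_def by blast

lemma sff_orthogonal_smul:
  assumes "sff_orthogonal p n" "n \<in> tangent_space M p"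
  shows "sff_orthogonal p (a \<bullet>\<^sub>v n)"
  unfolding sff_orthogonal_def
proof (intro allI impI)
  fix W Y' Y Z' Z assume *: "field_extends M N W Y' Y" "field_extends M N W Z' Z" "p \<in> W"
  show "g p (a \<bullet>\<^sub>v n) (DM Y' Z' p) = 0"
    using M.g_smul_left[OF assms(2) M.D_in[OF field_extendsD(1)[OF *(1)] field_extendsD(1)[OF *(2)] *(3)]]
      sff_orthogonalD[OF assms(1) *] by simp
qed

lemma sff_orthogonal_zero: "p \<in> pts N \<Longrightarrow> sff_orthogonal p 0"
  unfolding sff_orthogonal_def using M.g_zero_left[OF M.D_in] field_extendsD(1) by blast

lemma sff_orthogonalI:
  assumes U: "open_in M U" "p \<in> U"
    and *: "\<And>W Y' Y Z' Z. field_extends M N W Y' Y \<Longrightarrow> field_extends M N W Z' Z \<Longrightarrow> p \<in> W \<Longrightarrow> W \<subseteq> U \<Longrightarrow>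
      g p n (DM Y' Z' p) = 0"
  shows "sff_orthogonal p n"
  unfolding sff_orthogonal_def
proof (intro allI impI)
  fix W Y' Y Z' Z assume f: "field_extends M N W Y' Y" "field_extends M N W Z' Z" "p \<in> W"
  have o: "open_in M (W \<inter> U)" using field_extendsD(3)[OF f(1)] U(1) by (rule M.open_in_Int)
  show "g p n (DM Y' Z' p) = 0"
    by (rule *[OF field_extends_subset[OF f(1) o Int_lower1] field_extends_subset[OF f(2) o Int_lower1]])
       (use f U in auto)
qed

lemma agree_sff_orthogonal:
  assumes a: "connections_agree M N DM DN" and p: "p \<in> pts N" and n: "normal p n"
  shows "sff_orthogonal p n"
  unfolding sff_orthogonal_def
proof (intro allI impI)
  fix W Y' Y Z' Z assume f: "field_extends M N W Y' Y" "field_extends M N W Z' Z" "p \<in> W"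
  have "DM Y' Z' p = incl M p (DN Y Z p)"
    using a f p unfolding connections_agree_def field_extends_def by blast
  moreover have "DN Y Z p \<in> tangent_space N p"
    by (rule N.D_in[OF field_extendsD(2)[OF f(1)] field_extendsD(2)[OF f(2)]]) (use f p in auto)
  ultimately show "g p n (DM Y' Z' p) = 0" using normalD[OF n] by simp
qed

text \<open>
  Along the submanifold \<open>V'\<close> is the tangential part of \<open>V\<close> and \<open>V - V'\<close> the normal part; both are
  fields on an open set of \<open>M\<close>, so that they can be differentiated there.
\<close>

definition field_splits :: "'m set \<Rightarrow> ('m, 'k) vfield \<Rightarrow> ('m, 'k) vfield \<Rightarrow> ('m, 'k) vfield \<Rightarrow> bool" where
  "field_splits W V V' V\<^sub>N \<longleftrightarrow> vector_field M W V \<and> field_extends M N W V' V\<^sub>N \<and>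
     (\<forall>q\<in>W \<inter> pts N. normal q (V q - V' q))"

lemma field_splitsD:
  assumes "field_splits W V V' V\<^sub>N"
  shows "vector_field M W V" "field_extends M N W V' V\<^sub>N" "vector_field M W (\<lambda>q. V q - V' q)"
    "\<And>q. q \<in> W \<Longrightarrow> q \<in> pts N \<Longrightarrow> normal q (V q - V' q)"
  using assms field_extendsD(1)[of W V' V\<^sub>N] M.vector_field_diff[of W V V'] by (auto simp: field_splits_def)

lemma field_splits_subset:
  "field_splits W V V' V\<^sub>N \<Longrightarrow> open_in M B \<Longrightarrow> B \<subseteq> W \<Longrightarrow> field_splits B V V' V\<^sub>N"
  unfolding field_splits_def using M.vector_field_subset field_extends_subset by blast

lemma field_splits_exists:
  assumes V: "vector_field M W V" and p: "p \<in> W" "p \<in> pts N"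
  obtains B V' where "field_splits B V V' (proj_field M N g V)" "p \<in> B" "B \<subseteq> W"
proof -
  note P = proj_field_smooth[OF V]
  obtain C V' where C: "field_extends M N C V' (proj_field M N g V)" "p \<in> C" "C \<inter> pts N \<subseteq> W \<inter> pts N"
    by (rule field_extend[OF P(1)]) (use p in auto)
  have o: "open_in M (C \<inter> W)" using field_extendsD(3)[OF C(1)] M.vector_field_open[OF V] by (rule M.open_in_Int)
  note ext = field_extends_subset[OF C(1) o Int_lower1]
  have "normal q (V q - V' q)" if "q \<in> C \<inter> W" "q \<in> pts N" for q
    using P(2)[of q] field_extendsD(4)[OF ext that] that by simp
  then have "field_splits (C \<inter> W) V V' (proj_field M N g V)"
    unfolding field_splits_def using ext M.vector_field_subset[OF V o Int_lower2] by simp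
  then show ?thesis by (rule that) (use C p in auto)
qed

lemma field_splits_at:
  "field_splits W V V' V\<^sub>N \<Longrightarrow> p \<in> W \<Longrightarrow> p \<in> pts N \<Longrightarrow> V' p = incl M p (V\<^sub>N p)"
  using field_extendsD(4)[OF field_splitsD(2)] .

lemma split_extend:
  assumes V: "vector_field M (pts M) V" and A: "open_in N A" "p \<in> A" and Ys: "\<forall>Y\<in>set Ys. vector_field N A Y"
  obtains W F V' where "p \<in> W" "field_splits W V V' (proj_field M N g V)"
    "\<And>Y. Y \<in> set Ys \<Longrightarrow> field_extends M N W (F Y) Y"
proof -
  have p: "p \<in> pts M" "p \<in> pts N" using A N.open_in_subset pts_subset by auto
  obtain W F where W: "open_in M W" "p \<in> W" "\<forall>Y\<in>set Ys. field_extends M N W (F Y) Y"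
    using field_extend_list[OF A(2,1) Ys] by blast
  obtain B V' where B: "field_splits B V V' (proj_field M N g V)" "p \<in> B" "B \<subseteq> pts M"
    by (rule field_splits_exists[OF V p])
  have o: "open_in M (B \<inter> W)"
    using M.vector_field_open[OF field_splitsD(1)[OF B(1)]] W(1) by (rule M.open_in_Int)
  show ?thesis
    by (rule that[OF _ field_splits_subset[OF B(1) o Int_lower1]])
       (use W B(2) field_extends_subset[OF _ o Int_lower2] in auto)
qed

lemma DM_split:
  assumes V: "field_splits W V V' V\<^sub>N" and Y: "field_extends M N W Y' Y" and p: "p \<in> W" "p \<in> pts N"
  shows "DM Y' V p = DM Y' V' p + DM Y' (\<lambda>q. V q - V' q) p"
  using M.D_diff_right[OF field_extendsD(1)[OF Y] field_splitsD(1)[OF V] field_extendsD(1)[OF field_splitsD(2)[OF V]] p(1)]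
  by simp

text \<open>
  By Weingarten's equation, a normal part of \<open>V\<close> to which the second fundamental form is orthogonal
  does not contribute to the tangential part of the derivative of \<open>V\<close>.
\<close>

lemma DM_split_tangent:
  assumes V: "field_splits W V V' V\<^sub>N" and o: "sff_orthogonal p (V p - V' p)"
    and Y: "field_extends M N W Y' Y" and p: "p \<in> W" "p \<in> pts N" and v: "v \<in> tangent_space N p"
  shows "g p (DM Y' (\<lambda>q. V q - V' q) p) (incl M p v) = 0"
    and "g p (DM Y' V p) (incl M p v) = gN p (DN Y V\<^sub>N p) v"
proof -
  note V' = field_splitsD(2)[OF V] and \<nu> = field_splitsD(3)[OF V] field_splitsD(4)[OF V]
  obtain Z' Z B where Z: "field_extends M N B Z' Z" "p \<in> B" "B \<subseteq> W" "Z p = v"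
    by (rule tangent_extend_at[OF v field_extendsD(3)[OF Y] p(1)])
  note oB = field_extendsD(3)[OF Z(1)]
  note YB = field_extends_subset[OF Y oB Z(3)]
  have "g p (DM Y' (\<lambda>q. V q - V' q) p) (Z' p) = - g p (V p - V' p) (DM Y' Z' p)"
    by (rule weingarten[OF M.vector_field_subset[OF \<nu>(1) oB Z(3)] \<nu>(2) YB Z(1,2) p(2)]) (use Z(3) in auto)
  also have "\<dots> = 0" using sff_orthogonalD[OF o YB Z(1,2)] by simp
  finally show 0: "g p (DM Y' (\<lambda>q. V q - V' q) p) (incl M p v) = 0"
    using field_extendsD(4)[OF Z(1,2) p(2)] Z(4) by simp
  have "g p (DM Y' V p) (incl M p v) = g p (DM Y' V' p) (incl M p v) + g p (DM Y' (\<lambda>q. V q - V' q) p) (incl M p v)"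
    unfolding DM_split[OF V Y p]
    by (intro M.g_plus_left M.D_in[OF field_extendsD(1)[OF Y] _ p(1)] field_extendsD(1)[OF V'] \<nu>(1) incl_in[OF v])
  then show "g p (DM Y' V p) (incl M p v) = gN p (DN Y V\<^sub>N p) v"
    using 0 g_DM_tangent[OF Y V' p v] by simp
qed

end

locale levi_civita_hypersurface = levi_civita_submanifold M N g DM DN + metric_hypersurface M N g
  for M N :: "('m::t2_space, 'k::{real_normed_field, euclidean_space}, 'n::finite) manifold" and g DM DN
begin

text \<open>As the normal space is a line, one nonzero normal vector at each point tests the whole second fundamental form.\<close>

lemma sff_orthogonal_agree:
  assumes "\<And>p. p \<in> pts N \<Longrightarrow> \<exists>n. normal p n \<and> n \<noteq> 0 \<and> sff_orthogonal p n"
  shows "connections_agree M N DM DN"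
  unfolding connections_agree_def
proof (intro allI impI ballI)
  fix W Y Z Y' Z' p
  assume *: "vector_field M W Y' \<and> vector_field M W Z' \<and>
        vector_field N (W \<inter> pts N) Y \<and> vector_field N (W \<inter> pts N) Z \<and>
        (\<forall>p\<in>W \<inter> pts N. Y' p = incl M p (Y p) \<and> Z' p = incl M p (Z p))"
    and pW: "p \<in> W \<inter> pts N"
  then have Y: "field_extends M N W Y' Y" and Z: "field_extends M N W Z' Z" and p: "p \<in> W" "p \<in> pts N"
    by (auto simp: field_extends_def)
  obtain n where n: "normal p n" "n \<noteq> 0" "sff_orthogonal p n" using assms p(2) by blast
  note DMin = M.D_in[OF field_extendsD(1)[OF Y] field_extendsD(1)[OF Z] p(1)]
    and DNin = N.D_in[OF field_extendsD(2)[OF Y] field_extendsD(2)[OF Z] pW]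
  have "DM Y' Z' p \<in> sub_tangent_space M N p"
    by (rule normal_spans(3)[OF p(2) n(1,2) DMin sff_orthogonalD[OF n(3) Y Z p(1)]])
  then obtain v where v: "v \<in> tangent_space N p" "DM Y' Z' p = incl M p v" by (rule sub_tangent_spaceE)
  have "normal p (incl M p (v - DN Y Z p))"
    using DM_tangential_part[OF Y Z p] v(2) by (simp add: incl_diff)
  then have "v - DN Y Z p = 0"
    by (rule normal_tangent[OF _ N.tangent_space_diff[OF v(1) DNin]])
  then show "DM Y' Z' p = incl M p (DN Y Z p)" using v(2) by simp
qed

end

section \<open>Frobenius manifolds\<close>

text \<open>
  The Levi-Civita connection being unique, the axioms of a Frobenius manifold hold for any given
  one.
\<close>

context levi_civita_manifold
begin

lemma frobenius_axioms:
  assumes F: "frobenius_manifold X g m e E"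
  shows "frobenius_algebra_manifold X g D m"
    and "vector_field X (pts X) e" "vector_field X (pts X) E"
    and "\<And>p u. u \<in> tangent_space X p \<Longrightarrow> m p (e p) u = u"
    and "\<And>A Y p. vector_field X A Y \<Longrightarrow> p \<in> A \<Longrightarrow> D Y e p = 0"
    and "\<And>A U V W Z p. vector_field X A U \<Longrightarrow> vector_field X A V \<Longrightarrow> vector_field X A W \<Longrightarrow>
      vector_field X A Z \<Longrightarrow> p \<in> A \<Longrightarrow> nabla_c g m D Z U V W p = nabla_c g m D U Z V W p"
    and "\<And>A U V W Z p. vector_field X A U \<Longrightarrow> vector_field X A V \<Longrightarrow> vector_field X A W \<Longrightarrow>
      vector_field X A Z \<Longrightarrow> p \<in> A \<Longrightarrow> nabla_c g m D Z U V W p = nabla_c g m D Z V U W p"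
    and "\<And>A U V W Z p. vector_field X A U \<Longrightarrow> vector_field X A V \<Longrightarrow> vector_field X A W \<Longrightarrow>
      vector_field X A Z \<Longrightarrow> p \<in> A \<Longrightarrow> nabla_c g m D Z U V W p = nabla_c g m D Z U W V p"
    and "\<And>A Y Z p. vector_field X A Y \<Longrightarrow> vector_field X A Z \<Longrightarrow> p \<in> A \<Longrightarrow> D Y (D Z E) p = D (D Y Z) E p"
    and "\<And>A Y Z p. vector_field X A Y \<Longrightarrow> vector_field X A Z \<Longrightarrow> p \<in> A \<Longrightarrow>
      lie_bracket X E (\<lambda>q. m q (Y q) (Z q)) p - m p (lie_bracket X E Y p) (Z p)
      - m p (Y p) (lie_bracket X E Z p) = m p (Y p) (Z p)"
    and "\<exists>d. \<forall>A Y Z p. vector_field X A Y \<longrightarrow> vector_field X A Z \<longrightarrow> p \<in> A \<longrightarrow>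
      g p (D Y E p) (Z p) + g p (Y p) (D Z E p) = d * g p (Y p) (Z p)"
proof -
  note F' = F[unfolded frobenius_manifold_def]
  have mm: "is_multiplication X m" and e: "vector_field X (pts X) e" and E: "vector_field X (pts X) E"
    using F' by blast+
  have unit: "\<forall>p\<in>pts X. \<forall>u\<in>tangent_space X p. m p (e p) u = u"
    using F' by (elim conjE)
  obtain D' where D': "is_levi_civita X g D'"
    and compat: "\<forall>p\<in>pts X. \<forall>u\<in>tangent_space X p. \<forall>v\<in>tangent_space X p. \<forall>w\<in>tangent_space X p.
           g p (m p u v) w = g p u (m p v w)"
    and par: "\<forall>A Y. vector_field X A Y \<longrightarrow> (\<forall>p\<in>A. D' Y e p = 0)"
    and pot: "\<forall>A U V W Z. vector_field X A U \<and> vector_field X A V \<and>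
             vector_field X A W \<and> vector_field X A Z \<longrightarrow>
           (\<forall>p\<in>A. nabla_c g m D' Z U V W p = nabla_c g m D' U Z V W p \<and>
                  nabla_c g m D' Z U V W p = nabla_c g m D' Z V U W p \<and>
                  nabla_c g m D' Z U V W p = nabla_c g m D' Z U W V p)"
    and aff: "\<forall>A Y Z. vector_field X A Y \<and> vector_field X A Z \<longrightarrow>
           (\<forall>p\<in>A. D' Y (D' Z E) p - D' (D' Y Z) E p = 0)"
    and liem: "\<forall>A Y Z. vector_field X A Y \<and> vector_field X A Z \<longrightarrow>
           (\<forall>p\<in>A. lie_bracket X E (\<lambda>q. m q (Y q) (Z q)) p
                   - m p (lie_bracket X E Y p) (Z p) - m p (Y p) (lie_bracket X E Z p)
                 = m p (Y p) (Z p))"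
    and lieg: "\<exists>d. \<forall>A Y Z. vector_field X A Y \<and> vector_field X A Z \<longrightarrow>
           (\<forall>p\<in>A. E p (\<lambda>q. g q (Y q) (Z q))
                   - g p (lie_bracket X E Y p) (Z p) - g p (Y p) (lie_bracket X E Z p)
                 = d * g p (Y p) (Z p))"
    using F'[THEN conjunct2, THEN conjunct2, THEN conjunct2, THEN conjunct2, THEN conjunct2, THEN conjunct2]
    by (rule exE) ((erule conjE)+, rule that; assumption)
  interpret D': levi_civita_manifold X g D' by unfold_locales (rule D')
  have DD: "D' Y Z p = D Y Z p" if "vector_field X A Y" "vector_field X A Z" "p \<in> A" for A Y Z p
    using levi_civita_unique[OF D'.levi_civita_manifold_axioms levi_civita_manifold_axioms that] .
  have eA: "vector_field X A e" and EA: "vector_field X A E" if "open_in X A" for A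
    using vector_field_subset[OF e that open_in_subset[OF that]] vector_field_subset[OF E that open_in_subset[OF that]] by auto
  have nab: "nabla_c g m D' Z U V W p = nabla_c g m D Z U V W p"
    if "vector_field X A U" "vector_field X A V" "vector_field X A W" "vector_field X A Z" "p \<in> A" for A U V W Z p
    unfolding nabla_c_def using DD[OF that(4,1,5)] DD[OF that(4,2,5)] DD[OF that(4,3,5)] by simp
  show "frobenius_algebra_manifold X g D m" by unfold_locales (rule mm, rule compat)
  show "vector_field X (pts X) e" "vector_field X (pts X) E" by (fact e, fact E)
  show "m p (e p) u = u" if "u \<in> tangent_space X p" for p u using unit tangent_space_pts[OF that] that by blast
  show "D Y e p = 0" if "vector_field X A Y" "p \<in> A" for A Y p
    using DD[OF that(1) eA[OF vector_field_open[OF that(1)]] that(2)] par that by simp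
  show "nabla_c g m D Z U V W p = nabla_c g m D U Z V W p"
    "nabla_c g m D Z U V W p = nabla_c g m D Z V U W p"
    "nabla_c g m D Z U V W p = nabla_c g m D Z U W V p"
    if f: "vector_field X A U" "vector_field X A V" "vector_field X A W" "vector_field X A Z" "p \<in> A" for A U V W Z p
  proof -
    have *: "nabla_c g m D' Z U V W p = nabla_c g m D' U Z V W p \<and>
                  nabla_c g m D' Z U V W p = nabla_c g m D' Z V U W p \<and>
                  nabla_c g m D' Z U V W p = nabla_c g m D' Z U W V p"
      using pot f by blast
    show "nabla_c g m D Z U V W p = nabla_c g m D U Z V W p"
      using * nab[OF f] nab[OF f(4,2,3,1,5)] by metis
    show "nabla_c g m D Z U V W p = nabla_c g m D Z V U W p"
      using * nab[OF f] nab[OF f(2,1,3,4,5)] by metis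
    show "nabla_c g m D Z U V W p = nabla_c g m D Z U W V p"
      using * nab[OF f] nab[OF f(1,3,2,4,5)] by metis
  qed
  show "D Y (D Z E) p = D (D Y Z) E p" if f: "vector_field X A Y" "vector_field X A Z" "p \<in> A" for A Y Z p
  proof -
    note EE = EA[OF vector_field_open[OF f(1)]]
    have "D' Y (D' Z E) p - D' (D' Y Z) E p = 0" using aff f by blast
    moreover have "D' Y (D' Z E) p = D' Y (D Z E) p"
      by (rule D'.D_cong[OF f(1) D_field[OF f(2) EE] refl DD[OF f(2) EE] f(3)])
    moreover have "D' (D' Y Z) E p = D' (D Y Z) E p"
      by (rule D'.D_cong[OF D_field[OF f(1,2)] EE DD[OF f(1,2)] refl f(3)])
    ultimately show ?thesis
      using DD[OF f(1) D_field[OF f(2) EE] f(3)] DD[OF D_field[OF f(1,2)] EE f(3)] by simp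
  qed
  show "lie_bracket X E (\<lambda>q. m q (Y q) (Z q)) p - m p (lie_bracket X E Y p) (Z p)
      - m p (Y p) (lie_bracket X E Z p) = m p (Y p) (Z p)"
    if "vector_field X A Y" "vector_field X A Z" "p \<in> A" for A Y Z p
    using liem that by blast
  obtain d where d: "\<forall>A Y Z. vector_field X A Y \<and> vector_field X A Z \<longrightarrow>
           (\<forall>p\<in>A. E p (\<lambda>q. g q (Y q) (Z q))
                   - g p (lie_bracket X E Y p) (Z p) - g p (Y p) (lie_bracket X E Z p)
                 = d * g p (Y p) (Z p))" using lieg by blast
  have "g p (D Y E p) (Z p) + g p (Y p) (D Z E p) = d * g p (Y p) (Z p)"
    if f: "vector_field X A Y" "vector_field X A Z" "p \<in> A" for A Y Z p
    unfolding lie_derivative_metric[OF EA[OF vector_field_open[OF f(1)]] f, symmetric] using d f by blast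
  then show "\<exists>d. \<forall>A Y Z p. vector_field X A Y \<longrightarrow> vector_field X A Z \<longrightarrow> p \<in> A \<longrightarrow>
      g p (D Y E p) (Z p) + g p (Y p) (D Z E p) = d * g p (Y p) (Z p)" by blast
qed

end

section \<open>Hypersurfaces whose tangent spaces are subalgebras\<close>

locale frobenius_hypersurface = levi_civita_hypersurface M N g DM DN
  for M N :: "('m::t2_space, 'k::{real_normed_field, euclidean_space}, 'n::finite) manifold" and g DM DN +
  fixes m :: "('m, 'k) product_field" and e E :: "('m, 'k) vfield"
  assumes frobenius: "frobenius_manifold M g m e E"
    and flat_N: "is_flat N DN"
    and connected_N: "connected (pts N)"
    and product_invariant: "product_invariant M N m"
begin

sublocale M: frobenius_algebra_manifold M g DM m
  by (rule M.frobenius_axioms(1)[OF frobenius])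

lemmas e_field = M.frobenius_axioms(2)[OF frobenius]
  and E_field = M.frobenius_axioms(3)[OF frobenius]
  and unit = M.frobenius_axioms(4)[OF frobenius]
  and e_parallel = M.frobenius_axioms(5)[OF frobenius]
  and potential = M.frobenius_axioms(6,7,8)[OF frobenius]
  and E_affine = M.frobenius_axioms(9)[OF frobenius]
  and E_product = M.frobenius_axioms(10)[OF frobenius]
  and E_homothetic = M.frobenius_axioms(11)[OF frobenius]

abbreviation "mN \<equiv> proj_product M N g m"
abbreviation "eN \<equiv> proj_field M N g e"
abbreviation "EN \<equiv> proj_field M N g E"

lemma proj_product:
  assumes "u \<in> tangent_space N p" "v \<in> tangent_space N p"
  shows "mN p u v \<in> tangent_space N p" "m p (incl M p u) (incl M p v) = incl M p (mN p u v)"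
proof -
  have "m p (incl M p u) (incl M p v) \<in> sub_tangent_space M N p"
    using product_invariant assms N.tangent_space_pts[OF assms(1)] sub_tangent_spaceI
    unfolding product_invariant_def by blast
  then obtain w where w: "w \<in> tangent_space N p" "m p (incl M p u) (incl M p v) = incl M p w"
    by (rule sub_tangent_spaceE)
  then have "mN p u v = w" unfolding proj_product_def by (simp add: pr_incl)
  then show "mN p u v \<in> tangent_space N p" "m p (incl M p u) (incl M p v) = incl M p (mN p u v)" using w by auto
qed

lemma product_extends:
  assumes Y: "field_extends M N W Y' Y" and Z: "field_extends M N W Z' Z"
  shows "field_extends M N W (\<lambda>q. m q (Y' q) (Z' q)) (\<lambda>q. mN q (Y q) (Z q))"
  by (rule field_restrict[OF M.m_field[OF field_extendsD(1)[OF Y] field_extendsD(1)[OF Z]]])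
     (use field_extendsD(4,5)[OF Y] field_extendsD(4,5)[OF Z] proj_product in auto)

lemma submanifold_multiplication: "is_multiplication N mN"
proof -
  have 2: "mN p u v = mN p v u" if "u \<in> tangent_space N p" "v \<in> tangent_space N p" for p u v
    unfolding proj_product_def using M.m_comm[OF incl_in[OF that(1)] incl_in[OF that(2)]] by simp
  have 3: "mN p (u + u') v = mN p u v + mN p u' v"
    if "u \<in> tangent_space N p" "u' \<in> tangent_space N p" "v \<in> tangent_space N p" for p u u' v
  proof (rule incl_inj)
    show "incl M p (mN p (u + u') v) = incl M p (mN p u v + mN p u' v)"
      using that proj_product(2)[symmetric] M.m_plus_left[OF incl_in incl_in incl_in]
      by (simp add: incl_plus N.tangent_space_plus)
  qed (use that proj_product(1) N.tangent_space_plus in auto)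
  have 4: "mN p (a \<bullet>\<^sub>v u) v = a \<bullet>\<^sub>v mN p u v"
    if "u \<in> tangent_space N p" "v \<in> tangent_space N p" for p u v a
  proof (rule incl_inj)
    show "incl M p (mN p (a \<bullet>\<^sub>v u) v) = incl M p (a \<bullet>\<^sub>v mN p u v)"
      using that proj_product(2)[symmetric] M.m_smul_left[OF incl_in incl_in]
      by (simp add: incl_smul N.tangent_space_smul)
  qed (use that proj_product(1) N.tangent_space_smul in auto)
  have 5: "mN p (mN p u v) w = mN p u (mN p v w)"
    if "u \<in> tangent_space N p" "v \<in> tangent_space N p" "w \<in> tangent_space N p" for p u v w
  proof (rule incl_inj)
    show "incl M p (mN p (mN p u v) w) = incl M p (mN p u (mN p v w))"
      using M.m_assoc[OF incl_in[OF that(1)] incl_in[OF that(2)] incl_in[OF that(3)]]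
      by (simp add: that proj_product)
  qed (use that proj_product(1) in auto)
  have 6: "vector_field N A (\<lambda>p. mN p (Y p) (Z p))" if f: "vector_field N A Y" "vector_field N A Z" for A Y Z
  proof (rule N.vector_field_local[OF N.vector_field_open[OF f(1)]])
    fix p assume p: "p \<in> A"
    obtain W F where W: "open_in M W" "p \<in> W" "\<forall>Y\<in>set [Y, Z]. field_extends M N W (F Y) Y"
      using field_extend_list[OF p N.vector_field_open[OF f(1)], of "[Y, Z]"] f by auto
    have "vector_field N (W \<inter> pts N) (\<lambda>p. mN p (Y p) (Z p))"
      by (rule field_extendsD(2)[OF product_extends]) (use W in auto)
    then show "\<exists>W'. p \<in> W' \<and> vector_field N W' (\<lambda>p. mN p (Y p) (Z p))"
      using W(2) p N.open_in_subset[OF N.vector_field_open[OF f(1)]] by (intro exI[of _ "W \<inter> pts N"]) auto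
  qed
  show ?thesis
    unfolding is_multiplication_def
    by (intro conjI ballI allI impI; rule proj_product(1) 2 3 4 5 6; (assumption | erule conjunct1 | erule conjunct2))
qed

lemma submanifold_invariant:
  assumes "u \<in> tangent_space N p" "v \<in> tangent_space N p" "w \<in> tangent_space N p"
  shows "gN p (mN p u v) w = gN p u (mN p v w)"
  using M.m_invariant[OF incl_in[OF assms(1)] incl_in[OF assms(2)] incl_in[OF assms(3)]]
  by (simp add: restrict_metric_def proj_product(2) assms)

sublocale N: frobenius_algebra_manifold N "restrict_metric M g" DN mN
  by unfold_locales (rule submanifold_multiplication, intro ballI submanifold_invariant)

text \<open>Multiplication by a tangent vector is self-adjoint and preserves \<open>TN\<close>, hence also its orthogonal complement.\<close>

lemma normal_product:
  assumes n: "normal p n" and v: "v \<in> tangent_space N p"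
  shows "normal p (m p n (incl M p v))"
  unfolding normal_def
proof (intro conjI ballI)
  show "m p n (incl M p v) \<in> tangent_space M p" by (rule M.m_in[OF normal_in[OF n] incl_in[OF v]])
  fix w assume w: "w \<in> tangent_space N p"
  show "g p (m p n (incl M p v)) (incl M p w) = 0"
    using M.m_invariant[OF normal_in[OF n] incl_in[OF v] incl_in[OF w]] normalD[OF n] proj_product[OF v w] by simp
qed

lemma eN_in: "p \<in> pts N \<Longrightarrow> eN p \<in> tangent_space N p"
  and e_normal: "p \<in> pts N \<Longrightarrow> normal p (e p - incl M p (eN p))"
  using proj_field_smooth[OF e_field] N.vector_field_in pts_subset by blast+

lemma EN_in: "p \<in> pts N \<Longrightarrow> EN p \<in> tangent_space N p"
  and E_normal: "p \<in> pts N \<Longrightarrow> normal p (E p - incl M p (EN p))"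
  using proj_field_smooth[OF E_field] N.vector_field_in pts_subset by blast+

lemma eN_field: "vector_field N (pts N) eN" and EN_field: "vector_field N (pts N) EN"
  using proj_field_smooth(1)[OF e_field] proj_field_smooth(1)[OF E_field] pts_subset by (simp_all add: Int_absorb1)

text \<open>
  The components of the equation \<open>e \<circ> u = u\<close> for \<open>u\<close> tangent to the hypersurface: the tangential
  part of the unit is the unit of the subalgebra, and the normal part annihilates it.
\<close>

lemma unit_parts:
  assumes u: "u \<in> tangent_space N p"
  shows "mN p (eN p) u = u" "m p (e p - incl M p (eN p)) (incl M p u) = 0"
proof -
  have p: "p \<in> pts N" using u by (rule N.tangent_space_pts)
  note e0 = eN_in[OF p] and n = e_normal[OF p]
  let ?n = "e p - incl M p (eN p)"
  have ep: "e p \<in> tangent_space M p" using M.vector_field_in[OF e_field] p pts_subset by auto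
  have eq: "m p ?n (incl M p u) = incl M p (u - mN p (eN p) u)"
    using M.m_diff_left[OF ep incl_in[OF e0] incl_in[OF u]] unit[OF incl_in[OF u]] proj_product(2)[OF e0 u]
    by (simp add: incl_diff)
  have "u - mN p (eN p) u = 0"
    by (rule normal_tangent[OF normal_product[OF n u, unfolded eq] N.tangent_space_diff[OF u proj_product(1)[OF e0 u]]])
  then show "mN p (eN p) u = u" "m p ?n (incl M p u) = 0"
    using eq by (simp_all add: incl_zero)
qed

text \<open>
  Since products of tangent vectors are tangent, only the tangential parts of the covariant derivatives
  contribute.
\<close>

lemma nabla_c_incl:
  assumes Z: "field_extends M N B Z' Z" and U: "field_extends M N B U' U" and V: "field_extends M N B V' V"
    and W: "field_extends M N B W' W" and p: "p \<in> B" "p \<in> pts N"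
  shows "nabla_c g m DM Z' U' V' W' p = nabla_c gN mN DN Z U V W p"
proof -
  have pB: "p \<in> B \<inter> pts N" using p by auto
  note UV = product_extends[OF U V]
  note at = field_extendsD(4)[OF Z p] field_extendsD(4)[OF U p] field_extendsD(4)[OF V p] field_extendsD(4)[OF W p]
  note tg = field_extendsD(5)[OF Z p] field_extendsD(5)[OF U p] field_extendsD(5)[OF V p] field_extendsD(5)[OF W p]
  note DM_in = M.D_in[OF field_extendsD(1)[OF Z] _ p(1)] and DN_in = N.D_in[OF field_extendsD(2)[OF Z] _ pB]
  have 1: "Z' p (\<lambda>q. g q (m q (U' q) (V' q)) (W' q)) = Z p (\<lambda>q. gN q (mN q (U q) (V q)) (W q))"
    unfolding at(1)
    by (rule incl_apply_cong[OF tg(1) field_extendsD(3)[OF Z] p(1) M.g_smooth[OF field_extendsD(1)[OF UV] field_extendsD(1)[OF W]]])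
       (use field_extendsD(4)[OF UV] field_extendsD(4)[OF W] in \<open>auto simp: restrict_metric_def\<close>)
  have c: "g p (m p (DM Z' U' p) (incl M p v)) (incl M p w) = gN p (mN p (DN Z U p) v) w"
    if U: "field_extends M N B U' U" and v: "v \<in> tangent_space N p" and w: "w \<in> tangent_space N p" for U U' v w
  proof -
    have "g p (m p (DM Z' U' p) (incl M p v)) (incl M p w) = g p (DM Z' U' p) (incl M p (mN p v w))"
      using M.m_invariant[OF DM_in[OF field_extendsD(1)[OF U]] incl_in[OF v] incl_in[OF w]] proj_product(2)[OF v w] by simp
    also have "\<dots> = gN p (DN Z U p) (mN p v w)"
      by (rule g_DM_tangent[OF Z U p proj_product(1)[OF v w]])
    also have "\<dots> = gN p (mN p (DN Z U p) v) w"
      using N.m_invariant[OF DN_in[OF field_extendsD(2)[OF U]] v w] by simp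
    finally show ?thesis .
  qed
  have 3: "g p (m p (U' p) (DM Z' V' p)) (W' p) = gN p (mN p (U p) (DN Z V p)) (W p)"
    unfolding at using c[OF V tg(2,4)]
      M.m_comm[OF incl_in[OF tg(2)] DM_in[OF field_extendsD(1)[OF V]]] N.m_comm[OF tg(2) DN_in[OF field_extendsD(2)[OF V]]]
    by simp
  have 4: "g p (m p (U' p) (V' p)) (DM Z' W' p) = gN p (mN p (U p) (V p)) (DN Z W p)"
  proof -
    note uv = proj_product[OF tg(2,3)]
    have "g p (m p (U' p) (V' p)) (DM Z' W' p) = g p (DM Z' W' p) (incl M p (mN p (U p) (V p)))"
      unfolding at uv(2) by (rule M.g_sym[OF incl_in[OF uv(1)] DM_in[OF field_extendsD(1)[OF W]]])
    also have "\<dots> = gN p (DN Z W p) (mN p (U p) (V p))" by (rule g_DM_tangent[OF Z W p uv(1)])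
    also have "\<dots> = gN p (mN p (U p) (V p)) (DN Z W p)" by (rule N.g_sym[OF DN_in[OF field_extendsD(2)[OF W]] uv(1)])
    finally show ?thesis .
  qed
  show ?thesis
    unfolding nabla_c_def ctensor_def using 1 c[OF U tg(3,4)] 3 4 by (simp add: at)
qed

text \<open>
  Because \<open>TN\<close> is a subalgebra, \<open>c\<close> vanishes on one normal and two tangent arguments.  What the
  product rule leaves are terms with \<open>\<nabla>\<nu>\<close>, paired with a tangent vector, and terms with the product
  of \<open>\<nu>\<close> and a tangent vector, paired with the derivative of a tangent field.  Both kinds are values
  of the second fundamental form paired with a multiple of \<open>\<nu>\<close>.
\<close>

lemma nabla_c_normal:
  assumes E: "field_splits W V V' V\<^sub>N" and o: "sff_orthogonal p (V p - V' p)"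
    and Y: "field_extends M N W Y' Y" and Z: "field_extends M N W Z' Z" and T: "field_extends M N W T' T"
    and p: "p \<in> W" "p \<in> pts N"
  shows "nabla_c g m DM Y' (\<lambda>q. V q - V' q) Z' T' p = 0"
proof -
  let ?\<nu> = "\<lambda>q. V q - V' q"
  note \<nu> = field_splitsD(3,4)[OF E]
  note ZT = product_extends[OF Z T]
  note YM = field_extendsD(1)[OF Y] and ZM = field_extendsD(1)[OF Z] and TM = field_extendsD(1)[OF T]
  note DY = M.D_in[OF YM _ p(1)]
  note n = \<nu>(2)[OF p]
  note tgM = field_extendsD(6)[OF Z p(1)] field_extendsD(6)[OF T p(1)] normal_in[OF n]
  have inv: "g q (m q (?\<nu> q) (Z' q)) (T' q) = g q (?\<nu> q) (m q (Z' q) (T' q))" if "q \<in> W" for q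
    using M.m_invariant[OF M.vector_field_in[OF \<nu>(1) that] field_extendsD(6)[OF Z that] field_extendsD(6)[OF T that]] .
  have "incl M p (Y p) (\<lambda>q. g q (m q (?\<nu> q) (Z' q)) (T' q)) = Y p (\<lambda>q. 0)"
  proof (rule incl_apply_cong[OF field_extendsD(5)[OF Y p] field_extendsD(3)[OF Y] p(1)])
    show "smooth_fun M W (\<lambda>q. g q (m q (?\<nu> q) (Z' q)) (T' q))"
      by (intro M.g_smooth M.m_field \<nu>(1) ZM TM)
    show "g q (m q (?\<nu> q) (Z' q)) (T' q) = 0" if "q \<in> W \<inter> pts N" for q
      using inv[of q] normalD[OF \<nu>(2)] field_extendsD(4,5)[OF ZT] that by auto
  qed
  then have 1: "Y' p (\<lambda>q. g q (m q (?\<nu> q) (Z' q)) (T' q)) = 0"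
    using N.tangent_const[OF field_extendsD(5)[OF Y p]] field_extendsD(4)[OF Y p] by simp
  have 2: "g p (m p (DM Y' ?\<nu> p) (Z' p)) (T' p) = 0"
    using M.m_invariant[OF DY[OF \<nu>(1)] tgM(1,2)] field_extendsD(4)[OF ZT p]
      DM_split_tangent(1)[OF E o Y p field_extendsD(5)[OF ZT p]] by simp
  \<comment> \<open>Normal vectors being proportional, the product of \<open>\<nu>\<close> with a tangent vector is a multiple of \<open>\<nu>\<close>.\<close>
  have line: "g p (m p (?\<nu> p) (A' p)) (DM Y' B' p) = 0"
    if A: "field_extends M N W A' A" and B: "field_extends M N W B' B" for A A' B B'
  proof (cases "?\<nu> p = 0")
    case True
    show ?thesis
      unfolding True M.m_zero_left[OF field_extendsD(6)[OF A p(1)]] using M.g_zero_left[OF DY[OF field_extendsD(1)[OF B]]] by simp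
  next
    case False
    have "normal p (m p (?\<nu> p) (A' p))"
      using normal_product[OF n field_extendsD(5)[OF A p]] field_extendsD(4)[OF A p] by simp
    then obtain c where "m p (?\<nu> p) (A' p) = c \<bullet>\<^sub>v ?\<nu> p" using normal_spans(2)[OF p(2) n False] by blast
    then show ?thesis using sff_orthogonalD[OF sff_orthogonal_smul[OF o normal_in[OF n], of c] Y B p(1)] by simp
  qed
  have 3: "g p (m p (?\<nu> p) (DM Y' Z' p)) (T' p) = 0"
  proof -
    note DZ = DY[OF ZM]
    have "g p (m p (?\<nu> p) (DM Y' Z' p)) (T' p) = g p (m p (?\<nu> p) (T' p)) (DM Y' Z' p)"
      using M.m_invariant[OF tgM(3) DZ tgM(2)] M.m_invariant[OF tgM(3,2) DZ] M.m_comm[OF DZ tgM(2)] by simp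
    then show ?thesis using line[OF T Z] by simp
  qed
  show ?thesis
    unfolding nabla_c_def ctensor_def using 1 2 3 line[OF Z T] by simp
qed

text \<open>
  Sufficiency.  Once the normal parts of \<open>e\<close> and \<open>\<E>\<close> are orthogonal to the second fundamental form,
  every axiom is the tangential part of the corresponding axiom of the ambient manifold; only
  \<open>\<nabla>(\<nabla>\<E>\<^sub>N) = 0\<close> comes from the flatness of the hypersurface instead.  In the Lie derivative of the
  product, the derivative in the direction of the normal part of \<open>\<E>\<close> is turned by the symmetry of
  \<open>\<nabla>c\<close> into a derivative in a tangential direction.
\<close>

lemma frobenius_if_sff_orthogonal:
  assumes oe: "\<And>p. p \<in> pts N \<Longrightarrow> sff_orthogonal p (e p - incl M p (eN p))"
    and oE: "\<And>p. p \<in> pts N \<Longrightarrow> sff_orthogonal p (E p - incl M p (EN p))"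
  shows "frobenius_manifold N gN mN eN EN"
proof -
  have AN: "p \<in> pts N" if "vector_field N A Y" "p \<in> A" for A Y p
    using that N.open_in_subset[OF N.vector_field_open[OF that(1)]] by auto
  have sub: "vector_field N A eN" "vector_field N A EN" if "vector_field N A Y" for A Y
    using N.vector_field_subset[OF eN_field] N.vector_field_subset[OF EN_field] N.vector_field_open[OF that]
      N.open_in_subset by auto
  have par: "DN Y eN p = 0" if Y: "vector_field N A Y" and p: "p \<in> A" for A Y p
  proof (rule N.g_nondegenerate[OF N.D_in[OF Y sub(1)[OF Y] p]])
    fix v assume v: "v \<in> tangent_space N p"
    obtain W F e' where W: "p \<in> W" "field_splits W e e' eN" "\<And>Z. Z \<in> set [Y] \<Longrightarrow> field_extends M N W (F Z) Z"
      by (rule split_extend[OF e_field N.vector_field_open[OF Y] p, of "[Y]"]) (use Y in auto)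
    note pN = AN[OF Y p]
    have FY: "field_extends M N W (F Y) Y" using W(3) by simp
    have "sff_orthogonal p (e p - e' p)" using oe[OF pN] field_splits_at[OF W(2,1) pN] by simp
    from DM_split_tangent(2)[OF W(2) this FY W(1) pN v]
    have "gN p (DN Y eN p) v = g p (DM (F Y) e p) (incl M p v)" by simp
    then show "gN p (DN Y eN p) v = 0"
      using e_parallel[OF field_extendsD(1)[OF FY] W(1)] M.g_zero_left[OF incl_in[OF v]] by simp
  qed
  have pot: "nabla_c gN mN DN Z U V W p = nabla_c gN mN DN U Z V W p \<and>
      nabla_c gN mN DN Z U V W p = nabla_c gN mN DN Z V U W p \<and>
      nabla_c gN mN DN Z U V W p = nabla_c gN mN DN Z U W V p"
    if f: "vector_field N A U" "vector_field N A V" "vector_field N A W" "vector_field N A Z" and p: "p \<in> A"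
    for A U V W Z p
  proof -
    note pN = AN[OF f(1) p]
    obtain B F where B: "open_in M B" "p \<in> B" "\<forall>Y\<in>set [U, V, W, Z]. field_extends M N B (F Y) Y"
      using field_extend_list[OF p N.vector_field_open[OF f(1)], of "[U, V, W, Z]"] f by auto
    then have ext: "field_extends M N B (F U) U" "field_extends M N B (F V) V"
      "field_extends M N B (F W) W" "field_extends M N B (F Z) Z" by simp_all
    note vf = field_extendsD(1)[OF ext(1)] field_extendsD(1)[OF ext(2)] field_extendsD(1)[OF ext(3)] field_extendsD(1)[OF ext(4)]
    show ?thesis
      using potential(1)[OF vf B(2)] potential(2)[OF vf B(2)] potential(3)[OF vf B(2)]
      by (simp only: nabla_c_incl[OF ext(4,1,2,3) B(2) pN] nabla_c_incl[OF ext(1,4,2,3) B(2) pN]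
          nabla_c_incl[OF ext(4,2,1,3) B(2) pN] nabla_c_incl[OF ext(4,1,3,2) B(2) pN])
  qed
  obtain d where d: "\<And>A Y Z p. vector_field M A Y \<Longrightarrow> vector_field M A Z \<Longrightarrow> p \<in> A \<Longrightarrow>
      g p (DM Y E p) (Z p) + g p (Y p) (DM Z E p) = d * g p (Y p) (Z p)"
    using E_homothetic by blast
  have hom: "gN p (DN Y EN p) (Z p) + gN p (Y p) (DN Z EN p) = d * gN p (Y p) (Z p)"
    if f: "vector_field N A Y" "vector_field N A Z" and p: "p \<in> A" for A Y Z p
  proof -
    obtain W F E' where W: "p \<in> W" "field_splits W E E' EN" "\<And>Y'. Y' \<in> set [Y, Z] \<Longrightarrow> field_extends M N W (F Y') Y'"
      by (rule split_extend[OF E_field N.vector_field_open[OF f(1)] p, of "[Y, Z]"]) (use f in auto)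
    note pN = AN[OF f(1) p]
    have Y: "field_extends M N W (F Y) Y" and Z: "field_extends M N W (F Z) Z" using W(3) by simp_all
    have o: "sff_orthogonal p (E p - E' p)" using oE[OF pN] field_splits_at[OF W(2,1) pN] by simp
    note tg = field_extendsD(5)[OF Y W(1) pN] field_extendsD(5)[OF Z W(1) pN]
    note at = field_extendsD(4)[OF Y W(1) pN] field_extendsD(4)[OF Z W(1) pN]
    note EW = field_splitsD(1)[OF W(2)]
    have "g p (F Y p) (DM (F Z) E p) = g p (DM (F Z) E p) (F Y p)"
      by (rule M.g_sym[OF field_extendsD(6)[OF Y W(1)] M.D_in[OF field_extendsD(1)[OF Z] EW W(1)]])
    moreover have "gN p (Y p) (DN Z EN p) = gN p (DN Z EN p) (Y p)"
      by (rule N.g_sym[OF tg(1) N.D_in[OF f(2) sub(2)[OF f(2)] p]])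
    ultimately show ?thesis
      using d[OF field_extendsD(1)[OF Y] field_extendsD(1)[OF Z] W(1)]
        DM_split_tangent(2)[OF W(2) o Y W(1) pN tg(2)] DM_split_tangent(2)[OF W(2) o Z W(1) pN tg(1)]
      by (simp add: at restrict_metric_def)
  qed
  have aff: "DN Y (DN Z EN) p - DN (DN Y Z) EN p = 0"
    if f: "vector_field N A Y" "vector_field N A Z" and p: "p \<in> A" for A Y Z p
    by (rule N.homothetic_imp_affine[OF flat_N EN_field hom f p])
  have liem: "lie_bracket N EN (\<lambda>q. mN q (Y q) (Z q)) p - mN p (lie_bracket N EN Y p) (Z p)
      - mN p (Y p) (lie_bracket N EN Z p) = mN p (Y p) (Z p)"
    if f: "vector_field N A Y" "vector_field N A Z" and p: "p \<in> A" for A Y Z p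
  proof -
    note YZ = N.m_field[OF f] and EA = sub(2)[OF f(1)]
    have tg: "Y p \<in> tangent_space N p" "Z p \<in> tangent_space N p" using N.vector_field_in f p by auto
    have br: "lie_bracket N EN Q p \<in> tangent_space N p" if "vector_field N A Q" for Q
      unfolding N.torsion_free[OF EA that p] by (intro N.tangent_space_diff N.D_in[OF _ _ p] EA that)
    define L where "L = lie_bracket N EN (\<lambda>q. mN q (Y q) (Z q)) p - mN p (lie_bracket N EN Y p) (Z p)
      - mN p (Y p) (lie_bracket N EN Z p)"
    have Lin: "L \<in> tangent_space N p"
      unfolding L_def by (intro N.tangent_space_diff N.m_in br YZ f tg)
    have "L - mN p (Y p) (Z p) = 0"
    proof (rule N.g_nondegenerate[OF N.tangent_space_diff[OF Lin N.m_in[OF tg]]])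
      fix v assume v: "v \<in> tangent_space N p"
      obtain B0 V where B0: "vector_field N B0 V" "p \<in> B0" "V p = v" using v by (rule N.tangent_extend)
      let ?B = "A \<inter> B0"
      have oB: "open_in N ?B" using N.vector_field_open[OF f(1)] N.vector_field_open[OF B0(1)] by (rule N.open_in_Int)
      have fB: "vector_field N ?B Y" "vector_field N ?B Z" "vector_field N ?B V" "p \<in> ?B" "vector_field N ?B EN"
        using N.vector_field_subset[OF f(1) oB] N.vector_field_subset[OF f(2) oB] N.vector_field_subset[OF B0(1) oB]
          N.vector_field_subset[OF EA oB] p B0(2) by auto
      obtain W F E' where W: "p \<in> W" "field_splits W E E' EN"
          "\<And>Y'. Y' \<in> set [Y, Z, V] \<Longrightarrow> field_extends M N W (F Y') Y'"
        by (rule split_extend[OF E_field oB fB(4), of "[Y, Z, V]"]) (use fB in auto)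
      note pN = AN[OF f(1) p]
      have ext: "field_extends M N W (F Y) Y" "field_extends M N W (F Z) Z" "field_extends M N W (F V) V" using W(3) by simp_all
      have o: "sff_orthogonal p (E p - E' p)" using oE[OF pN] field_splits_at[OF W(2,1) pN] by simp
      note vf = field_extendsD(1)[OF ext(1)] field_extendsD(1)[OF ext(2)] field_extendsD(1)[OF ext(3)]
      note at = field_extendsD(4)[OF ext(1) W(1) pN] field_extendsD(4)[OF ext(2) W(1) pN] field_extendsD(4)[OF ext(3) W(1) pN]
      note tV = field_extendsD(5)[OF ext(3) W(1) pN]
      note E'W = field_splitsD(2)[OF W(2)] and EW = field_splitsD(1)[OF W(2)]
      note YZe = product_extends[OF ext(1,2)]
      have split: "(\<lambda>q. E' q + (E q - E' q)) = E" by auto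
      have "nabla_c g m DM E (F Y) (F Z) (F V) p = nabla_c g m DM (F Y) E (F Z) (F V) p"
        by (rule potential(1)[OF vf EW W(1)])
      also have "\<dots> = nabla_c g m DM (F Y) E' (F Z) (F V) p + nabla_c g m DM (F Y) (\<lambda>q. E q - E' q) (F Z) (F V) p"
        using M.nabla_c_plus[OF vf(1) field_extendsD(1)[OF E'W] field_splitsD(3)[OF W(2)] vf(2,3) W(1)]
        unfolding split .
      also have "\<dots> = nabla_c g m DM (F Y) E' (F Z) (F V) p"
        using nabla_c_normal[OF W(2) o ext W(1) pN] by simp
      also have "\<dots> = nabla_c g m DM E' (F Y) (F Z) (F V) p"
        by (rule potential(1)[OF field_extendsD(1)[OF E'W] vf(2,3,1) W(1)])
      also have "\<dots> = nabla_c gN mN DN EN Y Z V p"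
        by (rule nabla_c_incl[OF E'W ext W(1) pN])
      finally have 1: "nabla_c g m DM E (F Y) (F Z) (F V) p = nabla_c gN mN DN EN Y Z V p" .
      have tr: "g p (DM Q' E p) (incl M p w) = gN p (DN Q EN p) w"
        if "field_extends M N W Q' Q" "w \<in> tangent_space N p" for Q' Q w
        by (rule DM_split_tangent(2)[OF W(2) o that(1) W(1) pN that(2)])
      have "gN p L (V p) = nabla_c gN mN DN EN Y Z V p - gN p (DN (\<lambda>q. mN q (Y q) (Z q)) EN p) (V p)
        + gN p (DN Y EN p) (mN p (Z p) (V p)) + gN p (DN Z EN p) (mN p (Y p) (V p))"
        unfolding L_def by (rule N.lie_derivative_product[OF fB(5,1,2,3,4)])
      also have "\<dots> = nabla_c g m DM E (F Y) (F Z) (F V) p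
        - g p (DM (\<lambda>q. m q (F Y q) (F Z q)) E p) (F V p)
        + g p (DM (F Y) E p) (m p (F Z p) (F V p)) + g p (DM (F Z) E p) (m p (F Y p) (F V p))"
        using 1 tr[OF YZe tV] tr[OF ext(1) proj_product(1)[OF tg(2) tV]] tr[OF ext(2) proj_product(1)[OF tg(1) tV]]
        by (simp add: at proj_product(2) tg tV)
      also have "\<dots> = g p (m p (F Y p) (F Z p)) (F V p)"
        unfolding M.lie_derivative_product[OF EW vf W(1), symmetric] E_product[OF vf(1,2) W(1)] ..
      also have "\<dots> = gN p (mN p (Y p) (Z p)) (V p)"
        by (simp add: at proj_product(2) tg restrict_metric_def)
      finally show "gN p (L - mN p (Y p) (Z p)) v = 0"
        using N.g_diff_left[OF Lin N.m_in[OF tg] v] B0(3) by simp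
    qed
    then show ?thesis by (simp add: L_def)
  qed
  have lieg: "EN p (\<lambda>q. gN q (Y q) (Z q)) - gN p (lie_bracket N EN Y p) (Z p) - gN p (Y p) (lie_bracket N EN Z p)
      = d * gN p (Y p) (Z p)" if f: "vector_field N A Y" "vector_field N A Z" and p: "p \<in> A" for A Y Z p
    unfolding N.lie_derivative_metric[OF sub(2)[OF f(1)] f p] by (rule hom[OF f p])
  show ?thesis
    unfolding frobenius_manifold_def
    by (intro conjI ballI allI impI exI[of _ DN] exI[of _ d]; (elim conjE)?;
        rule submanifold_is_manifold submanifold_is_metric submanifold_multiplication eN_field EN_field
          unit_parts(1) N.levi_civita flat_N submanifold_invariant par pot[THEN conjunct1]
          pot[THEN conjunct2, THEN conjunct1] pot[THEN conjunct2, THEN conjunct2] aff liem lieg; assumption)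
qed

text \<open>
  Necessity of the condition on \<open>e\<close>: as \<open>e\<close> and \<open>e\<^sub>N\<close> are parallel, the derivative of the normal part of \<open>e\<close>
  has no tangential component, and Weingarten's equation applies.
\<close>

lemma frobenius_imp_sff_orthogonal_e:
  assumes F: "frobenius_manifold N gN mN eN EN" and p: "p \<in> pts N"
  shows "sff_orthogonal p (e p - incl M p (eN p))"
proof -
  obtain W e' where W: "field_splits W e e' eN" "p \<in> W"
    by (rule field_splits_exists[OF e_field _ p]) (use p pts_subset in auto)
  note oW = M.vector_field_open[OF field_splitsD(1)[OF W(1)]]
  have "sff_orthogonal p (e p - e' p)"
  proof (rule sff_orthogonalI[OF oW W(2)])
    fix B Y' Y Z' Z assume f: "field_extends M N B Y' Y" "field_extends M N B Z' Z" and B: "p \<in> B" "B \<subseteq> W"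
    note s = field_splits_subset[OF W(1) field_extendsD(3)[OF f(1)] B(2)]
    have pB: "p \<in> B \<inter> pts N" using B p by auto
    have "DN Y eN p = 0"
      by (rule N.frobenius_axioms(5)[OF F field_extendsD(2)[OF f(1)] pB])
    then have "g p (DM Y' e' p) (Z' p) = 0"
      using g_DM_tangent[OF f(1) field_splitsD(2)[OF s] B(1) p field_extendsD(5)[OF f(2) B(1) p]]
        field_extendsD(4)[OF f(2) B(1) p] N.g_zero_left[OF field_extendsD(5)[OF f(2) B(1) p]] by simp
    moreover have "DM Y' (\<lambda>q. e q - e' q) p = 0 - DM Y' e' p"
      using DM_split[OF s f(1) B(1) p] e_parallel[OF field_extendsD(1)[OF f(1)] B(1)]
      by (simp add: eq_neg_iff_add_eq_0 add.commute)
    ultimately have "g p (DM Y' (\<lambda>q. e q - e' q) p) (Z' p) = 0"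
      using M.g_diff_left[OF M.tangent_space_0 M.D_in[OF field_extendsD(1)[OF f(1)] field_extendsD(1)[OF field_splitsD(2)[OF s]] B(1)]
          field_extendsD(6)[OF f(2) B(1)]] M.g_zero_left[OF field_extendsD(6)[OF f(2) B(1)]] p pts_subset by auto
    then show "g p (e p - e' p) (DM Y' Z' p) = 0"
      using weingarten[OF field_splitsD(3)[OF s] field_splitsD(4)[OF s] f B(1) p] by simp
  qed
  then show ?thesis using field_splits_at[OF W p] by simp
qed

text \<open>
  For a normal vector field \<open>\<xi>\<close>, the product \<open>e\<^sub>N \<circ> \<xi>\<close> equals \<open>\<xi>\<close> where \<open>e\<close> is tangent and vanishes
  elsewhere; so tangency of \<open>e\<close> is an open and closed condition.
\<close>

lemma e_tangent_dichotomy: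
  "(\<forall>p\<in>pts N. e p \<in> sub_tangent_space M N p) \<or> (\<forall>p\<in>pts N. e p \<notin> sub_tangent_space M N p)"
proof (rule connected_local_dichotomy[OF connected_N])
  fix p assume p: "p \<in> pts N"
  obtain W0 \<xi> where W0: "vector_field M W0 \<xi>" "p \<in> W0" and
      \<xi>: "\<And>q. q \<in> W0 \<Longrightarrow> q \<in> pts N \<Longrightarrow> normal q (\<xi> q)"
      "\<And>q. q \<in> W0 \<Longrightarrow> q \<in> pts N \<Longrightarrow> g q (\<xi> q) (\<xi> q) \<noteq> 0"
    by (rule normal_frame[OF p]) blast
  obtain W e' where W: "field_splits W e e' eN" "p \<in> W" "W \<subseteq> W0"
    by (rule field_splits_exists[OF M.vector_field_subset[OF e_field M.vector_field_open[OF W0(1)]] W0(2) p])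
       (use M.open_in_subset[OF M.vector_field_open[OF W0(1)]] in auto)
  note oW = M.vector_field_open[OF field_splitsD(1)[OF W(1)]]
  note \<xi>W = M.vector_field_subset[OF W0(1) oW W(3)]
  note e' = field_splitsD(2)[OF W(1)]
  define \<psi> where "\<psi> q = g q (m q (e' q) (\<xi> q)) (\<xi> q)" for q
  have tan: "\<psi> q = g q (\<xi> q) (\<xi> q)" if q: "q \<in> W" "q \<in> pts N" and t: "e q \<in> sub_tangent_space M N q" for q
  proof -
    obtain u where u: "u \<in> tangent_space N q" "e q = incl M q u" using t by (rule sub_tangent_spaceE)
    then have "eN q = u" by (simp add: proj_field_def pr_incl)
    then have "e' q = e q" using field_splits_at[OF W(1) q] u(2) by simp
    then show ?thesis using unit[OF normal_in[OF \<xi>(1)]] q W(3) by (auto simp: \<psi>_def)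
  qed
  have notan: "\<psi> q = 0" if q: "q \<in> W" "q \<in> pts N" and t: "e q \<notin> sub_tangent_space M N q" for q
  proof -
    let ?n = "e q - incl M q (eN q)"
    have n0: "?n \<noteq> 0" using t sub_tangent_spaceI[OF eN_in[OF q(2)]] by auto
    have nx: "normal q (\<xi> q)" using \<xi>(1) q W(3) by blast
    obtain c where c: "\<xi> q = c \<bullet>\<^sub>v ?n" using normal_spans(2)[OF q(2) e_normal[OF q(2)] n0 nx] by blast
    have nin: "?n \<in> tangent_space M q" using e_normal[OF q(2)] by (rule normal_in)
    have ein: "incl M q (eN q) \<in> tangent_space M q" using eN_in[OF q(2)] by (rule incl_in)
    have "m q (e' q) (\<xi> q) = m q (\<xi> q) (incl M q (eN q))"
      using M.m_comm[OF ein normal_in[OF nx]] field_splits_at[OF W(1) q] by simp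
    also have "\<dots> = c \<bullet>\<^sub>v m q ?n (incl M q (eN q))"
      unfolding c by (rule M.m_smul_left[OF nin ein])
    also have "\<dots> = 0" unfolding unit_parts(2)[OF eN_in[OF q(2)]] by (simp add: smul_def fun_eq_iff)
    finally show ?thesis using M.g_zero_left[OF normal_in[OF nx]] by (simp add: \<psi>_def)
  qed
  have s: "smooth_fun M W \<psi>" "smooth_fun M W (\<lambda>q. \<psi> q - g q (\<xi> q) (\<xi> q))"
    unfolding \<psi>_def by (intro M.smooth_fun_diff M.g_smooth M.m_field \<xi>W field_extendsD(1)[OF e'])+
  note oN = open_in_restrict[OF oW]
  show "\<exists>B. openin (top_of_set (pts N)) B \<and> p \<in> B \<and>
      ((\<forall>q\<in>B. e q \<in> sub_tangent_space M N q) \<or> (\<forall>q\<in>B. e q \<notin> sub_tangent_space M N q))"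
  proof (cases "e p \<in> sub_tangent_space M N p")
    case True
    let ?B = "{q \<in> W \<inter> pts N. \<psi> q \<noteq> 0}"
    have "open_in N ?B" by (rule N.open_in_nonzero[OF oN smooth_fun_restrict[OF oW s(1)]])
    moreover have "p \<in> ?B" using tan[OF W(2) p True] \<xi>(2)[OF W0(2) p] W(2) p by simp
    moreover have "\<forall>q\<in>?B. e q \<in> sub_tangent_space M N q" using notan by blast
    ultimately show ?thesis unfolding open_in_def by blast
  next
    case False
    let ?B = "{q \<in> W \<inter> pts N. \<psi> q - g q (\<xi> q) (\<xi> q) \<noteq> 0}"
    have "open_in N ?B" by (rule N.open_in_nonzero[OF oN smooth_fun_restrict[OF oW s(2)]])
    moreover have "p \<in> ?B" using notan[OF W(2) p False] \<xi>(2)[OF W0(2) p] W(2) p by simp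
    moreover have "\<forall>q\<in>?B. e q \<notin> sub_tangent_space M N q" using tan by auto
    ultimately show ?thesis unfolding open_in_def by blast
  qed
qed

text \<open>
  Necessity of the condition on \<open>\<E>\<close>, when \<open>e\<close> is tangent.  Comparing the homothety equations, the
  second fundamental form in the direction of the normal part of \<open>\<E>\<close> is a constant multiple of the
  metric.  It vanishes on the parallel field \<open>e\<close>, so the constant is 0.
\<close>

lemma frobenius_imp_sff_orthogonal_E:
  assumes F: "frobenius_manifold N gN mN eN EN" and et: "tangent_to M N e" and p: "p \<in> pts N"
  shows "sff_orthogonal p (E p - incl M p (EN p))"
proof -
  obtain d where d: "\<And>A Y Z p. vector_field M A Y \<Longrightarrow> vector_field M A Z \<Longrightarrow> p \<in> A \<Longrightarrow>
      g p (DM Y E p) (Z p) + g p (Y p) (DM Z E p) = d * g p (Y p) (Z p)"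
    using E_homothetic by blast
  obtain d' where d': "\<And>A Y Z p. vector_field N A Y \<Longrightarrow> vector_field N A Z \<Longrightarrow> p \<in> A \<Longrightarrow>
      gN p (DN Y EN p) (Z p) + gN p (Y p) (DN Z EN p) = d' * gN p (Y p) (Z p)"
    using N.frobenius_axioms(11)[OF F] by blast
  obtain W E' where W: "field_splits W E E' EN" "p \<in> W"
    by (rule field_splits_exists[OF E_field _ p]) (use p pts_subset in auto)
  note oW = M.vector_field_open[OF field_splitsD(1)[OF W(1)]]
  have main: "2 * g p (E p - E' p) (DM Y' Z' p) = (d' - d) * gN p (Y p) (Z p)"
    if f: "field_extends M N B Y' Y" "field_extends M N B Z' Z" and B: "p \<in> B" "B \<subseteq> W" for B Y' Y Z' Z
  proof -
    note s = field_splits_subset[OF W(1) field_extendsD(3)[OF f(1)] B(2)]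
    have pB: "p \<in> B \<inter> pts N" using B p by auto
    let ?\<nu> = "\<lambda>q. E q - E' q"
    note \<nu> = field_splitsD(3,4)[OF s]
    note vf = field_extendsD(1)[OF f(1)] field_extendsD(1)[OF f(2)] and vN = field_extendsD(2)[OF f(1)] field_extendsD(2)[OF f(2)]
    note E'B = field_extendsD(1)[OF field_splitsD(2)[OF s]] and ENB = field_extendsD(2)[OF field_splitsD(2)[OF s]]
    note in_M = field_extendsD(6)[OF f(1) B(1)] field_extendsD(6)[OF f(2) B(1)]
    note in_N = field_extendsD(5)[OF f(1) B(1) p] field_extendsD(5)[OF f(2) B(1) p]
    have DE: "g p (DM Q' E p) (T' p) = gN p (DN Q EN p) (T p) - g p (?\<nu> p) (DM Q' T' p)"
      if Q: "field_extends M N B Q' Q" and T: "field_extends M N B T' T" for Q' Q T' T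
    proof -
      note QM = field_extendsD(1)[OF Q]
      have "g p (DM Q' E p) (T' p) = g p (DM Q' E' p) (T' p) + g p (DM Q' ?\<nu> p) (T' p)"
        unfolding DM_split[OF s Q B(1) p]
        by (rule M.g_plus_left[OF M.D_in[OF QM E'B B(1)] M.D_in[OF QM \<nu>(1) B(1)] field_extendsD(6)[OF T B(1)]])
      then show ?thesis
        using g_DM_tangent[OF Q field_splitsD(2)[OF s] B(1) p field_extendsD(5)[OF T B(1) p]]
          field_extendsD(4)[OF T B(1) p] weingarten[OF \<nu> Q T B(1) p] by simp
    qed
    have "g p (Y' p) (DM Z' E p) = g p (DM Z' E p) (Y' p)"
      by (rule M.g_sym[OF in_M(1) M.D_in[OF vf(2) field_splitsD(1)[OF s] B(1)]])
    moreover have "gN p (Y p) (DN Z EN p) = gN p (DN Z EN p) (Y p)"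
      by (rule N.g_sym[OF in_N(1) N.D_in[OF vN(2) ENB pB]])
    moreover have "g p (?\<nu> p) (DM Z' Y' p) = g p (?\<nu> p) (DM Y' Z' p)"
      by (rule sff_symmetric[OF \<nu>(2)[OF B(1) p] f(2,1) B(1) p])
    moreover have "g p (Y' p) (Z' p) = gN p (Y p) (Z p)"
      using field_extendsD(4)[OF f(1) B(1) p] field_extendsD(4)[OF f(2) B(1) p] by (simp add: restrict_metric_def)
    ultimately have "d * gN p (Y p) (Z p) = gN p (DN Y EN p) (Z p) - g p (?\<nu> p) (DM Y' Z' p)
        + (gN p (DN Z EN p) (Y p) - g p (?\<nu> p) (DM Y' Z' p))"
      and "d' * gN p (Y p) (Z p) = gN p (DN Y EN p) (Z p) + gN p (DN Z EN p) (Y p)"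
      using d[OF vf B(1)] d'[OF vN pB] DE[OF f] DE[OF f(2,1)] by simp_all
    then show ?thesis by (simp add: left_diff_distrib)
  qed
  have epr: "e q = incl M q (eN q)" if q: "q \<in> pts N" for q
  proof -
    have "e q \<in> sub_tangent_space M N q" using et q unfolding tangent_to_def by blast
    then obtain u where "u \<in> tangent_space N q" "e q = incl M q u" by (rule sub_tangent_spaceE)
    then show ?thesis by (simp add: proj_field_def pr_incl)
  qed
  have dd: "d' = d"
  proof (rule ccontr)
    assume ne: "d' \<noteq> d"
    have "eN p = 0"
    proof (rule N.g_nondegenerate[OF eN_in[OF p]])
      fix v assume v: "v \<in> tangent_space N p"
      obtain V' V B where V: "field_extends M N B V' V" "p \<in> B" "B \<subseteq> W" "V p = v"
        by (rule tangent_extend_at[OF v oW W(2)])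
      note oB = field_extendsD(3)[OF V(1)]
      have eB: "field_extends M N B e eN"
        by (rule field_restrict[OF M.vector_field_subset[OF e_field oB M.open_in_subset[OF oB]]]) (use epr eN_in in auto)
      have "DM V' e p = 0" by (rule e_parallel[OF field_extendsD(1)[OF V(1)] V(2)])
      then have "(d' - d) * gN p (V p) (eN p) = 2 * g p (E p - E' p) 0"
        using main[OF V(1) eB V(2,3)] by simp
      also have "g p (E p - E' p) 0 = 0"
      proof -
        have n: "E p - E' p \<in> tangent_space M p" using field_splitsD(4)[OF W p] by (rule normal_in)
        show ?thesis using M.g_smul_right[OF n n, of 0] by (simp add: M.smul_zero)
      qed
      finally show "gN p (eN p) v = 0" using ne V(4) N.g_sym[OF eN_in[OF p] v] by simp
    qed
    then have e0: "e p = 0" using epr[OF p] by (simp add: incl_zero)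
    obtain W0 \<xi> where W0: "vector_field M W0 \<xi>" "p \<in> W0" "\<And>q. q \<in> W0 \<Longrightarrow> q \<in> pts N \<Longrightarrow> g q (\<xi> q) (\<xi> q) \<noteq> 0"
      by (rule normal_frame[OF p]) blast
    have x: "\<xi> p \<in> tangent_space M p" using M.vector_field_in[OF W0(1,2)] .
    have "\<xi> p = 0" using unit[OF x] M.m_zero_left[OF x] e0 by simp
    then show False using W0(3)[OF W0(2) p] M.g_zero_left[OF x] x by simp
  qed
  have "sff_orthogonal p (E p - E' p)"
    by (rule sff_orthogonalI[OF oW W(2)]) (use main dd in fastforce)
  then show ?thesis using field_splits_at[OF W p] by simp
qed

text \<open>
  Let \<open>a = g(\<E>, \<xi>)\<close> for a normal field \<open>\<xi>\<close>, and let the second fundamental form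
  be orthogonal to the normal part of \<open>\<E>\<close>: its product with \<open>a\<close> vanishes.  Differentiating, it
  vanishes wherever the 1-jet of \<open>a\<close> does not.  There the hypersurface is totally geodesic, and
  \<open>\<nabla>\<nabla>\<E> = 0\<close> expresses the second derivatives of \<open>a\<close> linearly by its 1-jet.  So locally the 1-jet
  vanishes identically, and \<open>\<E>\<close> is tangent, or nowhere, and the second fundamental form vanishes.
\<close>

lemma E_local_dichotomy:
  assumes oE: "\<And>p. p \<in> pts N \<Longrightarrow> sff_orthogonal p (E p - incl M p (EN p))" and p: "p \<in> pts N"
  shows "\<exists>B. open_in N B \<and> p \<in> B \<and>
    ((\<forall>q\<in>B. E q \<in> sub_tangent_space M N q) \<or>
     (\<forall>q\<in>B. \<not> (\<exists>C. open_in N C \<and> q \<in> C \<and> (\<forall>r\<in>C. E r \<in> sub_tangent_space M N r)) \<and>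
       (\<exists>n. normal q n \<and> n \<noteq> 0 \<and> sff_orthogonal q n)))"
proof -
  obtain U \<kappa> where s: "slice U \<kappa>" and pU: "p \<in> U" using slice_at p by blast
  note c = slice_max[OF s] and cN = slice_N[OF s]
  obtain W0 \<xi> where W0: "vector_field M W0 \<xi>" "p \<in> W0" and
      \<xi>0: "\<And>q. q \<in> W0 \<Longrightarrow> q \<in> pts N \<Longrightarrow> normal q (\<xi> q)"
      "\<And>q. q \<in> W0 \<Longrightarrow> q \<in> pts N \<Longrightarrow> g q (\<xi> q) (\<xi> q) \<noteq> 0"
    by (rule normal_frame[OF p]) blast
  define W where "W = {q \<in> W0 \<inter> U. g q (\<xi> q) (\<xi> q) \<noteq> 0}"
  have oW0U: "open_in M (W0 \<inter> U)" using M.vector_field_open[OF W0(1)] M.chart_domain_open[OF c] by (rule M.open_in_Int)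
  have W: "open_in M W"
    unfolding W_def
    by (rule M.open_in_nonzero[OF oW0U M.smooth_fun_subset[OF M.g_smooth[OF W0(1) W0(1)] Int_lower1]])
  have pW: "p \<in> W" using W0(2) pU \<xi>0(2)[OF W0(2) p] by (simp add: W_def)
  have WU: "W \<subseteq> U" and WW0: "W \<subseteq> W0" by (auto simp: W_def)
  note \<xi> = M.vector_field_subset[OF W0(1) W WW0]
  have \<xi>n: "normal q (\<xi> q)" if "q \<in> W" "q \<in> pts N" for q using \<xi>0(1) that WW0 by blast
  have \<xi>0': "\<xi> q \<noteq> 0" if "q \<in> W" for q
    using that M.g_zero_left[OF M.vector_field_in[OF \<xi> that]] by (auto simp: W_def)
  define k where "k q = g q (\<xi> q) (\<xi> q)" for q
  have k0: "k q \<noteq> 0" if "q \<in> W" for q using that by (simp add: W_def k_def)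
  have k: "smooth_fun M W k" unfolding k_def by (rule M.g_smooth[OF \<xi> \<xi>])
  have EW: "vector_field M W E" by (rule M.vector_field_subset[OF E_field W M.open_in_subset[OF W]])
  define a where "a q = g q (E q) (\<xi> q)" for q
  have a: "smooth_fun M W a" unfolding a_def by (rule M.g_smooth[OF EW \<xi>])
  let ?J = "idx N"
  let ?S = "W \<inter> pts N"
  have oS: "open_in N ?S" by (rule open_in_restrict[OF W])
  have SU: "?S \<subseteq> U \<inter> pts N" using WU by auto
  note aN = smooth_fun_restrict[OF W a]
  define X where "X j q = tangent_vector M (U, \<kappa>) q (axis j 1)" for j q
  define Y where "Y j q = tangent_vector N (U \<inter> pts N, \<kappa>) q (axis j 1)" for j q
  have ext: "field_extends M N W (X j) (Y j)" if j: "j \<in> ?J" for j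
  proof (rule field_restrict)
    show "vector_field M W (X j)"
      unfolding X_def by (rule M.vector_field_subset[OF M.vector_field_const[OF c] W WU])
    fix q assume "q \<in> ?S"
    then have q: "q \<in> U \<inter> pts N" using SU by auto
    have "incl M q (Y j q) = X j q"
      unfolding Y_def X_def incl_tangent_vector[OF s q]
      by (rule M.tangent_vector_cong) (use j in \<open>auto simp: axis_def\<close>)
    then show "Y j q \<in> tangent_space N q \<and> X j q = incl M q (Y j q)"
      unfolding Y_def using N.tangent_vectorI[OF cN q] by simp
  qed
  note XM = field_extendsD(1)[OF ext] and YN = field_extendsD(2)[OF ext]
  have a_split: "\<exists>t. a q = t * k q \<and> E q - incl M q (EN q) = t \<bullet>\<^sub>v \<xi> q" if q: "q \<in> W" "q \<in> pts N" for q
  proof -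
    obtain t where t: "E q - incl M q (EN q) = t \<bullet>\<^sub>v \<xi> q"
      using normal_spans(2)[OF q(2) \<xi>n[OF q] \<xi>0'[OF q(1)] E_normal[OF q(2)]] by blast
    note \<xi>in = normal_in[OF \<xi>n[OF q]]
    have "a q = g q (t \<bullet>\<^sub>v \<xi> q + incl M q (EN q)) (\<xi> q)" unfolding a_def t[symmetric] by simp
    also have "\<dots> = t * k q + g q (incl M q (EN q)) (\<xi> q)"
      using M.g_plus_left[OF M.tangent_space_smul[OF \<xi>in] incl_in[OF EN_in[OF q(2)]] \<xi>in] M.g_smul_left[OF \<xi>in \<xi>in]
      by (simp add: k_def)
    also have "g q (incl M q (EN q)) (\<xi> q) = 0"
      using M.g_sym[OF incl_in[OF EN_in[OF q(2)]] \<xi>in] normalD[OF \<xi>n[OF q] EN_in[OF q(2)]] by simp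
    finally show ?thesis using t by auto
  qed
  have a_zero: "a q = 0 \<longleftrightarrow> E q \<in> sub_tangent_space M N q" if q: "q \<in> W" "q \<in> pts N" for q
  proof
    assume "a q = 0"
    then have "E q - incl M q (EN q) = 0" using a_split[OF q] k0[OF q(1)] by (auto simp: M.smul_zero)
    then show "E q \<in> sub_tangent_space M N q" using sub_tangent_spaceI[OF EN_in[OF q(2)]] by simp
  next
    assume "E q \<in> sub_tangent_space M N q"
    then obtain u where u: "u \<in> tangent_space N q" "E q = incl M q u" by (rule sub_tangent_spaceE)
    show "a q = 0"
      unfolding a_def u(2)
      using M.g_sym[OF incl_in[OF u(1)] normal_in[OF \<xi>n[OF q]]] normalD[OF \<xi>n[OF q] u(1)] by simp
  qed
  define D where "D = {q \<in> ?S. a q \<noteq> 0 \<or> (\<exists>i\<in>?J. Y i q a \<noteq> 0)}"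
  have oD: "open_in N D"
  proof -
    have eq: "D = {q \<in> ?S. a q \<noteq> 0} \<union> (\<Union>i\<in>?J. {q \<in> ?S. Y i q a \<noteq> 0})" by (auto simp: D_def)
    have "open_in N {q \<in> ?S. Y i q a \<noteq> 0}" if "i \<in> ?J" for i
      by (rule N.open_in_nonzero[OF oS N.vector_field_apply[OF YN[OF that] oS order_refl aN]])
    then show ?thesis
      unfolding eq using N.open_in_nonzero[OF oS aN] by (auto simp: open_in_def intro!: openin_Un openin_Union)
  qed
  have sffD: "sff_orthogonal q (\<xi> q)" if q: "q \<in> D" for q
  proof (rule sff_orthogonalI[OF W])
    show qW: "q \<in> W" using q by (auto simp: D_def)
    have qN: "q \<in> pts N" using q by (auto simp: D_def)
    fix B P' P Q' Q assume f: "field_extends M N B P' P" "field_extends M N B Q' Q" and B: "q \<in> B" "B \<subseteq> W"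
    note oB = field_extendsD(3)[OF f(1)]
    note PQ = M.D_field[OF field_extendsD(1)[OF f(1)] field_extendsD(1)[OF f(2)]]
    define h where "h r = g r (\<xi> r) (DM P' Q' r)" for r
    have h: "smooth_fun M B h" unfolding h_def by (rule M.g_smooth[OF M.vector_field_subset[OF \<xi> oB B(2)] PQ])
    have ah: "a r * h r = 0" if r: "r \<in> B \<inter> pts N" for r
    proof -
      have rW: "r \<in> W" "r \<in> pts N" using r B by auto
      obtain t where t: "a r = t * k r" "E r - incl M r (EN r) = t \<bullet>\<^sub>v \<xi> r" using a_split[OF rW] by blast
      have "g r (t \<bullet>\<^sub>v \<xi> r) (DM P' Q' r) = 0"
        unfolding t(2)[symmetric] by (rule sff_orthogonalD[OF oE[OF rW(2)] f]) (use r in auto)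
      then have "t * h r = 0"
        using M.g_smul_left[OF normal_in[OF \<xi>n[OF rW]] M.vector_field_in[OF PQ], of t] r by (simp add: h_def)
      then show ?thesis using t(1) by auto
    qed
    show "g q (\<xi> q) (DM P' Q' q) = 0"
    proof (cases "a q = 0")
      case False
      then show ?thesis using ah[of q] B(1) qN by (simp add: h_def)
    next
      case True
      then obtain i where i: "i \<in> ?J" "Y i q a \<noteq> 0" using q by (auto simp: D_def)
      note oBN = open_in_restrict[OF oB]
      have qB: "q \<in> B \<inter> pts N" using B(1) qN by auto
      have Yq: "Y i q \<in> tangent_space N q" by (rule field_extendsD(5)[OF ext[OF i(1)] qW qN])
      have sm: "smooth_near N q a" "smooth_near N q h"
        using N.smooth_fun_nearD[OF oS aN] qW qN N.smooth_fun_nearD[OF oBN smooth_fun_restrict[OF oB h] qB] by auto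
      have "Y i q (\<lambda>r. a r * h r) = Y i q (\<lambda>r. 0)"
        by (rule N.tangent_cong[OF Yq oBN qB ah])
      then have "a q * Y i q h + h q * Y i q a = 0"
        using N.tangent_mult[OF Yq sm] N.tangent_const[OF Yq] by simp
      then show ?thesis using True i(2) by (simp add: h_def)
    qed
  qed
  \<comment> \<open>Where the second fundamental form vanishes, derivatives of \<open>\<xi>\<close> in tangential directions are normal.\<close>
  define \<theta> where "\<theta> V q = g q (DM V \<xi> q) (\<xi> q) / k q" for V q
  have weing: "g q w (DM V' \<xi> q) = g q w (\<xi> q) * \<theta> V' q"
    if V: "field_extends M N B V' V" and B: "q \<in> B" "B \<subseteq> W" and q: "q \<in> D" and w: "w \<in> tangent_space M q" for B V' V q w
  proof -
    have qW: "q \<in> W" "q \<in> pts N" using q by (auto simp: D_def)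
    note oB = field_extendsD(3)[OF V]
    note \<xi>B = M.vector_field_subset[OF \<xi> oB B(2)]
    note Din = M.D_in[OF field_extendsD(1)[OF V] \<xi>B B(1)]
    note \<xi>in = normal_in[OF \<xi>n[OF qW]]
    have "normal q (DM V' \<xi> q)"
      unfolding normal_def
    proof (intro conjI ballI Din)
      fix v assume v: "v \<in> tangent_space N q"
      obtain Z' Z C where Z: "field_extends M N C Z' Z" "q \<in> C" "C \<subseteq> B" "Z q = v"
        by (rule tangent_extend_at[OF v oB B(1)])
      note oC = field_extendsD(3)[OF Z(1)]
      note VC = field_extends_subset[OF V oC Z(3)]
      have "g q (DM V' \<xi> q) (Z' q) = - g q (\<xi> q) (DM V' Z' q)"
        by (rule weingarten[OF M.vector_field_subset[OF \<xi>B oC Z(3)] _ VC Z(1,2) qW(2)]) (use \<xi>n Z(3) B(2) in auto)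
      also have "\<dots> = 0" using sff_orthogonalD[OF sffD[OF q] VC Z(1,2)] by simp
      finally show "g q (DM V' \<xi> q) (incl M q v) = 0" using field_extendsD(4)[OF Z(1,2) qW(2)] Z(4) by simp
    qed
    then obtain t where t: "DM V' \<xi> q = t \<bullet>\<^sub>v \<xi> q"
      using normal_spans(2)[OF qW(2) \<xi>n[OF qW] \<xi>0'[OF qW(1)]] by blast
    have "\<theta> V' q = t" using k0[OF qW(1)] M.g_smul_left[OF \<xi>in \<xi>in, of t] by (simp add: \<theta>_def t k_def)
    then show ?thesis using M.g_smul_right[OF \<xi>in w, of t] by (simp add: t)
  qed
  have \<theta>s: "smooth_fun M W (\<theta> V)" if "vector_field M W V" for V
    unfolding \<theta>_def by (intro M.smooth_fun_divide M.g_smooth M.D_field that \<xi> k k0)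
  have XYa: "X i q f = Y i q f" if "i \<in> ?J" "q \<in> ?S" "smooth_near M q f" for i q f
    using field_extendsD(4)[OF ext[OF that(1)]] that(2) incl_apply[OF that(3)] by auto
  define \<tau> where "\<tau> i j = \<theta> (DM (X j) (X i))" for i j
  define \<Gamma> where "\<Gamma> i j l q = DN (Y j) (Y i) q (\<lambda>q. \<kappa> q $ l)" for i j l q
  have hess: "Y j q (\<lambda>r. Y i r a) =
      (Y j q (\<theta> (X i)) - \<tau> i j q - \<theta> (X j) q * \<theta> (X i) q) * a q
      + ((\<Sum>l\<in>?J. \<Gamma> i j l q * Y l q a) + \<theta> (X j) q * Y i q a + \<theta> (X i) q * Y j q a)"
    if i: "i \<in> ?J" and j: "j \<in> ?J" and q: "q \<in> D" for i j q
  proof -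
    have qS: "q \<in> ?S" "q \<in> W" "q \<in> pts N" using q by (auto simp: D_def)
    note near = M.smooth_fun_nearD[OF W _ qS(2)]
    define G where "G r = g r (DM (X i) E r) (\<xi> r)" for r
    note DXE = M.D_field[OF XM[OF i] EW]
    have Gs: "smooth_fun M W G" unfolding G_def by (rule M.g_smooth[OF DXE \<xi>])
    have first: "Y i r a = G r + \<theta> (X i) r * a r" if r: "r \<in> D" for r
    proof -
      have rS: "r \<in> ?S" "r \<in> W" "r \<in> pts N" using r by (auto simp: D_def)
      have "Y i r a = X i r a" using XYa[OF i rS(1) M.smooth_fun_nearD[OF W a rS(2)]] by simp
      also have "\<dots> = G r + g r (E r) (DM (X i) \<xi> r)"
        unfolding a_def G_def by (rule M.metric_compatible[OF XM[OF i] EW \<xi> rS(2)])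
      finally show ?thesis
        using weing[OF ext[OF i] rS(2) order_refl r M.vector_field_in[OF EW rS(2)]] by (simp add: a_def mult.commute)
    qed
    have Yq: "Y j q \<in> tangent_space N q" by (rule field_extendsD(5)[OF ext[OF j] qS(2,3)])
    note nearN = N.smooth_fun_nearD[OF oS smooth_fun_restrict[OF W] qS(1)]
    have "Y j q (\<lambda>r. Y i r a) = Y j q (\<lambda>r. G r + \<theta> (X i) r * a r)"
      by (rule N.tangent_cong[OF Yq oD q first])
    also have "\<dots> = Y j q G + Y j q (\<lambda>r. \<theta> (X i) r * a r)"
      by (intro N.tangent_add[OF Yq] nearN Gs M.smooth_fun_mult \<theta>s XM i a)
    also have "Y j q (\<lambda>r. \<theta> (X i) r * a r) = \<theta> (X i) q * Y j q a + a q * Y j q (\<theta> (X i))"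
      by (intro N.tangent_mult[OF Yq] nearN \<theta>s XM i a)
    also have "Y j q G = g q (DM (X j) (DM (X i) E) q) (\<xi> q) + g q (DM (X i) E q) (DM (X j) \<xi> q)"
      using XYa[OF j qS(1) near[OF Gs]] M.metric_compatible[OF XM[OF j] DXE \<xi> qS(2), folded G_def] by simp
    also have "DM (X j) (DM (X i) E) q = DM (DM (X j) (X i)) E q"
      by (rule E_affine[OF XM[OF j] XM[OF i] qS(2)])
    also have "g q (DM (X i) E q) (DM (X j) \<xi> q) = G q * \<theta> (X j) q"
      unfolding G_def by (rule weing[OF ext[OF j] qS(2) order_refl q M.vector_field_in[OF DXE qS(2)]])
    also have "G q = Y i q a - \<theta> (X i) q * a q" using first[OF q] by simp
    also have "g q (DM (DM (X j) (X i)) E q) (\<xi> q) = (\<Sum>l\<in>?J. \<Gamma> i j l q * Y l q a) - \<tau> i j q * a q"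
    proof -
      define V' where "V' = DM (X j) (X i)"
      define V where "V = DN (Y j) (Y i)"
      have V': "vector_field M W V'" unfolding V'_def by (rule M.D_field[OF XM[OF j] XM[OF i]])
      obtain C0 where C0: "open_in M C0" "D = C0 \<inter> pts N" using oD by (rule open_in_extend)
      let ?C = "C0 \<inter> W"
      have oC: "open_in M ?C" using C0(1) W by (rule M.open_in_Int)
      have VC: "field_extends M N ?C V' V"
      proof (rule field_restrict[OF M.vector_field_subset[OF V' oC Int_lower2]])
        fix r assume "r \<in> ?C \<inter> pts N"
        then have r: "r \<in> D" "r \<in> W" "r \<in> pts N" using C0(2) by auto
        have rS: "r \<in> ?S" using r by auto
        have Vin: "V r \<in> tangent_space N r" unfolding V_def by (rule N.D_in[OF YN[OF j] YN[OF i] rS])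
        have "V' r \<in> sub_tangent_space M N r"
          by (rule normal_spans(3)[OF r(3) \<xi>n[OF r(2,3)] \<xi>0'[OF r(2)] M.vector_field_in[OF V' r(2)]])
             (unfold V'_def, rule sff_orthogonalD[OF sffD[OF r(1)] ext[OF j] ext[OF i] r(2)])
        then obtain u where u: "u \<in> tangent_space N r" "V' r = incl M r u" by (rule sub_tangent_spaceE)
        have "normal r (incl M r (u - V r))"
          using DM_tangential_part[OF ext[OF j] ext[OF i] r(2,3)] u(2) by (simp add: incl_diff V'_def V_def)
        then have "u - V r = 0" by (rule normal_tangent[OF _ N.tangent_space_diff[OF u(1) Vin]])
        then show "V r \<in> tangent_space N r \<and> V' r = incl M r (V r)" using u Vin by simp
      qed
      have qC: "q \<in> ?C" using q C0(2) qS by auto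
      have "V' q a = g q (DM V' E q) (\<xi> q) + g q (E q) (DM V' \<xi> q)"
        unfolding a_def by (rule M.metric_compatible[OF V' EW \<xi> qS(2)])
      moreover have "g q (E q) (DM V' \<xi> q) = a q * \<tau> i j q"
        using weing[OF VC qC Int_lower2 q M.vector_field_in[OF EW qS(2)]] by (simp add: a_def \<tau>_def V'_def)
      moreover have "V' q a = V q a"
        using field_extendsD(4)[OF VC qC qS(3)] incl_apply[OF near[OF a]] by simp
      moreover have "V q a = (\<Sum>l\<in>?J. \<Gamma> i j l q * Y l q a)"
      proof -
        have qU: "q \<in> U \<inter> pts N" using SU qS by auto
        have na: "smooth_near N q a" using nearN[OF a] .
        have Ya: "Y l q a = chart_partial (U \<inter> pts N, \<kappa>) l a q" if l: "l \<in> ?J" for l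
        proof -
          have "Y l q a = (\<Sum>i\<in>?J. axis l 1 $ i * chart_partial (U \<inter> pts N, \<kappa>) i a q)"
            using na by (simp add: Y_def tangent_vector_apply)
          also have "\<dots> = (\<Sum>i\<in>?J. if i = l then chart_partial (U \<inter> pts N, \<kappa>) i a q else 0)"
            by (intro sum.cong) (auto simp: axis_def)
          finally show ?thesis using l by simp
        qed
        show ?thesis
          unfolding N.tangent_apply_coords[OF cN qU field_extendsD(5)[OF VC qC qS(3)] na]
          by (intro sum.cong refl) (simp add: Ya \<Gamma>_def V_def)
      qed
      ultimately show ?thesis by (simp add: V'_def algebra_simps)
    qed
    finally show ?thesis by (simp add: algebra_simps)
  qed
  \<comment> \<open>In the slice chart, \<open>hess\<close> has the form required by the dichotomy for 1-jets.\<close>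
  let ?inv = "inv_into (U \<inter> pts N) \<kappa>"
  define A where "A = \<kappa> ` ?S"
  define F where "F x = a (?inv x)" for x
  have oA: "openin (top_of_set (coord_space ?J)) A"
    unfolding A_def by (rule N.max_open_image_subset[OF cN oS SU])
  have toA: "Cinf_on ?J A (\<lambda>x. f (?inv x))" if "smooth_fun N ?S f" for f
    unfolding A_def by (rule N.smooth_fun_chart[OF cN SU oS that])
  have invS: "?inv (\<kappa> q) = q" if "q \<in> ?S" for q using slice_inv_into[OF s] that SU by blast
  have partial: "partial_deriv i (\<lambda>x. f (?inv x)) x = Y i (?inv x) f"
    if i: "i \<in> ?J" and x: "x \<in> A" and f: "smooth_fun N ?S f" for i x f
  proof -
    obtain q where q: "q \<in> ?S" "x = \<kappa> q" using x by (auto simp: A_def)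
    have "smooth_near N q f" by (rule N.smooth_fun_nearD[OF oS f q(1)])
    then have "Y i q f = (\<Sum>l\<in>?J. axis i 1 $ l * chart_partial (U \<inter> pts N, \<kappa>) l f q)"
      by (simp add: Y_def tangent_vector_apply)
    also have "\<dots> = (\<Sum>l\<in>?J. if l = i then chart_partial (U \<inter> pts N, \<kappa>) l f q else 0)"
      by (intro sum.cong) (auto simp: axis_def)
    also have "\<dots> = partial_deriv i (\<lambda>x. f (?inv x)) x" using i by (simp add: chart_partial_def q(2))
    finally show ?thesis by (simp add: q(2) invS[OF q(1)])
  qed
  have F: "Cinf_on ?J A F" unfolding F_def by (rule toA[OF aN])
  have F1: "partial_deriv i F x = Y i (?inv x) a" if "i \<in> ?J" "x \<in> A" for i x
    unfolding F_def by (rule partial[OF that aN])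
  have F2: "partial_deriv j (partial_deriv i F) x = Y j (?inv x) (\<lambda>r. Y i r a)"
    if i: "i \<in> ?J" and j: "j \<in> ?J" and x: "x \<in> A" for i j x
  proof -
    have "partial_deriv j (partial_deriv i F) x = partial_deriv j (\<lambda>x. Y i (?inv x) a) x"
      by (rule partial_deriv_cong[OF oA x j F1[OF i]])
    also have "\<dots> = Y j (?inv x) (\<lambda>r. Y i r a)"
      by (rule partial[OF j x N.vector_field_apply[OF YN[OF i] oS order_refl aN]])
    finally show ?thesis .
  qed
  have inA: "?inv x \<in> ?S \<and> \<kappa> (?inv x) = x" if "x \<in> A" for x using that invS by (auto simp: A_def)
  have inD: "?inv x \<in> D \<longleftrightarrow> F x \<noteq> 0 \<or> (\<exists>l\<in>?J. partial_deriv l F x \<noteq> 0)" if x: "x \<in> A" for x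
    using F1[OF _ x] inA[OF x] by (auto simp: D_def F_def)
  define b where "b i j x = Y j (?inv x) (\<theta> (X i)) - \<tau> i j (?inv x) - \<theta> (X j) (?inv x) * \<theta> (X i) (?inv x)" for i j x
  define cc where "cc i j l x = \<Gamma> i j l (?inv x) + (if l = i then \<theta> (X j) (?inv x) else 0)
      + (if l = j then \<theta> (X i) (?inv x) else 0)" for i j l x
  have \<theta>N: "smooth_fun N ?S (\<theta> V)" if "vector_field M W V" for V by (rule smooth_fun_restrict[OF W \<theta>s[OF that]])
  have contA: "continuous_on A (\<lambda>x. f (?inv x))" if "smooth_fun N ?S f" for f
    by (rule Cinf_on_continuous[OF toA[OF that]])
  obtain B0 where B0: "openin (top_of_set (coord_space ?J)) B0" "\<kappa> p \<in> B0" "B0 \<subseteq> A"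
    "(\<forall>x\<in>B0. F x = 0) \<or> (\<forall>x\<in>B0. F x \<noteq> 0 \<or> (\<exists>l\<in>?J. partial_deriv l F x \<noteq> 0))"
  proof (rule jet_zero_dichotomy[OF oA F, where b = b and c = cc])
    show "\<kappa> p \<in> A" using pW p by (auto simp: A_def)
    show "continuous_on A (b i j)" if "i \<in> ?J" "j \<in> ?J" for i j
      unfolding b_def \<tau>_def
      by (intro continuous_on_diff continuous_on_mult contA \<theta>N N.vector_field_apply[OF YN oS order_refl] M.D_field XM that)
    show "continuous_on A (cc i j l)" if "i \<in> ?J" "j \<in> ?J" "l \<in> ?J" for i j l
    proof -
      have "smooth_fun N ?S (\<Gamma> i j l)"
        unfolding \<Gamma>_def
        by (rule N.vector_field_apply[OF N.D_field[OF YN[OF that(2)] YN[OF that(1)]] oS order_refl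
              N.smooth_fun_subset[OF N.smooth_fun_coord[OF cN] SU]])
      moreover have "smooth_fun N ?S (\<lambda>q. if R then \<theta> (X i) q else 0)" if "i \<in> ?J" for R i
        using \<theta>N[OF XM[OF that]] by (cases R) simp_all
      ultimately show ?thesis
        unfolding cc_def using that(1,2) by (intro continuous_on_add contA)
    qed
    fix x i j assume x: "x \<in> A" and i: "i \<in> ?J" and j: "j \<in> ?J"
      and nz: "F x \<noteq> 0 \<or> (\<exists>l\<in>?J. partial_deriv l F x \<noteq> 0)"
    have "(\<Sum>l\<in>?J. cc i j l x * partial_deriv l F x) = (\<Sum>l\<in>?J. \<Gamma> i j l (?inv x) * Y l (?inv x) a
        + (if l = i then \<theta> (X j) (?inv x) * Y l (?inv x) a else 0)
        + (if l = j then \<theta> (X i) (?inv x) * Y l (?inv x) a else 0))"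
      by (intro sum.cong refl) (auto simp: cc_def F1 x distrib_right)
    also have "\<dots> = (\<Sum>l\<in>?J. \<Gamma> i j l (?inv x) * Y l (?inv x) a)
        + \<theta> (X j) (?inv x) * Y i (?inv x) a + \<theta> (X i) (?inv x) * Y j (?inv x) a"
      using i j by (simp add: sum.distrib)
    finally show "partial_deriv j (partial_deriv i F) x = b i j x * F x + (\<Sum>l\<in>?J. cc i j l x * partial_deriv l F x)"
      using hess[OF i j] inD[OF x] nz F2[OF i j x] by (simp add: b_def F_def)
  qed
  define B where "B = (U \<inter> pts N) \<inter> \<kappa> -` B0"
  have oB: "open_in N B"
    unfolding B_def open_in_def by (rule chart_preimage_open[OF N.max_chart[OF cN] B0(1)])
  have pB: "p \<in> B" using pU p B0(2) by (simp add: B_def)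
  have BS: "q \<in> ?S \<and> \<kappa> q \<in> B0 \<and> ?inv (\<kappa> q) = q" if "q \<in> B" for q
  proof -
    have q: "q \<in> U \<inter> pts N" "\<kappa> q \<in> B0" using that by (auto simp: B_def)
    then obtain r where "r \<in> ?S" "\<kappa> q = \<kappa> r" using B0(3) by (auto simp: A_def)
    then have "q = r" using slice_inj[OF s] q SU by (auto dest: inj_onD)
    then show ?thesis using \<open>r \<in> ?S\<close> q invS by auto
  qed
  show ?thesis
    using B0(4)
  proof
    assume z: "\<forall>x\<in>B0. F x = 0"
    have "E q \<in> sub_tangent_space M N q" if "q \<in> B" for q
      using z BS[OF that] a_zero[of q] by (auto simp: F_def)
    then show ?thesis using oB pB by blast
  next
    assume nz: "\<forall>x\<in>B0. F x \<noteq> 0 \<or> (\<exists>l\<in>?J. partial_deriv l F x \<noteq> 0)"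
    have qD: "q \<in> D" if "q \<in> B" for q
      using nz BS[OF that] inD[of "\<kappa> q"] B0(3) by auto
    have 1: "\<exists>n. normal q n \<and> n \<noteq> 0 \<and> sff_orthogonal q n" if "q \<in> B" for q
      using \<xi>n[of q] \<xi>0'[of q] sffD[OF qD[OF that]] BS[OF that] by blast
    have 2: False if q: "q \<in> B" and C: "open_in N C" "q \<in> C" "\<forall>r\<in>C. E r \<in> sub_tangent_space M N r" for q C
    proof -
      have qS: "q \<in> W" "q \<in> pts N" using BS[OF q] by auto
      have o: "open_in N (C \<inter> ?S)" using C(1) oS by (rule N.open_in_Int)
      have z: "a r = 0" if "r \<in> C \<inter> ?S" for r using a_zero[of r] C(3) that by auto
      have "Y i q a = 0" if i: "i \<in> ?J" for i
      proof -
        have Yq: "Y i q \<in> tangent_space N q" by (rule field_extendsD(5)[OF ext[OF i] qS])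
        have "Y i q a = Y i q (\<lambda>r. 0)" by (rule N.tangent_cong[OF Yq o _ z]) (use C qS in auto)
        then show ?thesis using N.tangent_const[OF Yq] by simp
      qed
      moreover have "a q = 0" using z C(2) qS by auto
      ultimately show False using qD[OF q] by (auto simp: D_def)
    qed
    show ?thesis using oB pB 1 2 by blast
  qed
qed

text \<open>The points near which \<open>\<E>\<close> is tangent form an open set, whose complement is open by the local dichotomy.\<close>

lemma E_tangent_or_agree:
  assumes oE: "\<And>p. p \<in> pts N \<Longrightarrow> sff_orthogonal p (E p - incl M p (EN p))"
  shows "connections_agree M N DM DN \<or> tangent_to M N E"
proof -
  define P where "P q \<longleftrightarrow> (\<exists>C. open_in N C \<and> q \<in> C \<and> (\<forall>r\<in>C. E r \<in> sub_tangent_space M N r))" for q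
  define Q where "Q q \<longleftrightarrow> (\<exists>n. normal q n \<and> n \<noteq> 0 \<and> sff_orthogonal q n)" for q
  have loc: "\<exists>B. open_in N B \<and> p \<in> B \<and> ((\<forall>q\<in>B. P q) \<or> (\<forall>q\<in>B. \<not> P q \<and> Q q))" if p: "p \<in> pts N" for p
  proof -
    obtain B where B: "open_in N B" "p \<in> B" "(\<forall>q\<in>B. E q \<in> sub_tangent_space M N q) \<or> (\<forall>q\<in>B. \<not> P q \<and> Q q)"
      using E_local_dichotomy[OF oE p] unfolding P_def Q_def by blast
    then have "(\<forall>q\<in>B. P q) \<or> (\<forall>q\<in>B. \<not> P q \<and> Q q)" unfolding P_def by blast
    then show ?thesis using B by blast
  qed
  have "(\<forall>p\<in>pts N. P p) \<or> (\<forall>p\<in>pts N. \<not> P p)"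
  proof (rule connected_local_dichotomy[OF connected_N])
    fix p assume "p \<in> pts N"
    then obtain B where "open_in N B" "p \<in> B" "(\<forall>q\<in>B. P q) \<or> (\<forall>q\<in>B. \<not> P q \<and> Q q)" using loc by blast
    then show "\<exists>B. openin (top_of_set (pts N)) B \<and> p \<in> B \<and> ((\<forall>q\<in>B. P q) \<or> (\<forall>q\<in>B. \<not> P q))"
      by (intro exI[of _ B]) (auto simp: open_in_def)
  qed
  then show ?thesis
  proof
    assume "\<forall>p\<in>pts N. P p"
    then show ?thesis unfolding P_def tangent_to_def by blast
  next
    assume n: "\<forall>p\<in>pts N. \<not> P p"
    have "Q p" if "p \<in> pts N" for p using loc[OF that] n that by blast
    then show ?thesis using sff_orthogonal_agree unfolding Q_def by blast
  qed
qed

text \<open>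
  In each case of the right-hand side the normal parts of \<open>e\<close> and \<open>\<E>\<close> are orthogonal to the second
  fundamental form: they are 0 where the field is tangent, and any normal vector is orthogonal to it
  where the connections agree.
\<close>

lemma frobenius_iff:
  "frobenius_manifold N gN mN eN EN \<longleftrightarrow>
     (if tangent_to M N e then connections_agree M N DM DN \<or> tangent_to M N E
      else connections_agree M N DM DN)"
proof -
  have tangent: "sff_orthogonal p (V p - incl M p (proj_field M N g V p))"
    if t: "tangent_to M N V" and p: "p \<in> pts N" for V p
  proof -
    have "V p \<in> sub_tangent_space M N p" using t p unfolding tangent_to_def by blast
    then obtain u where "u \<in> tangent_space N p" "V p = incl M p u" by (rule sub_tangent_spaceE)
    then have "V p - incl M p (proj_field M N g V p) = 0" by (simp add: proj_field_def pr_incl)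
    then show ?thesis using sff_orthogonal_zero[OF p] by simp
  qed
  show ?thesis
  proof (cases "tangent_to M N e")
    case True
    have "frobenius_manifold N gN mN eN EN" if "connections_agree M N DM DN \<or> tangent_to M N E"
      using that
    proof
      assume "connections_agree M N DM DN"
      then show ?thesis
        by (intro frobenius_if_sff_orthogonal agree_sff_orthogonal e_normal E_normal)
    next
      assume "tangent_to M N E"
      then show ?thesis using True by (intro frobenius_if_sff_orthogonal tangent)
    qed
    moreover have "connections_agree M N DM DN \<or> tangent_to M N E" if "frobenius_manifold N gN mN eN EN"
      by (rule E_tangent_or_agree[OF frobenius_imp_sff_orthogonal_E[OF that True]])
    ultimately show ?thesis using True by auto
  next
    case False
    then have nt: "\<forall>p\<in>pts N. e p \<notin> sub_tangent_space M N p"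
      using e_tangent_dichotomy unfolding tangent_to_def by blast
    have "frobenius_manifold N gN mN eN EN" if "connections_agree M N DM DN"
      by (intro frobenius_if_sff_orthogonal agree_sff_orthogonal[OF that] e_normal E_normal)
    moreover have "connections_agree M N DM DN" if F: "frobenius_manifold N gN mN eN EN"
    proof (rule sff_orthogonal_agree)
      fix p assume p: "p \<in> pts N"
      have "e p - incl M p (eN p) \<noteq> 0" using nt p sub_tangent_spaceI[OF eN_in[OF p]] by auto
      then show "\<exists>n. normal p n \<and> n \<noteq> 0 \<and> sff_orthogonal p n"
        using e_normal[OF p] frobenius_imp_sff_orthogonal_e[OF F p] by blast
    qed
    ultimately show ?thesis using False by auto
  qed
qed

end

theorem proposition0p17:
  fixes M N :: "('m::t2_space, 'k::{real_normed_field, euclidean_space}, 'n::finite) manifold"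
    and g :: "('m, 'k) metric_field"
    and m :: "('m, 'k) product_field"
    and e E :: "('m, 'k) vfield"
    and DM DN :: "('m, 'k) covd"
  assumes "frobenius_manifold M g m e E"
    and "is_levi_civita M g DM"
    and "hypersurface M N"
    and "connected (pts N)"
    and "nondegenerate N (restrict_metric M g)"
    and "is_levi_civita N (restrict_metric M g) DN"
    and "is_flat N DN"
  shows "(\<not> tangent_to M N e \<longrightarrow>
            (natural_frobenius_submanifold M N g m e E \<longleftrightarrow>
               product_invariant M N m \<and> connections_agree M N DM DN)) \<and>
         (tangent_to M N e \<longrightarrow>
            (natural_frobenius_submanifold M N g m e E \<longleftrightarrow>
               product_invariant M N m \<and>
               (connections_agree M N DM DN \<or> tangent_to M N E)))"
proof -
  have sub: "submanifold M N" using assms(3) by (simp add: hypersurface_def)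
  have iff: "frobenius_manifold N (restrict_metric M g) (proj_product M N g m) (proj_field M N g e) (proj_field M N g E)
     \<longleftrightarrow> (if tangent_to M N e then connections_agree M N DM DN \<or> tangent_to M N E
          else connections_agree M N DM DN)" if inv: "product_invariant M N m"
  proof -
    have MM: "is_manifold M" "is_metric M g" using assms(1) by (simp_all add: frobenius_manifold_def)
    interpret metric_manifold M g by unfold_locales (fact MM)+
    interpret smooth_submanifold M N by unfold_locales (rule sub)
    interpret metric_submanifold M N g by unfold_locales (rule assms(5))
    interpret frobenius_hypersurface M N g DM DN m e E
    proof unfold_locales
      show "card (idx M) = card (idx N) + 1" using assms(3) by (simp add: hypersurface_def)
    qed (fact assms inv)+
    show ?thesis by (rule frobenius_iff)
  qed
  show ?thesis
    unfolding natural_frobenius_submanifold_def frobenius_submanifold_def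
    using iff sub assms(5) by auto
qed

end
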